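(* Let $\{p_\theta:\theta\in\Theta\}$, $\Theta\subseteq\mathbb{R}$, be a family of probability density functions such that for each $\theta\in\Theta$: the score $s(\theta,y)=\partial\log p_\theta(y)/\partial\theta$ exists, is finite, and has mean zero, $E_\theta\{s(\theta,Y)\}=0$; the score is square-integrable, $\mathcal{I}(\theta)=E_\theta\{s(\theta,Y)^2\}<\infty$; $\mathcal{I}(\cdot)$ is continuous at $\theta$; and $\mathcal{I}(\theta)>0$. Let $(\theta_N)_{N\ge n}$ be the predictive resampling sequence started at the initial value $\theta_n$, i.e. for all $N>n$, $Y_N\sim p_{\theta_{N-1}}$ given $\mathcal{F}_{N-1}$, and $\theta_N=\theta_{N-1}+N^{-1}Z_N$ with $Z_N=\mathcal{I}(\theta_{N-1})^{-1}s(\theta_{N-1},Y_N)$. Assume that the sequence $(Z_N^2)_{N>n}$ is uniformly integrable. Let $\theta_\infty$ be the almost sure limit of $\theta_N$. For $X_N=\theta_N-\theta_{N-1}$, define $$V_N^2=\sum_{i=N+1}^\infty E\left(X_i^2\mid\mathcal{F}_{i-1}\right),\qquad s_N^2=\sum_{i=N+1}^\infty E\left(X_i^2\right)=E\left\{(\theta_\infty-\theta_N)^2\right\}.$$ Then, as $N\to\infty$, $$\frac{V_N^2}{s_N^2}\to\frac{\mathcal{I}(\theta_\infty)^{-1}}{E\{\mathcal{I}(\theta_\infty)^{-1}\}}\quad\text{almost surely},$$ and $$V_N^{-1}(\theta_\infty-\theta_N)\to\mathcal{N}(0,1)\quad\text{in distribution}.$$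
   Context: The densities are on a space $\mathcal{Y}$, and $E_\theta$ is expectation under $Y\sim p_\theta$. The integer $n$ is the number of observed data points $Y_1,\dots,Y_n$; these, and hence the estimate $\theta_n$ computed from them, are treated as fixed, and the only randomness is in the simulated $Y_{n+1},Y_{n+2},\dots$. The filtration is $\mathcal{F}_N=\sigma(Y_{n+1},\dots,Y_N)$. Under the hypotheses $(\theta_N)$ is a martingale bounded in $L_2$, so a finite limit $\theta_\infty$ exists almost surely.
   Formalization: It is additionally assumed that θ_∞ lies in Θ almost surely (automatic when Θ is closed), since otherwise I(θ_∞) is undefined; joint measurability of the score and θ_N ∈ Θ for all N ≥ n are also made explicit. *)

theory Defs
  imports "HOL-Probability.Probability"
begin

definition model_dist :: "'y measure \<Rightarrow> (real \<Rightarrow> 'y \<Rightarrow> real) \<Rightarrow> real \<Rightarrow> 'y measure" where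
  "model_dist \<mu> p \<theta> = density \<mu> (\<lambda>y. ennreal (p \<theta> y))"

(* "The partial derivative of log p(y) at \<theta> exists in \<Theta>, is finite, and equals D".
   The derivative is taken within \<Theta>, because p carries no information outside \<Theta>; at interior
   points this is the ordinary derivative. At an isolated point of \<Theta> every D would be a derivative
   within \<Theta>, hence the limit point condition. The library has ln 0 = 0, whereas log 0 is -infinity
   here, so positivity of the densities near \<theta> is required explicitly. *)
definition has_score :: "(real \<Rightarrow> 'y \<Rightarrow> real) \<Rightarrow> real set \<Rightarrow> real \<Rightarrow> 'y \<Rightarrow> real \<Rightarrow> bool" where
  "has_score p \<Theta> \<theta> y D \<longleftrightarrow>
     \<theta> islimpt \<Theta> \<and> p \<theta> y > 0 \<and> (\<forall>\<^sub>F t in at \<theta> within \<Theta>. p t y > 0) \<and>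
     ((\<lambda>t. ln (p t y)) has_real_derivative D) (at \<theta> within \<Theta>)"

definition score :: "(real \<Rightarrow> 'y \<Rightarrow> real) \<Rightarrow> real set \<Rightarrow> real \<Rightarrow> 'y \<Rightarrow> real" where
  "score p \<Theta> \<theta> y = (if \<exists>D. has_score p \<Theta> \<theta> y D then THE D. has_score p \<Theta> \<theta> y D else 0)"

definition fisher :: "'y measure \<Rightarrow> (real \<Rightarrow> 'y \<Rightarrow> real) \<Rightarrow> real set \<Rightarrow> real \<Rightarrow> real" where
  "fisher \<mu> p \<Theta> \<theta> = (\<integral>y. (score p \<Theta> \<theta> y)\<^sup>2 \<partial>model_dist \<mu> p \<theta>)"

(* The sigma-algebra generated by Y (n+1), ..., Y N; it is trivial for N \<le> n. *)
definition past :: "'w measure \<Rightarrow> 'y measure \<Rightarrow> (nat \<Rightarrow> 'w \<Rightarrow> 'y) \<Rightarrow> nat \<Rightarrow> nat \<Rightarrow> 'w measure" where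
  "past M \<mu> Y n N =
     sigma (space M) (\<Union>i\<in>{n<..N}. {Y i -` A \<inter> space M | A. A \<in> sets \<mu>})"

definition Zinc :: "'y measure \<Rightarrow> (real \<Rightarrow> 'y \<Rightarrow> real) \<Rightarrow> real set \<Rightarrow> (nat \<Rightarrow> 'w \<Rightarrow> 'y) \<Rightarrow>
    (nat \<Rightarrow> 'w \<Rightarrow> real) \<Rightarrow> nat \<Rightarrow> 'w \<Rightarrow> real" where
  "Zinc \<mu> p \<Theta> Y \<theta> N \<omega> =
     inverse (fisher \<mu> p \<Theta> (\<theta> (N - 1) \<omega>)) * score p \<Theta> (\<theta> (N - 1) \<omega>) (Y N \<omega>)"

(* The conditional law of Y N is the usual version-based one: for each measurable A, the
   conditional probability of Y N \<in> A is almost surely the integral of the density over A. *)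
definition predictive_resampling :: "'w measure \<Rightarrow> 'y measure \<Rightarrow> (real \<Rightarrow> 'y \<Rightarrow> real) \<Rightarrow> real set \<Rightarrow>
    nat \<Rightarrow> real \<Rightarrow> (nat \<Rightarrow> 'w \<Rightarrow> 'y) \<Rightarrow> (nat \<Rightarrow> 'w \<Rightarrow> real) \<Rightarrow> bool" where
  "predictive_resampling M \<mu> p \<Theta> n t0 Y \<theta> \<longleftrightarrow>
     (\<forall>\<omega>\<in>space M. \<theta> n \<omega> = t0) \<and>
     (\<forall>N\<ge>n. \<forall>\<omega>\<in>space M. \<theta> N \<omega> \<in> \<Theta>) \<and>
     (\<forall>N>n. Y N \<in> measurable M \<mu>) \<and>
     (\<forall>N>n. \<forall>A\<in>sets \<mu>. AE \<omega> in M.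
        real_cond_exp M (past M \<mu> Y n (N - 1)) (\<lambda>\<omega>'. indicator A (Y N \<omega>')) \<omega>
          = measure (model_dist \<mu> p (\<theta> (N - 1) \<omega>)) A) \<and>
     (\<forall>N>n. \<forall>\<omega>\<in>space M. \<theta> N \<omega> = \<theta> (N - 1) \<omega> + (1 / real N) * Zinc \<mu> p \<Theta> Y \<theta> N \<omega>)"

definition uniformly_integrable :: "'w measure \<Rightarrow> 'i set \<Rightarrow> ('i \<Rightarrow> 'w \<Rightarrow> real) \<Rightarrow> bool" where
  "uniformly_integrable M I f \<longleftrightarrow>
     (\<forall>i\<in>I. f i \<in> borel_measurable M) \<and>
     ((\<lambda>K::real. SUP i\<in>I. \<integral>\<^sup>+\<omega>. ennreal \<bar>f i \<omega>\<bar> * indicator {\<omega>. \<bar>f i \<omega>\<bar> > K} \<omega> \<partial>M) \<longlongrightarrow> 0) at_top"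

definition theta_inf :: "(nat \<Rightarrow> 'w \<Rightarrow> real) \<Rightarrow> 'w \<Rightarrow> real" where
  "theta_inf \<theta> \<omega> = lim (\<lambda>N. \<theta> N \<omega>)"

definition incr :: "(nat \<Rightarrow> 'w \<Rightarrow> real) \<Rightarrow> nat \<Rightarrow> 'w \<Rightarrow> real" where
  "incr \<theta> N \<omega> = \<theta> N \<omega> - \<theta> (N - 1) \<omega>"

definition cond_var :: "'w measure \<Rightarrow> 'y measure \<Rightarrow> (nat \<Rightarrow> 'w \<Rightarrow> 'y) \<Rightarrow> nat \<Rightarrow>
    (nat \<Rightarrow> 'w \<Rightarrow> real) \<Rightarrow> nat \<Rightarrow> 'w \<Rightarrow> real" where
  "cond_var M \<mu> Y n \<theta> i = real_cond_exp M (past M \<mu> Y n (i - 1)) (\<lambda>\<omega>. (incr \<theta> i \<omega>)\<^sup>2)"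

(* V_sq and s_sq are the sums over all i \<ge> N + 1. *)
definition V_sq :: "'w measure \<Rightarrow> 'y measure \<Rightarrow> (nat \<Rightarrow> 'w \<Rightarrow> 'y) \<Rightarrow> nat \<Rightarrow>
    (nat \<Rightarrow> 'w \<Rightarrow> real) \<Rightarrow> nat \<Rightarrow> 'w \<Rightarrow> real" where
  "V_sq M \<mu> Y n \<theta> N \<omega> = (\<Sum>j. cond_var M \<mu> Y n \<theta> (N + 1 + j) \<omega>)"

definition s_sq :: "'w measure \<Rightarrow> (nat \<Rightarrow> 'w \<Rightarrow> real) \<Rightarrow> nat \<Rightarrow> real" where
  "s_sq M \<theta> N = (\<Sum>j. \<integral>\<omega>. (incr \<theta> (N + 1 + j) \<omega>)\<^sup>2 \<partial>M)"

(* The Fisher information is unspecified off \<Theta>, and the limit lies in \<Theta> only almost surely, so its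
   reciprocal at the limit is a random variable only up to a null set. Its expectation is therefore
   taken over the completion of M, which gives the integral over M for M-measurable functions. *)
definition mean_inv_fisher :: "'w measure \<Rightarrow> 'y measure \<Rightarrow> (real \<Rightarrow> 'y \<Rightarrow> real) \<Rightarrow> real set \<Rightarrow>
    (nat \<Rightarrow> 'w \<Rightarrow> real) \<Rightarrow> real" where
  "mean_inv_fisher M \<mu> p \<Theta> \<theta> =
     (\<integral>\<omega>. inverse (fisher \<mu> p \<Theta> (theta_inf \<theta> \<omega>)) \<partial>completion M)"

end

theory Submission
  imports Defs
begin

text \<open>
  Write \<open>\<zeta> k = Z (k + 1)\<close> and \<open>g k = 1 / I(\<theta> k)\<close>. The conditional law of \<open>Y (k + 1)\<close> gives
  \<open>E(H \<zeta> k) = 0\<close> and \<open>E(H (\<zeta> k)\<^sup>2) = E(H g k)\<close> for every \<open>F k\<close>-measurable \<open>H\<close>, so \<open>\<theta>\<close> is an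
  \<open>L\<^sub>2\<close>-bounded martingale whose tail variances are \<open>\<Sum>i>N. E(g (i - 1)) / i\<^sup>2\<close>. Since \<open>g k\<close> converges
  almost surely and, by uniform integrability, in \<open>L\<^sub>1\<close>, both \<open>N V\<^sub>N\<^sup>2\<close> and \<open>N s\<^sub>N\<^sup>2\<close> converge.

  For the central limit theorem let \<open>a\<close> be bounded and \<open>F N\<close>-measurable. The expectations of
  \<open>exp(i a \<surd>N (\<theta> m - \<theta> N)) exp(- a\<^sup>2 g N N / (2 m))\<close> interpolate between \<open>exp(- a\<^sup>2 g N / 2)\<close> at
  \<open>m = N\<close> and the characteristic function of \<open>a \<surd>N (\<theta>\<^sub>\<infinity> - \<theta> N)\<close> as \<open>m\<close> tends to infinity. By a second
  order Taylor expansion each step changes them by at most \<open>N / (m (m + 1))\<close> times a quantity that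
  vanishes with \<open>N\<close>, and these weights sum to 1. Taking \<open>a = t / max \<delta> \<surd>(g N)\<close> and letting
  \<open>\<delta>\<close> tend to 0 replaces the normalisation by \<open>V\<^sub>N\<close>.
\<close>

section \<open>Deterministic sequences\<close>

text \<open>The obstacle is the normalisation: it stays random in the limit, and it involves the
  conditional variances of all later steps, so at time N it is not yet known. The variance is
  therefore frozen at \<open>g N\<close>, which is known at time N and asymptotically agrees with N
  times the squared normalisation. The share N / m in the interpolation approximates N times the sum
  of 1 / i^2 over i > m, the part of the tail variance still ahead at time m; its differences are
  the telescoping weights. The floor \<delta> is there because \<open>g N\<close> is not bounded
  away from 0, while the expansion needs a bounded multiplier. Only second moments exist, so the
  Taylor remainders are truncated. Uniform integrability enters through the expected excess of a
  squared innovation over a level K; this is convex, so by Jensen's inequality it also controls the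
  conditional variances. The densities are measurable in y for each parameter separately, so the
  conditional laws need not form a measurable kernel. Conditional moments are therefore obtained by
  comparing jointly measurable integrands.\<close>

lemma harmonic_telescope_sums:
  assumes "N \<ge> 1"
  shows "(\<lambda>j. real N / (real (N + j) * real (N + j + 1))) sums 1"
proof -
  have "(\<lambda>j. real N / real (N + j)) \<longlonglongrightarrow> 0"
    by real_asymp
  from telescope_sums'[OF this]
  have "(\<lambda>j. real N / real (N + j) - real N / real (N + Suc j)) sums 1"
    using assms by simp
  moreover have "real N / real (N + j) - real N / real (N + Suc j)
      = real N / (real (N + j) * real (N + j + 1))" for j
    using assms by (simp add: divide_simps) (simp add: algebra_simps)
  ultimately show ?thesis by simp
qed

lemma summable_tail_inverse_squares:
  fixes x :: "nat \<Rightarrow> real"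
  assumes "Bseq x"
  shows "summable (\<lambda>j. x (N + j) / (real (N + j + 1))\<^sup>2)"
proof -
  obtain B where B: "\<And>i. \<bar>x i\<bar> \<le> B"
    using assms unfolding Bseq_def by auto
  have "summable (\<lambda>j. B * inverse (real (Suc j) ^ 2))"
    by (intro summable_mult) (subst summable_Suc_iff, rule inverse_power_summable, simp)
  then show ?thesis
  proof (rule summable_comparison_test'[where N = 0])
    fix j
    have "\<bar>x (N + j)\<bar> * inverse ((real (N + j + 1))\<^sup>2) \<le> B * inverse (real (Suc j) ^ 2)"
      by (intro mult_mono B le_imp_inverse_le power_mono) (use B[of 0] in auto)
    then show "norm (x (N + j) / (real (N + j + 1))\<^sup>2) \<le> B * inverse (real (Suc j) ^ 2)"
      by (simp add: divide_inverse abs_mult)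
  qed
qed

text \<open>Multiplied by N, the weights 1 / (i + 1)^2 become the telescoping probability weights N
  / (i (i + 1)) times i / (i + 1). The sum is thus an average over indices i >= N of the sequence
  \<open>y\<close>, which has the same limit as \<open>x\<close>.\<close>

lemma tail_inverse_squares_limit:
  fixes x :: "nat \<Rightarrow> real"
  assumes "x \<longlonglongrightarrow> c"
  shows "(\<lambda>N. real N * (\<Sum>j. x (N + j) / (real (N + j + 1))\<^sup>2)) \<longlonglongrightarrow> c"
proof (rule LIMSEQ_I)
  fix e :: real assume "e > 0"
  define y where "y i = x i * (real i / real (i + 1))" for i
  have "(\<lambda>i. real i / real (i + 1)) \<longlonglongrightarrow> 1"
    by real_asymp
  from tendsto_mult[OF assms this] have "y \<longlonglongrightarrow> c"
    unfolding y_def[abs_def] by simp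
  then obtain N0 where N0: "\<And>i. i \<ge> N0 \<Longrightarrow> \<bar>y i - c\<bar> < e / 2"
    using LIMSEQ_D[of y c "e / 2"] \<open>e > 0\<close> by auto
  have "norm (real N * (\<Sum>j. x (N + j) / (real (N + j + 1))\<^sup>2) - c) < e" if N: "N \<ge> max 1 N0" for N
  proof -
    let ?w = "\<lambda>j. real N / (real (N + j) * real (N + j + 1))"
    have w: "?w sums 1" using harmonic_telescope_sums[of N] N by simp
    have xs: "summable (\<lambda>j. x (N + j) / (real (N + j + 1))\<^sup>2)"
      using assms by (intro summable_tail_inverse_squares convergent_imp_Bseq convergentI)
    from sums_mult[OF summable_sums[OF this], of "real N"]
    have "(\<lambda>j. real N * (x (N + j) / (real (N + j + 1))\<^sup>2)) sums
        (real N * (\<Sum>j. x (N + j) / (real (N + j + 1))\<^sup>2))" .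
    moreover have "real N * (x (N + j) / (real (N + j + 1))\<^sup>2) = ?w j * y (N + j)" for j
      using N unfolding y_def by (simp add: divide_simps power2_eq_square)
    ultimately have "(\<lambda>j. ?w j * y (N + j)) sums
        (real N * (\<Sum>j. x (N + j) / (real (N + j + 1))\<^sup>2))" by simp
    from sums_diff[OF this sums_mult2[OF w, of c]]
    have d: "(\<lambda>j. ?w j * (y (N + j) - c)) sums
        (real N * (\<Sum>j. x (N + j) / (real (N + j + 1))\<^sup>2) - c)"
      by (simp add: right_diff_distrib)
    have le: "norm (?w j * (y (N + j) - c)) \<le> ?w j * (e / 2)" for j
    proof -
      have "norm (?w j * (y (N + j) - c)) = ?w j * \<bar>y (N + j) - c\<bar>"
        unfolding real_norm_def abs_mult by (subst abs_of_nonneg) auto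
      then show ?thesis
        using N N0[of "N + j"] by (simp only:) (intro mult_left_mono, auto)
    qed
    have "norm (\<Sum>j. ?w j * (y (N + j) - c)) \<le> (\<Sum>j. ?w j * (e / 2))"
      by (rule norm_suminf_le[OF le]) (rule sums_summable[OF sums_mult2[OF w]])
    also have "(\<Sum>j. ?w j * (e / 2)) = e / 2"
      using sums_mult2[OF w, of "e / 2"] by (simp add: sums_iff)
    finally show ?thesis
      using d \<open>e > 0\<close> by (simp add: sums_iff)
  qed
  then show "\<exists>no. \<forall>N\<ge>no. norm (real N * (\<Sum>j. x (N + j) / (real (N + j + 1))\<^sup>2) - c) < e"
    by blast
qed

section \<open>Convergence of a real sequence through blocks between consecutive cubes\<close>

lemma cube_block_exists:
  fixes j K :: nat
  assumes "j \<ge> K ^ 3"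
  shows "\<exists>k\<ge>K. k ^ 3 \<le> j \<and> j < (k + 1) ^ 3"
proof -
  \<comment> \<open>\<open>GREATEST\<close> is meaningful only for a bounded predicate; k is at most
    its own cube, hence at most j.\<close>
  have ub: "\<forall>k. k ^ 3 \<le> j \<longrightarrow> k \<le> j"
    by (metis le_trans self_le_power nat_le_linear less_one not_le zero_less_numeral le0)
  define k where "k = (GREATEST k. k ^ 3 \<le> j)"
  have "k ^ 3 \<le> j" unfolding k_def
    by (rule GreatestI_nat[of _ K j]) (use assms ub in auto)
  moreover have "K \<le> k" unfolding k_def
    by (rule Greatest_le_nat[of _ K j]) (use assms ub in auto)
  moreover have "\<not> (k + 1) ^ 3 \<le> j"
    using Greatest_le_nat[of "\<lambda>k. k ^ 3 \<le> j" "k + 1" j] ub unfolding k_def by fastforce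
  ultimately show ?thesis by auto
qed

text \<open>With increments of variance \<open>O(1/i\<^sup>2)\<close> the blocks between consecutive cubes make Cauchy-Schwarz
  good enough for almost sure convergence, without a maximal inequality.\<close>

lemma convergent_of_cube_blocks:
  fixes x :: "nat \<Rightarrow> real"
  assumes d: "summable (\<lambda>k. (real (k + 1))\<^sup>2 * (x ((k + 1) ^ 3) - x (k ^ 3))\<^sup>2)"
    and q: "summable (\<lambda>k. (real (k + 1))\<^sup>2 * (\<Sum>i\<in>{k ^ 3..<(k + 1) ^ 3}. (x (Suc i) - x i)\<^sup>2))"
  shows "convergent x"
proof -
  have "summable (\<lambda>k. 1 / (real (k + 1))\<^sup>2 + (real (k + 1))\<^sup>2 * (x ((k + 1) ^ 3) - x (k ^ 3))\<^sup>2)"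
    using summable_Suc_iff[of "\<lambda>n. inverse (real n ^ 2)"] inverse_power_summable[of 2, where 'a = real]
    by (intro summable_add d) (simp add: divide_inverse)
  then have sum: "summable (\<lambda>k. x (Suc k ^ 3) - x (k ^ 3))"
  proof (rule summable_comparison_test'[where N = 0])
    fix k
    \<comment> \<open>The weights make \<open>?a * ?b\<close> the block increment, so that 2ab <=
      a^2 + b^2 trades absolute summability for the weighted squares in \<open>d\<close> and the
      convergent series of inverse squares.\<close>
    let ?a = "1 / real (k + 1)" and ?b = "real (k + 1) * \<bar>x ((k + 1) ^ 3) - x (k ^ 3)\<bar>"
    have "0 \<le> (?a - ?b)\<^sup>2" by simp
    also have "\<dots> = ?a\<^sup>2 + ?b\<^sup>2 - 2 * (?a * ?b)"
      by (simp only: power2_diff)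
    also have "?a * ?b = \<bar>x ((k + 1) ^ 3) - x (k ^ 3)\<bar>" by simp
    finally have "2 * \<bar>x ((k + 1) ^ 3) - x (k ^ 3)\<bar> \<le> ?a\<^sup>2 + ?b\<^sup>2" by linarith
    then have "\<bar>x ((k + 1) ^ 3) - x (k ^ 3)\<bar> \<le> ?a\<^sup>2 + ?b\<^sup>2"
      by (rule order_trans[rotated]) simp
    then show "norm (x (Suc k ^ 3) - x (k ^ 3))
        \<le> 1 / (real (k + 1))\<^sup>2 + (real (k + 1))\<^sup>2 * (x ((k + 1) ^ 3) - x (k ^ 3))\<^sup>2"
      by (simp add: power_mult_distrib power_divide)
  qed
  have "convergent (\<lambda>k. x (k ^ 3))"
  proof -
    have "(\<lambda>m. \<Sum>k<m. x (Suc k ^ 3) - x (k ^ 3)) \<longlonglongrightarrow> (\<Sum>k. x (Suc k ^ 3) - x (k ^ 3))"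
      using sum by (rule summable_LIMSEQ)
    then have "(\<lambda>m. x (m ^ 3) - x 0) \<longlonglongrightarrow> (\<Sum>k. x (Suc k ^ 3) - x (k ^ 3))"
      by (simp add: sum_lessThan_telescope[where f = "\<lambda>k. x (k ^ 3)"])
    from tendsto_add[OF this tendsto_const[of "x 0"]] show ?thesis
      by (auto simp: convergent_def)
  qed
  then obtain c where c: "(\<lambda>k. x (k ^ 3)) \<longlonglongrightarrow> c" by (auto simp: convergent_def)
  have q0: "(\<lambda>k. (real (k + 1))\<^sup>2 * (\<Sum>i\<in>{k ^ 3..<(k + 1) ^ 3}. (x (Suc i) - x i)\<^sup>2)) \<longlonglongrightarrow> 0"
    using q by (rule summable_LIMSEQ_zero)
  \<comment> \<open>A block has 3 k^2 + 3 k + 1 <= 3 (k + 1)^2 steps. Cauchy-Schwarz against the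
    constant 1 costs this factor, which is why \<open>q\<close> carries the weight (k +
    1)^2.\<close>
  have osc: "(x j - x (k ^ 3))\<^sup>2 \<le>
      3 * ((real (k + 1))\<^sup>2 * (\<Sum>i\<in>{k ^ 3..<(k + 1) ^ 3}. (x (Suc i) - x i)\<^sup>2))"
    if "k ^ 3 \<le> j" "j < (k + 1) ^ 3" for j k
  proof -
    have "x j - x (k ^ 3) = (\<Sum>i\<in>{k ^ 3..<j}. x (Suc i) - x i)"
      using that by (simp add: sum_Suc_diff')
    then have "(x j - x (k ^ 3))\<^sup>2 \<le> (\<Sum>i\<in>{k ^ 3..<j}. 1\<^sup>2) * (\<Sum>i\<in>{k ^ 3..<j}. (x (Suc i) - x i)\<^sup>2)"
      using Cauchy_Schwarz_ineq_sum[of "\<lambda>_. 1" "\<lambda>i. x (Suc i) - x i" "{k ^ 3..<j}"] by simp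
    also have "\<dots> \<le> (3 * (real (k + 1))\<^sup>2) * (\<Sum>i\<in>{k ^ 3..<(k + 1) ^ 3}. (x (Suc i) - x i)\<^sup>2)"
    proof (intro mult_mono sum_mono2)
      have "real j - real (k ^ 3) \<le> real ((k + 1) ^ 3) - real (k ^ 3)"
        using that by (intro diff_right_mono of_nat_mono) auto
      also have "\<dots> \<le> 3 * (real (k + 1))\<^sup>2"
        by (simp add: power2_eq_square power3_eq_cube algebra_simps)
      finally show "(\<Sum>i\<in>{k ^ 3..<j}. 1\<^sup>2) \<le> 3 * (real (k + 1))\<^sup>2"
        using that by (simp add: of_nat_diff)
    qed (use that in \<open>auto intro: sum_nonneg\<close>)
    finally show ?thesis by (simp add: mult.assoc)
  qed
  have "x \<longlonglongrightarrow> c"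
  proof (rule LIMSEQ_I)
    fix e :: real assume e: "e > 0"
    obtain K1 where K1: "\<And>k. k \<ge> K1 \<Longrightarrow> \<bar>x (k ^ 3) - c\<bar> < e / 2"
      using LIMSEQ_D[OF c, of "e / 2"] e by auto
    obtain K2 where K2: "\<And>k. k \<ge> K2 \<Longrightarrow>
        (real (k + 1))\<^sup>2 * (\<Sum>i\<in>{k ^ 3..<(k + 1) ^ 3}. (x (Suc i) - x i)\<^sup>2) < (e / 2)\<^sup>2 / 3"
      using order_tendstoD(2)[OF q0, of "(e / 2)\<^sup>2 / 3"] e
      unfolding eventually_sequentially by auto
    show "\<exists>no. \<forall>j\<ge>no. norm (x j - c) < e"
    proof (intro exI allI impI)
      fix j assume "j \<ge> (max K1 K2) ^ 3"
      then obtain k where k: "k \<ge> max K1 K2" "k ^ 3 \<le> j" "j < (k + 1) ^ 3"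
        using cube_block_exists by blast
      have "(x j - x (k ^ 3))\<^sup>2 < (e / 2)\<^sup>2"
        using osc[OF k(2,3)] K2[of k] k(1) by simp
      then have "\<bar>x j - x (k ^ 3)\<bar> < e / 2"
        using e by (intro power2_less_imp_less[of "\<bar>x j - x (k ^ 3)\<bar>"]) auto
      moreover have "\<bar>x (k ^ 3) - c\<bar> < e / 2" using K1[of k] k(1) by simp
      ultimately show "norm (x j - c) < e" unfolding real_norm_def by linarith
    qed
  qed
  then show ?thesis by (rule convergentI)
qed

section \<open>Martingales with increments of order 1/k\<close>

text \<open>Fatou's lemma for Bochner integrals. Only a tail matters to the lower limit, so the
  bound may start at \<open>k0\<close>; this is what a Cauchy estimate for k >= m provides.\<close>

lemma fatou_expectation_bound:
  fixes f :: "nat \<Rightarrow> 'a \<Rightarrow> real"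
  assumes f: "\<And>k. integrable M (f k)" "\<And>k. AE x in M. 0 \<le> f k x"
    and [measurable]: "h \<in> borel_measurable M"
    and lim: "AE x in M. (\<lambda>k. f k x) \<longlonglongrightarrow> h x"
    and le: "\<And>k. k \<ge> k0 \<Longrightarrow> (\<integral>x. f k x \<partial>M) \<le> r"
  shows "integrable M h" "(\<integral>x. h x \<partial>M) \<le> r"
proof -
  have [measurable]: "f k \<in> borel_measurable M" for k using f(1) by auto
  have nn: "AE x in M. \<forall>k. 0 \<le> f k x" using f(2) by (simp add: AE_all_countable)
  have h: "AE x in M. 0 \<le> h x"
    using nn lim by eventually_elim (auto intro: LIMSEQ_le_const)
  have r: "0 \<le> r"
    using le[of k0] integral_nonneg_AE[OF f(2)[of k0]] by simp
  have "(\<integral>\<^sup>+ x. ennreal (h x) \<partial>M) = (\<integral>\<^sup>+ x. liminf (\<lambda>k. ennreal (f k x)) \<partial>M)"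
    using lim by (intro nn_integral_cong_AE, eventually_elim)
      (intro lim_imp_Liminf[symmetric] tendsto_ennrealI, auto)
  also have "\<dots> \<le> liminf (\<lambda>k. \<integral>\<^sup>+ x. ennreal (f k x) \<partial>M)"
    by (rule nn_integral_liminf) simp
  also have "\<dots> \<le> ennreal r"
  proof (rule Liminf_le)
    show "\<forall>\<^sub>F k in sequentially. (\<integral>\<^sup>+ x. ennreal (f k x) \<partial>M) \<le> ennreal r"
      using eventually_ge_at_top[of k0]
      by eventually_elim (subst nn_integral_eq_integral[OF f], auto intro: ennreal_leI le)
  qed simp
  finally have *: "(\<integral>\<^sup>+ x. ennreal (h x) \<partial>M) \<le> ennreal r" .
  show "integrable M h"
    using * h by (intro integrableI_nonneg) (auto simp: order_le_less_trans)
  then show "(\<integral>x. h x \<partial>M) \<le> r"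
    using * r h by (simp add: nn_integral_eq_integral)
qed

section \<open>Second moments and their limits\<close>

lemma integrable_mult_of_squares:
  fixes f g :: "'a \<Rightarrow> real"
  assumes [measurable]: "f \<in> borel_measurable M" "g \<in> borel_measurable M"
    and "integrable M (\<lambda>x. (f x)\<^sup>2)" "integrable M (\<lambda>x. (g x)\<^sup>2)"
  shows "integrable M (\<lambda>x. f x * g x)" "integrable M (\<lambda>x. (f x + g x)\<^sup>2)"
proof -
  show "integrable M (\<lambda>x. f x * g x)"
  proof (rule Bochner_Integration.integrable_bound[OF Bochner_Integration.integrable_add[OF assms(3,4)]])
    have "\<bar>a * b\<bar> \<le> a\<^sup>2 + b\<^sup>2" for a b :: real
    proof -
      have "2 * \<bar>a * b\<bar> \<le> a\<^sup>2 + b\<^sup>2"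
        using sum_squares_bound[of "\<bar>a\<bar>" "\<bar>b\<bar>"] by (simp add: abs_mult)
      moreover have "0 \<le> \<bar>a * b\<bar>" by simp
      ultimately show ?thesis by linarith
    qed
    then show "AE x in M. norm (f x * g x) \<le> norm ((f x)\<^sup>2 + (g x)\<^sup>2)" by simp
  qed simp
  then have "integrable M (\<lambda>x. (f x)\<^sup>2 + (g x)\<^sup>2 + 2 * (f x * g x))"
    using assms by simp
  then show "integrable M (\<lambda>x. (f x + g x)\<^sup>2)"
    by (simp add: power2_sum mult.assoc)
qed

text \<open>Letting k tend to infinity in the Cauchy bound, Fatou's lemma puts the mean square
  distance of \<open>f m\<close> and \<open>h\<close> below \<open>r m\<close>; second moments are
  continuous for this distance.\<close>

lemma L2_Cauchy_limit:
  fixes f :: "nat \<Rightarrow> 'a \<Rightarrow> real"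
  assumes [measurable]: "\<And>m. f m \<in> borel_measurable M" "h \<in> borel_measurable M"
    and sq: "\<And>m. integrable M (\<lambda>x. (f m x)\<^sup>2)"
    and lim: "AE x in M. (\<lambda>m. f m x) \<longlonglongrightarrow> h x"
    and cauchy: "\<And>m k. m \<le> k \<Longrightarrow> (\<integral>x. (f k x - f m x)\<^sup>2 \<partial>M) \<le> r m"
    and r: "r \<longlonglongrightarrow> 0"
  shows "integrable M (\<lambda>x. (h x)\<^sup>2)" "(\<lambda>m. \<integral>x. (f m x)\<^sup>2 \<partial>M) \<longlonglongrightarrow> (\<integral>x. (h x)\<^sup>2 \<partial>M)"
proof -
  have diff: "integrable M (\<lambda>x. (f k x - f m x)\<^sup>2)" for k m
    using integrable_mult_of_squares(2)[of "f k" M "\<lambda>x. - f m x"] sq by simp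
  have lim': "AE x in M. (\<lambda>k. (f k x - f m x)\<^sup>2) \<longlonglongrightarrow> (h x - f m x)\<^sup>2" for m
    using lim by eventually_elim (intro tendsto_intros)
  have hm: "integrable M (\<lambda>x. (h x - f m x)\<^sup>2)" "(\<integral>x. (h x - f m x)\<^sup>2 \<partial>M) \<le> r m" for m
    by (rule fatou_expectation_bound[OF diff _ _ lim' cauchy]; simp)+
  show hsq: "integrable M (\<lambda>x. (h x)\<^sup>2)"
    using integrable_mult_of_squares(2)[of "\<lambda>x. h x - f 0 x" M "f 0"] hm(1) sq by simp
  have upper: "(\<integral>x. (u x)\<^sup>2 \<partial>M) \<le> (1 + e) * (\<integral>x. (v x)\<^sup>2 \<partial>M) + (1 + 1 / e) * (\<integral>x. (u x - v x)\<^sup>2 \<partial>M)"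
    if "e > 0" "integrable M (\<lambda>x. (u x)\<^sup>2)" "integrable M (\<lambda>x. (v x)\<^sup>2)" "integrable M (\<lambda>x. (u x - v x)\<^sup>2)"
    for e :: real and u v :: "'a \<Rightarrow> real"
  proof -
    \<comment> \<open>Young's inequality on the cross term: it compares second moments in both
      directions without square roots, at the price of a factor 1 + e.\<close>
    have pw: "a\<^sup>2 \<le> (1 + e) * b\<^sup>2 + (1 + 1 / e) * (a - b)\<^sup>2" for a b :: real
    proof -
      have "0 \<le> (e * b - (a - b))\<^sup>2 / e" using \<open>e > 0\<close> by simp
      also have "\<dots> = (1 + e) * b\<^sup>2 + (1 + 1 / e) * (a - b)\<^sup>2 - a\<^sup>2"
        using \<open>e > 0\<close> by (simp add: field_simps power2_eq_square)
      finally show ?thesis by simp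
    qed
    have "(\<integral>x. (u x)\<^sup>2 \<partial>M) \<le> (\<integral>x. (1 + e) * (v x)\<^sup>2 + (1 + 1 / e) * (u x - v x)\<^sup>2 \<partial>M)"
      using that pw by (intro integral_mono) auto
    then show ?thesis using that by simp
  qed
  let ?I = "\<integral>x. (h x)\<^sup>2 \<partial>M"
  have I0: "?I \<ge> 0" by simp
  show "(\<lambda>m. \<integral>x. (f m x)\<^sup>2 \<partial>M) \<longlonglongrightarrow> ?I"
  proof (rule tendstoI)
    fix \<epsilon> :: real assume "\<epsilon> > 0"
    \<comment> \<open>The denominator contains \<open>?I + 1\<close> since \<open>?I\<close> may
      vanish; the cap 1 absorbs the product of \<open>e\<close> with \<epsilon> / 2 in the converse
      estimate.\<close>
    define e where "e = min 1 (\<epsilon> / (4 * (?I + 1)))"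
    have e: "e > 0" "e * ?I \<le> \<epsilon> / 4" "e \<le> 1"
    proof -
      have "\<epsilon> / (4 * (?I + 1)) > 0" using \<open>\<epsilon> > 0\<close> I0 by (intro divide_pos_pos mult_pos_pos) linarith+
      then show "e > 0" "e \<le> 1" by (auto simp: e_def)
      have "e * ?I \<le> (\<epsilon> / (4 * (?I + 1))) * ?I" unfolding e_def using I0 by (intro mult_right_mono) auto
      also have "\<dots> = (\<epsilon> * ?I) / (4 * (?I + 1))" by simp
      also have "\<dots> \<le> (\<epsilon> * (?I + 1)) / (4 * (?I + 1))"
        using I0 \<open>\<epsilon> > 0\<close> by (intro divide_right_mono mult_left_mono mult_nonneg_nonneg) linarith+
      also have "\<dots> = \<epsilon> / 4"
      proof -
        have "\<epsilon> * J / (4 * J) = \<epsilon> / 4" if "J \<noteq> 0" for J using that by simp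
        moreover have "?I + 1 \<noteq> 0" using I0 by linarith
        ultimately show ?thesis by blast
      qed
      finally show "e * ?I \<le> \<epsilon> / 4" .
    qed
    have "(\<lambda>m. (1 + 1 / e) * r m) \<longlonglongrightarrow> (1 + 1 / e) * 0"
      by (intro tendsto_intros r)
    then have "\<forall>\<^sub>F m in sequentially. (1 + 1 / e) * r m < \<epsilon> / 4"
      using \<open>\<epsilon> > 0\<close> by (intro order_tendstoD(2)[where y = 0]) auto
    then show "\<forall>\<^sub>F m in sequentially. dist (\<integral>x. (f m x)\<^sup>2 \<partial>M) ?I < \<epsilon>"
    proof eventually_elim
      fix m assume m: "(1 + 1 / e) * r m < \<epsilon> / 4"
      have flip: "(\<lambda>x. (f m x - h x)\<^sup>2) = (\<lambda>x. (h x - f m x)\<^sup>2)" by (simp add: power2_commute)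
      have D: "(1 + 1 / e) * (\<integral>x. (h x - f m x)\<^sup>2 \<partial>M) \<le> (1 + 1 / e) * r m"
        using e hm(2)[of m] by (intro mult_left_mono) auto
      have a: "(\<integral>x. (f m x)\<^sup>2 \<partial>M) \<le> (1 + e) * ?I + (1 + 1 / e) * (\<integral>x. (h x - f m x)\<^sup>2 \<partial>M)"
        using upper[of e "f m" h] e sq hsq hm(1) by (simp add: flip)
      have b: "?I \<le> (1 + e) * (\<integral>x. (f m x)\<^sup>2 \<partial>M) + (1 + 1 / e) * (\<integral>x. (h x - f m x)\<^sup>2 \<partial>M)"
        using upper[of e h "f m"] e sq hsq hm(1) by simp
      define X where "X = (1 + 1 / e) * (\<integral>x. (h x - f m x)\<^sup>2 \<partial>M)"
      have X: "X < \<epsilon> / 4" unfolding X_def by (rule order.strict_trans1[OF D m])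
      have A: "(\<integral>x. (f m x)\<^sup>2 \<partial>M) < ?I + \<epsilon> / 2"
        using a[folded X_def] X e(2) unfolding distrib_right[of 1 e] by simp
      have "e * (\<integral>x. (f m x)\<^sup>2 \<partial>M) \<le> e * ?I + e * (\<epsilon> / 2)"
        using mult_left_mono[OF less_imp_le[OF A], of e] e by (simp add: algebra_simps)
      also have "\<dots> \<le> \<epsilon> / 4 + \<epsilon> / 2"
        using e \<open>\<epsilon> > 0\<close> mult_right_mono[of e 1 "\<epsilon> / 2"] by linarith
      finally have "?I < (\<integral>x. (f m x)\<^sup>2 \<partial>M) + \<epsilon>"
        using b[folded X_def] X unfolding distrib_right[of 1 e] by simp
      with A show "dist (\<integral>x. (f m x)\<^sup>2 \<partial>M) ?I < \<epsilon>"
        using \<open>\<epsilon> > 0\<close> by (simp add: dist_real_def abs_less_iff)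
    qed
  qed
qed

text \<open>By Tonelli the sum of the series has finite expectation, so it is finite almost
  everywhere.\<close>

lemma AE_summable_of_expectation:
  fixes f :: "nat \<Rightarrow> 'a \<Rightarrow> real"
  assumes f: "\<And>k. integrable M (f k)" "\<And>k. AE x in M. 0 \<le> f k x"
    and "summable (\<lambda>k. \<integral>x. f k x \<partial>M)"
  shows "AE x in M. summable (\<lambda>k. f k x)"
proof -
  have [measurable]: "f k \<in> borel_measurable M" for k using f(1) by auto
  have "(\<integral>\<^sup>+ x. (\<Sum>k. ennreal (f k x)) \<partial>M) = (\<Sum>k. \<integral>\<^sup>+ x. ennreal (f k x) \<partial>M)"
    by (rule nn_integral_suminf) simp
  also have "\<dots> = (\<Sum>k. ennreal (\<integral>x. f k x \<partial>M))"
    using f by (simp add: nn_integral_eq_integral)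
  also have "\<dots> \<noteq> \<infinity>"
    using assms by (subst suminf_ennreal2) (auto intro: integral_nonneg_AE)
  finally have "AE x in M. (\<Sum>k. ennreal (f k x)) \<noteq> \<infinity>"
    by (intro nn_integral_noteq_infinite) auto
  moreover have "AE x in M. \<forall>k. 0 \<le> f k x" using f(2) by (simp add: AE_all_countable)
  ultimately show ?thesis
    by eventually_elim (auto intro: summable_suminf_not_top)
qed

text \<open>\<open>centred\<close> and \<open>variance\<close> say that \<zeta> k has conditional
  mean 0 and conditional second moment \<open>g k\<close> given \<open>F k\<close>; test functions
  express this without choosing versions of conditional expectations. \<open>excess_small\<close> is
  uniform integrability of the squared innovations in a convex form, which survives
  conditioning.\<close>

locale l2_martingale = prob_space M for M :: "'w measure" +
  fixes F :: "nat \<Rightarrow> 'w measure" and \<theta> \<zeta> g :: "nat \<Rightarrow> 'w \<Rightarrow> real"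
  assumes subalg: "\<And>k. subalgebra M (F k)"
    and filtration: "\<And>k. subalgebra (F (Suc k)) (F k)"
    and adapted: "\<And>k. \<theta> k \<in> borel_measurable (F k)"
    and innovation_meas [measurable]: "\<And>k. \<zeta> k \<in> borel_measurable M"
    and var_adapted: "\<And>k. g k \<in> borel_measurable (F k)"
    and step: "\<And>k \<omega>. \<omega> \<in> space M \<Longrightarrow> \<theta> (Suc k) \<omega> = \<theta> k \<omega> + \<zeta> k \<omega> / real (Suc k)"
    and var_nonneg: "\<And>k \<omega>. \<omega> \<in> space M \<Longrightarrow> 0 \<le> g k \<omega>"
    and innovation_sq: "\<And>k. integrable M (\<lambda>\<omega>. (\<zeta> k \<omega>)\<^sup>2)"
    and var_integrable: "\<And>k. integrable M (g k)"
    \<comment> \<open>\<open>H\<close> need not be bounded: if a product is not integrable, its integral is 0.\<close>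
    and centred: "\<And>k H. H \<in> borel_measurable (F k) \<Longrightarrow> (\<integral>\<omega>. H \<omega> * \<zeta> k \<omega> \<partial>M) = 0"
    and variance: "\<And>k H. H \<in> borel_measurable (F k) \<Longrightarrow>
      (\<integral>\<omega>. H \<omega> * (\<zeta> k \<omega>)\<^sup>2 \<partial>M) = (\<integral>\<omega>. H \<omega> * g k \<omega> \<partial>M)"
    and excess_small: "\<And>e. e > 0 \<Longrightarrow> \<exists>K\<ge>0. \<forall>k. (\<integral>\<omega>. max 0 ((\<zeta> k \<omega>)\<^sup>2 - K) \<partial>M) \<le> e"
begin

section \<open>Orthogonality of the increments and almost sure convergence\<close>

lemma filtration_mono:
  assumes "i \<le> j" shows "subalgebra (F j) (F i)"
  using assms
proof (induction j rule: dec_induct)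
  case base show ?case by (simp add: subalgebra_def)
next
  case (step j) then show ?case using filtration[of j] by (auto simp: subalgebra_def)
qed

lemma adapted_mono: "f \<in> measurable (F i) N \<Longrightarrow> i \<le> j \<Longrightarrow> f \<in> measurable (F j) N"
  using filtration_mono measurable_from_subalg by blast

lemma adapted_imp_M: "f \<in> measurable (F i) N \<Longrightarrow> f \<in> measurable M N"
  using subalg measurable_from_subalg by blast

lemma theta_meas [measurable]: "\<theta> k \<in> borel_measurable M"
  using adapted adapted_imp_M by blast

lemma var_meas [measurable]: "g k \<in> borel_measurable M"
  using var_adapted adapted_imp_M by blast

lemma excess_integrable [simp]:
  "integrable M (\<lambda>\<omega>. max 0 ((\<zeta> k \<omega>)\<^sup>2 - K))" "integrable M (\<lambda>\<omega>. max 0 (g k \<omega> - K))"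
  using innovation_sq var_integrable by auto

lemma expectation_innovation_sq: "(\<integral>\<omega>. (\<zeta> k \<omega>)\<^sup>2 \<partial>M) = (\<integral>\<omega>. g k \<omega> \<partial>M)"
  using variance[of "\<lambda>_. 1" k] by simp

lemma expectation_var_nonneg: "0 \<le> (\<integral>\<omega>. g k \<omega> \<partial>M)"
  using var_nonneg by (intro integral_nonneg_AE) auto

lemma variance_bounded: obtains C where "C > 0" "\<And>k. (\<integral>\<omega>. g k \<omega> \<partial>M) \<le> C"
proof -
  obtain K where K: "K \<ge> 0" "\<And>k. (\<integral>\<omega>. max 0 ((\<zeta> k \<omega>)\<^sup>2 - K) \<partial>M) \<le> 1"
    using excess_small[of 1] by auto
  have "(\<integral>\<omega>. g k \<omega> \<partial>M) \<le> K + 1" for k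
  proof -
    have "(\<integral>\<omega>. (\<zeta> k \<omega>)\<^sup>2 \<partial>M) \<le> (\<integral>\<omega>. K + max 0 ((\<zeta> k \<omega>)\<^sup>2 - K) \<partial>M)"
      using innovation_sq by (intro integral_mono) auto
    also have "\<dots> = K + (\<integral>\<omega>. max 0 ((\<zeta> k \<omega>)\<^sup>2 - K) \<partial>M)"
      by (subst Bochner_Integration.integral_add) (auto simp: prob_space)
    finally show ?thesis using K(2)[of k] by (simp add: expectation_innovation_sq)
  qed
  with K(1) that[of "K + 1"] show ?thesis by auto
qed

text \<open>Conditional Jensen inequality for the positive part of x - K, obtained by testing
  \<open>variance\<close> with the indicator of the event \<open>g k > K\<close>. It passes uniform
  integrability from the squared innovations to the conditional variances.\<close>

lemma excess_var_le:
  "(\<integral>\<omega>. max 0 (g k \<omega> - K) \<partial>M) \<le> (\<integral>\<omega>. max 0 ((\<zeta> k \<omega>)\<^sup>2 - K) \<partial>M)"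
proof -
  define H where "H \<omega> = (indicator {K<..} (g k \<omega>) :: real)" for \<omega>
  have [measurable]: "H \<in> borel_measurable (F k)"
    unfolding H_def using var_adapted[of k] by measurable
  then have [measurable]: "H \<in> borel_measurable M" by (rule adapted_imp_M)
  have H: "\<bar>H \<omega>\<bar> \<le> 1" for \<omega> by (simp add: H_def indicator_def)
  have i: "integrable M (\<lambda>\<omega>. H \<omega> * f \<omega>)" if "integrable M f" for f
    by (rule Bochner_Integration.integrable_bound[OF that])
      (use that H in \<open>auto simp: abs_mult mult_left_le_one_le\<close>)
  have "(\<integral>\<omega>. max 0 (g k \<omega> - K) \<partial>M) = (\<integral>\<omega>. H \<omega> * g k \<omega> - H \<omega> * K \<partial>M)"
    by (intro Bochner_Integration.integral_cong) (auto simp: H_def indicator_def)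
  also have "\<dots> = (\<integral>\<omega>. H \<omega> * (\<zeta> k \<omega>)\<^sup>2 - H \<omega> * K \<partial>M)"
    using variance[of H k] i[OF var_integrable[of k]] i[OF innovation_sq[of k]] i[of "\<lambda>_. K"]
    by simp
  also have "\<dots> \<le> (\<integral>\<omega>. max 0 ((\<zeta> k \<omega>)\<^sup>2 - K) \<partial>M)"
    using i[OF innovation_sq[of k]] i[of "\<lambda>_. K"]
    by (intro integral_mono) (auto simp: H_def indicator_def)
  finally show ?thesis .
qed

text \<open>The increments are orthogonal: testing \<open>centred\<close> with the earlier increment
  \<open>?D\<close>, which may be unbounded, removes the cross term. Square integrability belongs to
  the same induction because splitting the integral at the next step depends on it.\<close>

lemma increment_L2:
  "integrable M (\<lambda>\<omega>. (\<theta> (N + m) \<omega> - \<theta> N \<omega>)\<^sup>2) \<and>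
   (\<integral>\<omega>. (\<theta> (N + m) \<omega> - \<theta> N \<omega>)\<^sup>2 \<partial>M) = (\<Sum>j<m. (\<integral>\<omega>. g (N + j) \<omega> \<partial>M) / (real (N + j + 1))\<^sup>2)"
proof (induction m)
  case (Suc m)
  let ?D = "\<lambda>\<omega>. \<theta> (N + m) \<omega> - \<theta> N \<omega>" and ?c = "real (N + m + 1)"
  have D: "?D \<in> borel_measurable (F (N + m))"
    using adapted[of "N + m"] adapted_mono[OF adapted[of N], of "N + m"] by auto
  have iD: "integrable M (\<lambda>\<omega>. (?D \<omega>)\<^sup>2)" using Suc by simp
  have "integrable M (\<lambda>\<omega>. (\<zeta> (N + m) \<omega> / ?c)\<^sup>2)"
    using innovation_sq[of "N + m"] by (simp add: power_divide)
  note i2 = integrable_mult_of_squares[OF _ _ iD this]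
  have iX: "integrable M (\<lambda>\<omega>. ?D \<omega> * \<zeta> (N + m) \<omega>)"
    by (rule integrable_mult_of_squares(1)[OF _ _ iD innovation_sq]) auto
  have eq: "\<theta> (N + Suc m) \<omega> - \<theta> N \<omega> = ?D \<omega> + \<zeta> (N + m) \<omega> / ?c" if "\<omega> \<in> space M" for \<omega>
    using step[OF that, of "N + m"] by (simp add: algebra_simps)
  have "integrable M (\<lambda>\<omega>. (\<theta> (N + Suc m) \<omega> - \<theta> N \<omega>)\<^sup>2)
      \<longleftrightarrow> integrable M (\<lambda>\<omega>. (?D \<omega> + \<zeta> (N + m) \<omega> / ?c)\<^sup>2)"
    by (intro Bochner_Integration.integrable_cong refl) (simp only: eq)
  then have "integrable M (\<lambda>\<omega>. (\<theta> (N + Suc m) \<omega> - \<theta> N \<omega>)\<^sup>2)"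
    using i2(2) by simp
  moreover have "(\<integral>\<omega>. (\<theta> (N + Suc m) \<omega> - \<theta> N \<omega>)\<^sup>2 \<partial>M)
      = (\<integral>\<omega>. (?D \<omega>)\<^sup>2 + (2 / ?c) * (?D \<omega> * \<zeta> (N + m) \<omega>) + (\<zeta> (N + m) \<omega>)\<^sup>2 / ?c\<^sup>2 \<partial>M)"
    by (intro Bochner_Integration.integral_cong refl, simp only: eq)
      (simp add: power2_sum power_divide)
  moreover have "\<dots> = (\<integral>\<omega>. (?D \<omega>)\<^sup>2 \<partial>M) + (\<integral>\<omega>. g (N + m) \<omega> \<partial>M) / ?c\<^sup>2"
    using iD iX innovation_sq[of "N + m"] centred[OF D]
    by (simp add: expectation_innovation_sq del: of_nat_add)
  ultimately show ?case using Suc by simp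
qed simp

lemma summable_variances: "summable (\<lambda>j. (\<integral>\<omega>. g (N + j) \<omega> \<partial>M) / (real (N + j + 1))\<^sup>2)"
proof -
  obtain C where C: "\<And>k. (\<integral>\<omega>. g k \<omega> \<partial>M) \<le> C" using variance_bounded by blast
  have "Bseq (\<lambda>k. \<integral>\<omega>. g k \<omega> \<partial>M)"
    by (rule BseqI'[where K = C]) (use C expectation_var_nonneg in auto)
  then show ?thesis by (rule summable_tail_inverse_squares)
qed

text \<open>By orthogonality the squared increment over a block and the sum of the squared steps in
  it have the same expectation \<open>q k\<close>. Between k^3 and (k + 1)^3 there are O(k^2) steps,
  each of variance O(k^-6), so \<open>q k\<close> is O(k^-4) and stays summable after the weight (k
  + 1)^2.\<close>

lemma converges_AE: "AE \<omega> in M. convergent (\<lambda>k. \<theta> k \<omega>)"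
proof -
  obtain C where C: "C > 0" "\<And>k. (\<integral>\<omega>. g k \<omega> \<partial>M) \<le> C" using variance_bounded by blast
  let ?Q = "\<lambda>k \<omega>. \<Sum>i\<in>{k ^ 3..<(k + 1) ^ 3}. (\<theta> (Suc i) \<omega> - \<theta> i \<omega>)\<^sup>2"
  let ?D = "\<lambda>k \<omega>. (\<theta> ((k + 1) ^ 3) \<omega> - \<theta> (k ^ 3) \<omega>)\<^sup>2"
  define q where "q k = (\<Sum>i\<in>{k ^ 3..<(k + 1) ^ 3}. (\<integral>\<omega>. g i \<omega> \<partial>M) / (real (i + 1))\<^sup>2)" for k :: nat
  have Q: "integrable M (?Q k)" "(\<integral>\<omega>. ?Q k \<omega> \<partial>M) = q k" for k
    using increment_L2[of _ 1] by (auto simp: q_def)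
  have D: "integrable M (?D k)" "(\<integral>\<omega>. ?D k \<omega> \<partial>M) = q k" for k
  proof -
    have le: "k ^ 3 \<le> (k + 1) ^ 3" by (intro power_mono) auto
    then have eq: "k ^ 3 + ((k + 1) ^ 3 - k ^ 3) = (k + 1) ^ 3" by simp
    show "integrable M (?D k)"
      using increment_L2[of "k ^ 3" "(k + 1) ^ 3 - k ^ 3"] unfolding eq by simp
    have "(\<integral>\<omega>. ?D k \<omega> \<partial>M) = (\<Sum>j<(k + 1) ^ 3 - k ^ 3. (\<integral>\<omega>. g (k ^ 3 + j) \<omega> \<partial>M) / (real (k ^ 3 + j + 1))\<^sup>2)"
      using increment_L2[of "k ^ 3" "(k + 1) ^ 3 - k ^ 3"] unfolding eq by blast
    also have "\<dots> = q k"
      unfolding q_def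
      by (rule sum.reindex_bij_witness[of _ "\<lambda>i. i - k ^ 3" "\<lambda>j. k ^ 3 + j"]) (use le in auto)
    finally show "(\<integral>\<omega>. ?D k \<omega> \<partial>M) = q k" .
  qed
  \<comment> \<open>48 is 3 times 16: there are at most 3 (k + 1)^2 steps, and i + 1 >= (k + 1)^3 /
    4, whose square contributes 16.\<close>
  have qle: "(real (k + 1))\<^sup>2 * q k \<le> 48 * C * inverse ((real (Suc k))\<^sup>2)" for k
  proof -
    let ?t = "real (k + 1)"
    \<comment> \<open>Convexity of the cube at the midpoint of k and 1. Comparing with k + 1 instead
      of k also covers the block k = 0.\<close>
    have cube: "?t ^ 3 \<le> 4 * (real k ^ 3 + 1)"
    proof -
      have "4 * (real k ^ 3 + 1) - ?t ^ 3 = 3 * ?t * (real k - 1)\<^sup>2"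
        by (simp add: power2_eq_square power3_eq_cube algebra_simps)
      also have "\<dots> \<ge> 0" by simp
      finally show ?thesis by simp
    qed
    have "q k \<le> (\<Sum>i\<in>{k ^ 3..<(k + 1) ^ 3}. C * (16 / ?t ^ 6))"
      unfolding q_def
    proof (rule sum_mono)
      fix i assume i: "i \<in> {k ^ 3..<(k + 1) ^ 3}"
      have "real k ^ 3 \<le> real i" using i by (metis atLeastLessThan_iff of_nat_le_iff of_nat_power)
      moreover have "a / 4 \<le> c + 1" if "a \<le> 4 * (b + 1)" "b \<le> c" for a b c :: real
        using that by simp
      ultimately have "?t ^ 3 / 4 \<le> real i + 1" using cube by blast
      then have "?t ^ 3 / 4 \<le> real (i + 1)" by simp
      then have "(?t ^ 3 / 4)\<^sup>2 \<le> (real (i + 1))\<^sup>2" by (intro power_mono) auto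
      then have "inverse ((real (i + 1))\<^sup>2) \<le> inverse ((?t ^ 3 / 4)\<^sup>2)"
        by (intro le_imp_inverse_le) auto
      also have "inverse ((?t ^ 3 / 4)\<^sup>2) = 16 / ?t ^ 6"
        by (simp add: power_divide flip: power_mult)
      finally show "(\<integral>\<omega>. g i \<omega> \<partial>M) / (real (i + 1))\<^sup>2 \<le> C * (16 / ?t ^ 6)"
        unfolding divide_inverse[of "\<integral>\<omega>. g i \<omega> \<partial>M"]
        using C expectation_var_nonneg[of i] by (intro mult_mono) auto
    qed
    also have "\<dots> = (real ((k + 1) ^ 3) - real (k ^ 3)) * (C * (16 / ?t ^ 6))"
      by (simp add: of_nat_diff power_mono del: of_nat_add of_nat_power)
    also have "\<dots> \<le> (3 * ?t\<^sup>2) * (C * (16 / ?t ^ 6))"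
      using C by (intro mult_right_mono) (auto simp: power2_eq_square power3_eq_cube algebra_simps)
    finally have "?t\<^sup>2 * q k \<le> ?t\<^sup>2 * ((3 * ?t\<^sup>2) * (C * (16 / ?t ^ 6)))"
      by (intro mult_left_mono) auto
    also have "\<dots> = 48 * C * inverse (?t\<^sup>2)"
      by (simp add: field_simps flip: power_add)
    finally show ?thesis by simp
  qed
  have sq: "summable (\<lambda>k. (real (k + 1))\<^sup>2 * q k)"
  proof (rule summable_comparison_test'[where N = 0])
    show "summable (\<lambda>k. 48 * C * inverse ((real (Suc k))\<^sup>2))"
      by (intro summable_mult) (subst summable_Suc_iff, rule inverse_power_summable, simp)
    have "0 \<le> q k" for k
      unfolding q_def by (intro sum_nonneg divide_nonneg_nonneg expectation_var_nonneg) auto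
    then show "norm ((real (k + 1))\<^sup>2 * q k) \<le> 48 * C * inverse ((real (Suc k))\<^sup>2)" for k
      using qle[of k] by simp
  qed
  have "AE \<omega> in M. summable (\<lambda>k. (real (k + 1))\<^sup>2 * ?D k \<omega>)"
    by (rule AE_summable_of_expectation) (use D sq in \<open>auto simp del: of_nat_add\<close>)
  moreover have "AE \<omega> in M. summable (\<lambda>k. (real (k + 1))\<^sup>2 * ?Q k \<omega>)"
    by (rule AE_summable_of_expectation)
      (use Q sq in \<open>auto simp del: of_nat_add intro!: sum_nonneg mult_nonneg_nonneg\<close>)
  ultimately show ?thesis
    by eventually_elim (rule convergent_of_cube_blocks)
qed

definition "limit \<omega> = lim (\<lambda>k. \<theta> k \<omega>)"

lemma limit_meas [measurable]: "limit \<in> borel_measurable M"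
  unfolding limit_def[abs_def] by measurable

lemma tendsto_limit: "AE \<omega> in M. (\<lambda>k. \<theta> k \<omega>) \<longlonglongrightarrow> limit \<omega>"
  using converges_AE by eventually_elim (simp add: limit_def convergent_LIMSEQ_iff)

text \<open>The increments from N on are Cauchy in mean square with the remainders of the variance
  series as modulus, so their second moments, the partial sums of that series, converge to the
  second moment of the limit.\<close>

lemma limit_L2:
  "integrable M (\<lambda>\<omega>. (limit \<omega> - \<theta> N \<omega>)\<^sup>2)"
  "(\<Sum>j. (\<integral>\<omega>. g (N + j) \<omega> \<partial>M) / (real (N + j + 1))\<^sup>2) = (\<integral>\<omega>. (limit \<omega> - \<theta> N \<omega>)\<^sup>2 \<partial>M)"
proof -
  let ?f = "\<lambda>m \<omega>. \<theta> (N + m) \<omega> - \<theta> N \<omega>"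
  let ?v = "\<lambda>N j. (\<integral>\<omega>. g (N + j) \<omega> \<partial>M) / (real (N + j + 1))\<^sup>2"
  define r where "r m = (\<Sum>j. ?v (N + m) j)" for m
  have nn: "0 \<le> ?v N j" for N j using expectation_var_nonneg by simp
  have lim: "AE \<omega> in M. (\<lambda>m. ?f m \<omega>) \<longlonglongrightarrow> limit \<omega> - \<theta> N \<omega>"
    using tendsto_limit
    by eventually_elim (intro tendsto_intros, subst add.commute, rule LIMSEQ_ignore_initial_segment)
  have cauchy: "(\<integral>\<omega>. (?f k \<omega> - ?f m \<omega>)\<^sup>2 \<partial>M) \<le> r m" if "m \<le> k" for m k
  proof -
    have "N + m + (k - m) = N + k" using that by simp
    with increment_L2[of "N + m" "k - m"]
    have "(\<integral>\<omega>. (?f k \<omega> - ?f m \<omega>)\<^sup>2 \<partial>M) = (\<Sum>j<k - m. ?v (N + m) j)" by simp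
    also have "\<dots> \<le> r m"
      unfolding r_def by (intro sum_le_suminf summable_variances nn) auto
    finally show ?thesis .
  qed
  have "r = (\<lambda>m. \<Sum>j. ?v N (j + m))"
    unfolding r_def by (rule ext) (simp add: ac_simps)
  then have r: "r \<longlonglongrightarrow> 0"
    using suminf_exist_split2[OF summable_variances[of N]] by simp
  note L = L2_Cauchy_limit[where f = ?f and h = "\<lambda>\<omega>. limit \<omega> - \<theta> N \<omega>", OF _ _ _ lim cauchy r]
  show "integrable M (\<lambda>\<omega>. (limit \<omega> - \<theta> N \<omega>)\<^sup>2)"
    by (rule L) (use increment_L2 in auto)
  have "(\<lambda>m. \<integral>\<omega>. (?f m \<omega>)\<^sup>2 \<partial>M) \<longlonglongrightarrow> (\<integral>\<omega>. (limit \<omega> - \<theta> N \<omega>)\<^sup>2 \<partial>M)"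
    by (rule L) (use increment_L2 in auto)
  moreover have "(\<lambda>m. \<integral>\<omega>. (?f m \<omega>)\<^sup>2 \<partial>M) \<longlonglongrightarrow> (\<Sum>j. ?v N j)"
    using summable_LIMSEQ[OF summable_variances[of N]] increment_L2[of N] by simp
  ultimately show "(\<Sum>j. ?v N j) = (\<integral>\<omega>. (limit \<omega> - \<theta> N \<omega>)\<^sup>2 \<partial>M)"
    by (rule LIMSEQ_unique[symmetric])
qed

end

section \<open>The central limit theorem for the tail\<close>

text \<open>The cubic remainder serves small x, the quadratic one large x; the cubic bound alone
  would call for third moments.\<close>

lemma cmod_iexp_second_order:
  "cmod (iexp x - (1 + \<i> * x - (complex_of_real x)\<^sup>2 / 2)) \<le> x\<^sup>2 * min 1 \<bar>x\<bar>"
proof -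
  have sum: "(\<Sum>k\<le>2. (\<i> * complex_of_real x) ^ k / fact k) = 1 + \<i> * x - (complex_of_real x)\<^sup>2 / 2"
    by (simp add: numeral_2_eq_2 power_mult_distrib algebra_simps)
  have "cmod (iexp x - (1 + \<i> * x - (complex_of_real x)\<^sup>2 / 2)) \<le> \<bar>x\<bar> ^ 3 / 6"
    using iexp_approx1[of x 2] unfolding sum by (simp add: eval_nat_numeral)
  also have "\<dots> \<le> \<bar>x\<bar> ^ 3" by simp
  also have "\<bar>x\<bar> ^ 3 = x\<^sup>2 * \<bar>x\<bar>" by (simp add: power3_eq_cube power2_eq_square)
  finally have "cmod (iexp x - (1 + \<i> * x - (complex_of_real x)\<^sup>2 / 2)) \<le> x\<^sup>2 * \<bar>x\<bar>" .
  moreover have "cmod (iexp x - (1 + \<i> * x - (complex_of_real x)\<^sup>2 / 2)) \<le> x\<^sup>2"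
    using iexp_approx2[of x 2] unfolding sum by (simp add: eval_nat_numeral)
  ultimately show ?thesis by (simp add: min_def)
qed

text \<open>Same shape as the bound for \<open>iexp\<close>, so that one truncation argument covers
  both remainders. The quadratic error for small x comes from comparing with 1 / (1 + x).\<close>

lemma exp_minus_first_order:
  assumes "0 \<le> (x :: real)"
  shows "\<bar>exp (- x) - (1 - x)\<bar> \<le> x * min 1 x"
proof -
  have lower: "1 - x \<le> exp (- x)" using exp_ge_add_one_self[of "- x"] by simp
  have "exp (- x) \<le> 1 / (1 + x)"
    using exp_ge_add_one_self[of x] assms by (simp add: exp_minus field_simps)
  also have "\<dots> \<le> 1 - x + x * x"
  proof -
    have "(1 - x + x * x) * (1 + x) = 1 + x * x * x" by (simp add: algebra_simps)
    then show ?thesis using assms by (simp add: divide_le_eq)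
  qed
  finally have "exp (- x) \<le> 1 - x + x * x" .
  moreover have "exp (- x) \<le> 1" using assms by simp
  ultimately show ?thesis using lower assms by (auto simp: min_def)
qed

text \<open>The excess over L vanishes at L itself and dominates z, up to the factor 2, only beyond
  2 L; hence the cut at 2 L. Below the cut the bound w' on the second factor takes over.\<close>

lemma truncated_product_le:
  fixes z w :: real
  assumes "0 \<le> z" "0 \<le> w" "0 \<le> L" "z \<le> 2 * L \<Longrightarrow> w \<le> w'" "0 \<le> w'"
  shows "z * min 1 w \<le> 2 * max 0 (z - L) + 2 * L * w'"
proof (cases "z \<le> 2 * L")
  case True
  have "z * min 1 w \<le> (2 * L) * w'"
    using assms True by (intro mult_mono) auto
  then show ?thesis by (rule order_trans) simp
next
  case False
  have "z * min 1 w \<le> z" using assms by (intro mult_left_le) auto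
  also have "\<dots> \<le> 2 * max 0 (z - L)" using False by (simp add: max_def)
  finally show ?thesis by (rule order_trans) (use assms in simp)
qed

section \<open>Comparison with a Gaussian of frozen variance\<close>

context l2_martingale
begin

lemma innovation_integrable: "integrable M (\<zeta> k)"
  using square_integrable_imp_integrable[OF innovation_meas innovation_sq] .

lemma bounded_mult_integrable:
  fixes H :: "'w \<Rightarrow> 'b :: {real_normed_algebra, banach, second_countable_topology}"
  assumes "integrable M f" "H \<in> borel_measurable M" "\<And>\<omega>. norm (H \<omega>) \<le> B"
  shows "integrable M (\<lambda>\<omega>. H \<omega> * f \<omega>)"
proof (rule Bochner_Integration.integrable_bound)
  show "integrable M (\<lambda>\<omega>. B * norm (f \<omega>))" using assms(1) by simp
  have "norm (H \<omega> * f \<omega>) \<le> norm (B * norm (f \<omega>))" for \<omega>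
  proof -
    have "norm (H \<omega> * f \<omega>) \<le> norm (H \<omega>) * norm (f \<omega>)" by (rule norm_mult_ineq)
    also have "\<dots> \<le> B * norm (f \<omega>)" by (intro mult_right_mono assms) simp
    finally show ?thesis by simp
  qed
  then show "AE \<omega> in M. norm (H \<omega> * f \<omega>) \<le> norm (B * norm (f \<omega>))" by simp
qed (use assms in measurable)

lemma complex_orthogonality:
  fixes H :: "'w \<Rightarrow> complex"
  assumes H: "H \<in> borel_measurable (F k)" and B: "\<And>\<omega>. cmod (H \<omega>) \<le> B"
  shows "(\<integral>\<omega>. H \<omega> * complex_of_real (\<zeta> k \<omega>) \<partial>M) = 0"
    and "(\<integral>\<omega>. H \<omega> * complex_of_real ((\<zeta> k \<omega>)\<^sup>2) \<partial>M) = (\<integral>\<omega>. H \<omega> * complex_of_real (g k \<omega>) \<partial>M)"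
proof -
  have HM [measurable]: "H \<in> borel_measurable M" using H by (rule adapted_imp_M)
  have ReIm: "(\<lambda>\<omega>. Re (H \<omega>)) \<in> borel_measurable (F k)" "(\<lambda>\<omega>. Im (H \<omega>)) \<in> borel_measurable (F k)"
    using H by measurable
  have split: "(\<integral>\<omega>. H \<omega> * complex_of_real (f \<omega>) \<partial>M)
      = Complex (\<integral>\<omega>. Re (H \<omega>) * f \<omega> \<partial>M) (\<integral>\<omega>. Im (H \<omega>) * f \<omega> \<partial>M)"
    if "integrable M f" for f
  proof -
    have "integrable M (\<lambda>\<omega>. H \<omega> * complex_of_real (f \<omega>))"
      using that B by (intro bounded_mult_integrable) auto
    from integral_Re[OF this] integral_Im[OF this] show ?thesis
      by (simp add: complex_eq_iff)
  qed
  show "(\<integral>\<omega>. H \<omega> * complex_of_real (\<zeta> k \<omega>) \<partial>M) = 0"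
    unfolding split[OF innovation_integrable] centred[OF ReIm(1)] centred[OF ReIm(2)]
    by (simp add: complex_eq_iff)
  show "(\<integral>\<omega>. H \<omega> * complex_of_real ((\<zeta> k \<omega>)\<^sup>2) \<partial>M) = (\<integral>\<omega>. H \<omega> * complex_of_real (g k \<omega>) \<partial>M)"
    unfolding split[OF innovation_sq] split[OF var_integrable] variance[OF ReIm(1)] variance[OF ReIm(2)] ..
qed

text \<open>One step of the interpolation, with \<open>H\<close> the factor known at time m. When
  both exponentials are expanded the constants cancel, the linear term vanishes by
  \<open>centred\<close>, and \<open>variance\<close> turns the squared innovation into
  \<open>g m\<close>. There remain two Taylor remainders, each costing 2 u and a term that vanishes
  with N, the change \<open>d\<close> of the conditional variance since time N, and a discretisation
  error C / N.\<close>

lemma char_step_bound: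
  fixes H :: "'w \<Rightarrow> complex" and a :: "'w \<Rightarrow> real"
  assumes N: "1 \<le> N" "N \<le> m" and a: "a \<in> borel_measurable (F N)" "\<And>\<omega>. \<bar>a \<omega>\<bar> \<le> K"
    and H: "H \<in> borel_measurable (F m)" "\<And>\<omega>. cmod (H \<omega>) \<le> 1"
    and L: "0 \<le> L" "\<And>k. (\<integral>\<omega>. max 0 ((\<zeta> k \<omega>)\<^sup>2 - L) \<partial>M) \<le> u"
    and C: "\<And>k. (\<integral>\<omega>. g k \<omega> \<partial>M) \<le> C"
    and d: "(\<integral>\<omega>. \<bar>g m \<omega> - g N \<omega>\<bar> \<partial>M) \<le> d"
  defines "w \<equiv> real N / (real m * real (m + 1))"
  shows "cmod (\<integral>\<omega>. H \<omega> * (iexp (a \<omega> * sqrt N * (\<zeta> m \<omega> / real (m + 1)))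
        - complex_of_real (exp (- ((a \<omega>)\<^sup>2 * g N \<omega> * w / 2)))) \<partial>M)
      \<le> w * (K\<^sup>2 * (4 * u + 2 * L * (K / sqrt N * sqrt (2 * L)) + 2 * L * (K\<^sup>2 / N * (2 * L)) + d + C / N))"
    (is "cmod (\<integral>\<omega>. H \<omega> * (iexp (?D \<omega>) - complex_of_real (exp (- ?x \<omega>))) \<partial>M) \<le> _")
proof -
  have [measurable]: "H \<in> borel_measurable M" "a \<in> borel_measurable M"
    by (rule adapted_imp_M, rule H, rule adapted_imp_M, rule a)
  have K0: "0 \<le> K" using a(2)[of undefined] by linarith
  have m: "1 \<le> m" using N by simp
  have w0: "0 \<le> w" by (simp add: w_def)
  have aK: "(a \<omega>)\<^sup>2 \<le> K\<^sup>2" for \<omega>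
    using power_mono[OF a(2)[of \<omega>], of 2] by simp
  have wN: "w \<le> 1 / N"
  proof -
    have "w \<le> 1 / real (m + 1)" unfolding w_def using N m by (simp add: divide_simps)
    also have "\<dots> \<le> 1 / N" using N by (intro divide_left_mono) auto
    finally show ?thesis .
  qed
  \<comment> \<open>The step has variance weight N / (m + 1)^2, whereas the telescoping scheme
    removes N / (m (m + 1)). Their difference w / (m + 1) is the source of the term C / N.\<close>
  have w_diff: "0 \<le> w - N / (real (m + 1))\<^sup>2" "w - N / (real (m + 1))\<^sup>2 \<le> w / N"
  proof -
    have eq: "w - N / (real (m + 1))\<^sup>2 = w * (1 / real (m + 1))"
      unfolding w_def using m by (simp add: divide_simps power2_eq_square) (simp add: algebra_simps)
    show "0 \<le> w - N / (real (m + 1))\<^sup>2" unfolding eq using w0 by simp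
    have "w * (1 / real (m + 1)) \<le> w * (1 / N)"
      using N w0 by (intro mult_left_mono divide_left_mono) auto
    then show "w - N / (real (m + 1))\<^sup>2 \<le> w / N" unfolding eq by simp
  qed
  define A where "A \<omega> = a \<omega> * (sqrt N / real (m + 1))" for \<omega>
  have D_eq: "?D \<omega> = A \<omega> * \<zeta> m \<omega>" for \<omega> by (simp add: A_def)
  have A_sq: "(A \<omega>)\<^sup>2 = (a \<omega>)\<^sup>2 * (N / (real (m + 1))\<^sup>2)" for \<omega>
    by (simp add: A_def power_mult_distrib power_divide)
  have [measurable]: "A \<in> borel_measurable M" unfolding A_def by measurable
  have A_meas: "A \<in> borel_measurable (F m)"
    using adapted_mono[OF a(1) N(2)] unfolding A_def by measurable
  have A_bd: "\<bar>A \<omega>\<bar> \<le> K * (sqrt N / real (m + 1))" for \<omega>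
    unfolding A_def abs_mult using a(2)[of \<omega>] by (auto intro!: mult_mono K0 divide_right_mono)
  have A_sq_bd: "(A \<omega>)\<^sup>2 \<le> K\<^sup>2 * w" for \<omega>
    unfolding A_sq using aK w_diff by (intro mult_mono) auto
  have A_bd': "\<bar>A \<omega>\<bar> \<le> K / sqrt N" for \<omega>
  proof -
    have "sqrt N / real (m + 1) \<le> 1 / sqrt N"
      using N by (simp add: divide_simps)
    from mult_left_mono[OF this K0] A_bd[of \<omega>] show ?thesis by simp
  qed
  let ?T = "\<lambda>\<omega>. iexp (?D \<omega>) - (1 + \<i> * ?D \<omega> - (complex_of_real (?D \<omega>))\<^sup>2 / 2)"
  let ?R = "\<lambda>\<omega>. exp (- ?x \<omega>) - (1 - ?x \<omega>)"
  have T_le: "cmod (?T \<omega>) \<le> (K\<^sup>2 * w) * (2 * max 0 ((\<zeta> m \<omega>)\<^sup>2 - L) + 2 * L * (K / sqrt N * sqrt (2 * L)))" for \<omega>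
  proof -
    have "cmod (?T \<omega>) \<le> (?D \<omega>)\<^sup>2 * min 1 \<bar>?D \<omega>\<bar>" by (rule cmod_iexp_second_order)
    also have "\<dots> \<le> (K\<^sup>2 * w * (\<zeta> m \<omega>)\<^sup>2) * min 1 (K / sqrt N * \<bar>\<zeta> m \<omega>\<bar>)"
      unfolding D_eq power_mult_distrib abs_mult
      using A_sq_bd A_bd' w0 K0 by (intro mult_mono min.mono) auto
    also have "\<dots> = (K\<^sup>2 * w) * ((\<zeta> m \<omega>)\<^sup>2 * min 1 (K / sqrt N * \<bar>\<zeta> m \<omega>\<bar>))" by simp
    also have "\<dots> \<le> (K\<^sup>2 * w) * (2 * max 0 ((\<zeta> m \<omega>)\<^sup>2 - L) + 2 * L * (K / sqrt N * sqrt (2 * L)))"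
    proof (rule mult_left_mono[OF truncated_product_le])
      assume "(\<zeta> m \<omega>)\<^sup>2 \<le> 2 * L"
      then have "\<bar>\<zeta> m \<omega>\<bar> \<le> sqrt (2 * L)" by (intro real_le_rsqrt) simp
      then show "K / sqrt N * \<bar>\<zeta> m \<omega>\<bar> \<le> K / sqrt N * sqrt (2 * L)"
        using K0 by (intro mult_left_mono) auto
    qed (use K0 L w0 in auto)
    finally show ?thesis .
  qed
  have x0: "0 \<le> ?x \<omega>" if "\<omega> \<in> space M" for \<omega>
    using var_nonneg[OF that] w0 by simp
  have R_le: "\<bar>?R \<omega>\<bar> \<le> (K\<^sup>2 * w) * (2 * max 0 (g N \<omega> - L) + 2 * L * (K\<^sup>2 / N * (2 * L)))"
    if "\<omega> \<in> space M" for \<omega>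
  proof -
    have g0: "0 \<le> g N \<omega>" using var_nonneg[OF that] .
    have "\<bar>?R \<omega>\<bar> \<le> ?x \<omega> * min 1 (?x \<omega>)" by (rule exp_minus_first_order[OF x0[OF that]])
    also have "\<dots> \<le> (K\<^sup>2 * w * g N \<omega>) * min 1 (K\<^sup>2 / N * g N \<omega>)"
    proof -
      have "?x \<omega> \<le> (a \<omega>)\<^sup>2 * g N \<omega> * w" using g0 w0 by simp
      also have "\<dots> \<le> K\<^sup>2 * g N \<omega> * w" using g0 w0 aK by (intro mult_right_mono) auto
      finally have 1: "?x \<omega> \<le> K\<^sup>2 * w * g N \<omega>" by (simp add: ac_simps)
      have "K\<^sup>2 * w * g N \<omega> \<le> K\<^sup>2 * (1 / N) * g N \<omega>"
        using g0 wN by (intro mult_right_mono mult_left_mono) auto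
      from order_trans[OF 1 this] have "?x \<omega> \<le> K\<^sup>2 / N * g N \<omega>" by simp
      with 1 show ?thesis
        using x0[OF that] g0 w0 by (intro mult_mono min.mono) auto
    qed
    also have "\<dots> = (K\<^sup>2 * w) * (g N \<omega> * min 1 (K\<^sup>2 / N * g N \<omega>))" by simp
    also have "\<dots> \<le> (K\<^sup>2 * w) * (2 * max 0 (g N \<omega> - L) + 2 * L * (K\<^sup>2 / N * (2 * L)))"
    proof (rule mult_left_mono[OF truncated_product_le])
      assume "g N \<omega> \<le> 2 * L"
      then show "K\<^sup>2 / N * g N \<omega> \<le> K\<^sup>2 / N * (2 * L)"
        by (intro mult_left_mono) auto
    qed (use g0 L w0 in auto)
    finally show ?thesis .
  qed
  have V_le: "\<bar>?x \<omega> - (A \<omega>)\<^sup>2 / 2 * g m \<omega>\<bar> \<le> K\<^sup>2 * w * (\<bar>g m \<omega> - g N \<omega>\<bar> + g m \<omega> / N)"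
    if "\<omega> \<in> space M" for \<omega>
  proof -
    have g0: "0 \<le> g m \<omega>" using var_nonneg[OF that] .
    have "?x \<omega> - (A \<omega>)\<^sup>2 / 2 * g m \<omega> = (a \<omega>)\<^sup>2 / 2 *
        (w * (g N \<omega> - g m \<omega>) + (w - N / (real (m + 1))\<^sup>2) * g m \<omega>)"
      unfolding A_sq by (simp add: algebra_simps)
    then have "\<bar>?x \<omega> - (A \<omega>)\<^sup>2 / 2 * g m \<omega>\<bar> = (a \<omega>)\<^sup>2 / 2 *
        \<bar>w * (g N \<omega> - g m \<omega>) + (w - N / (real (m + 1))\<^sup>2) * g m \<omega>\<bar>"
      by (simp only: abs_mult) simp
    also have "\<dots> \<le> K\<^sup>2 * (w * \<bar>g m \<omega> - g N \<omega>\<bar> + w / N * g m \<omega>)"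
    proof (rule mult_mono)
      show "(a \<omega>)\<^sup>2 / 2 \<le> K\<^sup>2"
        using aK[of \<omega>] zero_le_power2[of "a \<omega>"] by linarith
      have V1: "\<bar>w * (g N \<omega> - g m \<omega>)\<bar> = w * \<bar>g m \<omega> - g N \<omega>\<bar>"
        using w0 by (simp add: abs_mult abs_minus_commute)
      have V2: "\<bar>(w - N / (real (m + 1))\<^sup>2) * g m \<omega>\<bar> \<le> w / N * g m \<omega>"
        unfolding abs_mult using w_diff g0 by (intro mult_mono) auto
      show "\<bar>w * (g N \<omega> - g m \<omega>) + (w - N / (real (m + 1))\<^sup>2) * g m \<omega>\<bar>
          \<le> w * \<bar>g m \<omega> - g N \<omega>\<bar> + w / N * g m \<omega>"
        by (rule order_trans[OF abs_triangle_ineq add_mono[OF eq_refl[OF V1] V2]])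
    qed auto
    also have "\<dots> = K\<^sup>2 * w * (\<bar>g m \<omega> - g N \<omega>\<bar> + g m \<omega> / N)" by (simp add: algebra_simps)
    finally show ?thesis .
  qed
  have HA: "(\<lambda>\<omega>. H \<omega> * complex_of_real (A \<omega>)) \<in> borel_measurable (F m)"
    "(\<lambda>\<omega>. H \<omega> * complex_of_real ((A \<omega>)\<^sup>2 / 2)) \<in> borel_measurable (F m)"
    using H(1) A_meas by measurable
  have HA_bd: "cmod (H \<omega> * complex_of_real (A \<omega>)) \<le> K / sqrt N"
    "cmod (H \<omega> * complex_of_real ((A \<omega>)\<^sup>2 / 2)) \<le> K\<^sup>2 * w" for \<omega>
  proof -
    show "cmod (H \<omega> * complex_of_real (A \<omega>)) \<le> K / sqrt N"
      unfolding norm_mult using mult_mono[OF H(2)[of \<omega>] A_bd'[of \<omega>]] by simp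
    have "(A \<omega>)\<^sup>2 / 2 \<le> K\<^sup>2 * w" using A_sq_bd[of \<omega>] zero_le_power2[of "A \<omega>"] by linarith
    from mult_mono[OF H(2)[of \<omega>] this]
    show "cmod (H \<omega> * complex_of_real ((A \<omega>)\<^sup>2 / 2)) \<le> K\<^sup>2 * w"
      unfolding norm_mult norm_of_real by simp
  qed
  have i1: "integrable M (\<lambda>\<omega>. H \<omega> * ?T \<omega>)"
  proof (rule Bochner_Integration.integrable_bound)
    show "integrable M (\<lambda>\<omega>. (K\<^sup>2 * w) * (2 * max 0 ((\<zeta> m \<omega>)\<^sup>2 - L) + 2 * L * (K / sqrt N * sqrt (2 * L))))"
      by simp
    show "AE \<omega> in M. norm (H \<omega> * ?T \<omega>)
        \<le> norm ((K\<^sup>2 * w) * (2 * max 0 ((\<zeta> m \<omega>)\<^sup>2 - L) + 2 * L * (K / sqrt N * sqrt (2 * L))))"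
    proof (rule AE_I2)
      fix \<omega>
      have "norm (H \<omega> * ?T \<omega>) \<le> 1 * cmod (?T \<omega>)"
        unfolding norm_mult by (intro mult_right_mono H) auto
      then show "norm (H \<omega> * ?T \<omega>)
        \<le> norm ((K\<^sup>2 * w) * (2 * max 0 ((\<zeta> m \<omega>)\<^sup>2 - L) + 2 * L * (K / sqrt N * sqrt (2 * L))))"
        using order_trans[OF T_le[of \<omega>] abs_ge_self] by simp
    qed
  qed measurable
  have i2: "integrable M (\<lambda>\<omega>. H \<omega> * complex_of_real (A \<omega>) * complex_of_real (\<zeta> m \<omega>))"
    using innovation_integrable[of m] HA_bd(1) by (intro bounded_mult_integrable) auto
  have i3: "integrable M (\<lambda>\<omega>. H \<omega> * complex_of_real ((A \<omega>)\<^sup>2 / 2) * complex_of_real ((\<zeta> m \<omega>)\<^sup>2))"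
    using innovation_sq[of m] HA_bd(2)
    by (intro bounded_mult_integrable[where B = "K\<^sup>2 * w"]) (simp_all del: of_real_power of_real_divide)
  have i3': "integrable M (\<lambda>\<omega>. H \<omega> * complex_of_real ((A \<omega>)\<^sup>2 / 2) * complex_of_real (g m \<omega>))"
    using var_integrable[of m] HA_bd(2)
    by (intro bounded_mult_integrable[where B = "K\<^sup>2 * w"]) (simp_all del: of_real_power of_real_divide)
  have x_int: "integrable M ?x"
  proof -
    have "norm ((a \<omega>)\<^sup>2) \<le> K\<^sup>2" for \<omega> using aK[of \<omega>] by simp
    then have "integrable M (\<lambda>\<omega>. (a \<omega>)\<^sup>2 * g N \<omega>)"
      using var_integrable[of N] by (intro bounded_mult_integrable) auto
    then show ?thesis by simp
  qed
  have i4: "integrable M (\<lambda>\<omega>. H \<omega> * complex_of_real (?x \<omega>))"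
    using x_int H(2) by (intro bounded_mult_integrable integrable_of_real) auto
  have R_int: "integrable M ?R"
  proof (rule Bochner_Integration.integrable_bound)
    show "integrable M (\<lambda>\<omega>. (K\<^sup>2 * w) * (2 * max 0 (g N \<omega> - L) + 2 * L * (K\<^sup>2 / N * (2 * L))))"
      by simp
    show "AE \<omega> in M. norm (?R \<omega>) \<le> norm ((K\<^sup>2 * w) * (2 * max 0 (g N \<omega> - L) + 2 * L * (K\<^sup>2 / N * (2 * L))))"
    proof (rule AE_I2)
      fix \<omega> assume "\<omega> \<in> space M"
      from R_le[OF this] show "norm (?R \<omega>) \<le> norm ((K\<^sup>2 * w) * (2 * max 0 (g N \<omega> - L) + 2 * L * (K\<^sup>2 / N * (2 * L))))"
        unfolding real_norm_def by (rule order_trans[OF _ abs_ge_self])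
    qed
  qed measurable
  have i5: "integrable M (\<lambda>\<omega>. H \<omega> * complex_of_real (?R \<omega>))"
    using R_int H(2) by (intro bounded_mult_integrable integrable_of_real) auto
  \<comment> \<open>With D and x for \<open>?D\<close> and \<open>?x\<close>, the difference of the
    exponentials is T + i D + (x - D^2 / 2) - R, where T and R are the remainders \<open>?T\<close>
    and \<open>?R\<close>.\<close>
  have "(\<integral>\<omega>. H \<omega> * (iexp (?D \<omega>) - complex_of_real (exp (- ?x \<omega>))) \<partial>M)
      = (\<integral>\<omega>. (H \<omega> * ?T \<omega> + \<i> * (H \<omega> * complex_of_real (A \<omega>) * complex_of_real (\<zeta> m \<omega>))
        + (H \<omega> * complex_of_real (?x \<omega>) - H \<omega> * complex_of_real ((A \<omega>)\<^sup>2 / 2) * complex_of_real ((\<zeta> m \<omega>)\<^sup>2)))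
        - H \<omega> * complex_of_real (?R \<omega>) \<partial>M)"
    by (intro Bochner_Integration.integral_cong refl) (simp only: D_eq, simp add: algebra_simps power2_eq_square)
  also have "\<dots> = ((\<integral>\<omega>. H \<omega> * ?T \<omega> \<partial>M)
        + \<i> * (\<integral>\<omega>. H \<omega> * complex_of_real (A \<omega>) * complex_of_real (\<zeta> m \<omega>) \<partial>M)
        + ((\<integral>\<omega>. H \<omega> * complex_of_real (?x \<omega>) \<partial>M)
          - (\<integral>\<omega>. H \<omega> * complex_of_real ((A \<omega>)\<^sup>2 / 2) * complex_of_real ((\<zeta> m \<omega>)\<^sup>2) \<partial>M)))
        - (\<integral>\<omega>. H \<omega> * complex_of_real (?R \<omega>) \<partial>M)"
    using i1 i2 i3 i4 i5
    by (simp only: Bochner_Integration.integral_add Bochner_Integration.integral_diff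
        Bochner_Integration.integrable_add Bochner_Integration.integrable_diff
        integrable_mult_right integral_mult_right_zero)
  also have "(\<integral>\<omega>. H \<omega> * complex_of_real (A \<omega>) * complex_of_real (\<zeta> m \<omega>) \<partial>M) = 0"
    by (rule complex_orthogonality(1)[OF HA(1) HA_bd(1)])
  also have "(\<integral>\<omega>. H \<omega> * complex_of_real ((A \<omega>)\<^sup>2 / 2) * complex_of_real ((\<zeta> m \<omega>)\<^sup>2) \<partial>M)
      = (\<integral>\<omega>. H \<omega> * complex_of_real ((A \<omega>)\<^sup>2 / 2) * complex_of_real (g m \<omega>) \<partial>M)"
    by (rule complex_orthogonality(2)[OF HA(2) HA_bd(2)])
  also have "(\<integral>\<omega>. H \<omega> * complex_of_real (?x \<omega>) \<partial>M)
        - (\<integral>\<omega>. H \<omega> * complex_of_real ((A \<omega>)\<^sup>2 / 2) * complex_of_real (g m \<omega>) \<partial>M)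
      = (\<integral>\<omega>. H \<omega> * complex_of_real (?x \<omega> - (A \<omega>)\<^sup>2 / 2 * g m \<omega>) \<partial>M)"
    using Bochner_Integration.integral_diff[OF i4 i3'] by (simp add: right_diff_distrib mult.assoc)
  finally have eq: "(\<integral>\<omega>. H \<omega> * (iexp (?D \<omega>) - complex_of_real (exp (- ?x \<omega>))) \<partial>M)
      = (\<integral>\<omega>. H \<omega> * ?T \<omega> \<partial>M) + (\<integral>\<omega>. H \<omega> * complex_of_real (?x \<omega> - (A \<omega>)\<^sup>2 / 2 * g m \<omega>) \<partial>M)
        - (\<integral>\<omega>. H \<omega> * complex_of_real (?R \<omega>) \<partial>M)" by simp
  \<comment> \<open>For a product that is not integrable the integral is 0 by convention, and the
    bound reduces to nonnegativity of the majorant.\<close>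
  have nb: "cmod (\<integral>\<omega>. H \<omega> * f \<omega> \<partial>M) \<le> (\<integral>\<omega>. r \<omega> \<partial>M)"
    if "integrable M r" "\<And>\<omega>. \<omega> \<in> space M \<Longrightarrow> cmod (f \<omega>) \<le> r \<omega>" for f r
  proof (cases "integrable M (\<lambda>\<omega>. H \<omega> * f \<omega>)")
    case True
    have "cmod (H \<omega> * f \<omega>) \<le> r \<omega>" if "\<omega> \<in> space M" for \<omega>
    proof -
      have "cmod (H \<omega> * f \<omega>) \<le> 1 * cmod (f \<omega>)"
        unfolding norm_mult by (intro mult_right_mono H) auto
      then show ?thesis using \<open>\<And>\<omega>. \<omega> \<in> space M \<Longrightarrow> cmod (f \<omega>) \<le> r \<omega>\<close>[OF that] by simp
    qed
    with True that(1) show ?thesis by (intro order_trans[OF integral_norm_bound integral_mono]) auto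
  next
    case False
    have "0 \<le> r \<omega>" if "\<omega> \<in> space M" for \<omega>
      using \<open>\<And>\<omega>. \<omega> \<in> space M \<Longrightarrow> cmod (f \<omega>) \<le> r \<omega>\<close>[OF that] norm_ge_zero order_trans by blast
    with False show ?thesis by (simp add: not_integrable_integral_eq integral_nonneg_AE)
  qed
  have uN: "(\<integral>\<omega>. max 0 (g N \<omega> - L) \<partial>M) \<le> u"
    using excess_var_le[of N L] L(2)[of N] by linarith
  have b1: "cmod (\<integral>\<omega>. H \<omega> * ?T \<omega> \<partial>M) \<le> (K\<^sup>2 * w) * (2 * u + 2 * L * (K / sqrt N * sqrt (2 * L)))"
  proof -
    have "cmod (\<integral>\<omega>. H \<omega> * ?T \<omega> \<partial>M)
        \<le> (\<integral>\<omega>. (K\<^sup>2 * w) * (2 * max 0 ((\<zeta> m \<omega>)\<^sup>2 - L) + 2 * L * (K / sqrt N * sqrt (2 * L))) \<partial>M)"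
      by (rule nb) (use T_le in auto)
    also have "\<dots> = (K\<^sup>2 * w) * (2 * (\<integral>\<omega>. max 0 ((\<zeta> m \<omega>)\<^sup>2 - L) \<partial>M) + 2 * L * (K / sqrt N * sqrt (2 * L)))"
      by (simp add: prob_space)
    also have "\<dots> \<le> (K\<^sup>2 * w) * (2 * u + 2 * L * (K / sqrt N * sqrt (2 * L)))"
      using L(2)[of m] w0 by (intro mult_left_mono add_right_mono) auto
    finally show ?thesis .
  qed
  have b2: "cmod (\<integral>\<omega>. H \<omega> * complex_of_real (?R \<omega>) \<partial>M) \<le> (K\<^sup>2 * w) * (2 * u + 2 * L * (K\<^sup>2 / N * (2 * L)))"
  proof -
    have "cmod (\<integral>\<omega>. H \<omega> * complex_of_real (?R \<omega>) \<partial>M)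
        \<le> (\<integral>\<omega>. (K\<^sup>2 * w) * (2 * max 0 (g N \<omega> - L) + 2 * L * (K\<^sup>2 / N * (2 * L))) \<partial>M)"
      by (rule nb) (use R_le in \<open>auto simp only: norm_of_real real_norm_def, simp\<close>)
    also have "\<dots> = (K\<^sup>2 * w) * (2 * (\<integral>\<omega>. max 0 (g N \<omega> - L) \<partial>M) + 2 * L * (K\<^sup>2 / N * (2 * L)))"
      by (simp add: prob_space)
    also have "\<dots> \<le> (K\<^sup>2 * w) * (2 * u + 2 * L * (K\<^sup>2 / N * (2 * L)))"
      using uN w0 by (intro mult_left_mono add_right_mono) auto
    finally show ?thesis .
  qed
  have b3: "cmod (\<integral>\<omega>. H \<omega> * complex_of_real (?x \<omega> - (A \<omega>)\<^sup>2 / 2 * g m \<omega>) \<partial>M) \<le> (K\<^sup>2 * w) * (d + C / N)"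
  proof -
    have "cmod (\<integral>\<omega>. H \<omega> * complex_of_real (?x \<omega> - (A \<omega>)\<^sup>2 / 2 * g m \<omega>) \<partial>M)
        \<le> (\<integral>\<omega>. K\<^sup>2 * w * (\<bar>g m \<omega> - g N \<omega>\<bar> + g m \<omega> / N) \<partial>M)"
      by (rule nb) (use V_le var_integrable in \<open>auto simp only: norm_of_real real_norm_def, simp\<close>)
    also have "\<dots> = K\<^sup>2 * w * ((\<integral>\<omega>. \<bar>g m \<omega> - g N \<omega>\<bar> \<partial>M) + (\<integral>\<omega>. g m \<omega> \<partial>M) / N)"
      using var_integrable by simp
    also have "\<dots> \<le> (K\<^sup>2 * w) * (d + C / N)"
      using d C[of m] w0 by (intro mult_left_mono add_mono divide_right_mono) auto
    finally show ?thesis .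
  qed
  have "cmod (\<integral>\<omega>. H \<omega> * (iexp (?D \<omega>) - complex_of_real (exp (- ?x \<omega>))) \<partial>M)
      \<le> (K\<^sup>2 * w) * (2 * u + 2 * L * (K / sqrt N * sqrt (2 * L))) + (K\<^sup>2 * w) * (d + C / N)
        + (K\<^sup>2 * w) * (2 * u + 2 * L * (K\<^sup>2 / N * (2 * L)))"
    unfolding eq by (intro order_trans[OF norm_triangle_ineq4] add_mono order_trans[OF norm_triangle_ineq] b1 b2 b3)
  also have "\<dots> = w * (K\<^sup>2 * (4 * u + 2 * L * (K / sqrt N * sqrt (2 * L)) + 2 * L * (K\<^sup>2 / N * (2 * L)) + d + C / N))"
    by (simp add: algebra_simps)
  finally show ?thesis .
qed

lemma char_frozen_bound:
  fixes a :: "'w \<Rightarrow> real"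
  assumes N: "1 \<le> N" and a: "a \<in> borel_measurable (F N)" "\<And>\<omega>. \<bar>a \<omega>\<bar> \<le> K"
    and L: "0 \<le> L" "\<And>k. (\<integral>\<omega>. max 0 ((\<zeta> k \<omega>)\<^sup>2 - L) \<partial>M) \<le> u"
    and C: "\<And>k. (\<integral>\<omega>. g k \<omega> \<partial>M) \<le> C"
    and d: "\<And>m. N \<le> m \<Longrightarrow> (\<integral>\<omega>. \<bar>g m \<omega> - g N \<omega>\<bar> \<partial>M) \<le> d"
  shows "cmod ((\<integral>\<omega>. iexp (a \<omega> * sqrt N * (limit \<omega> - \<theta> N \<omega>)) \<partial>M)
        - (\<integral>\<omega>. complex_of_real (exp (- ((a \<omega>)\<^sup>2 * g N \<omega> / 2))) \<partial>M))
      \<le> K\<^sup>2 * (4 * u + 2 * L * (K / sqrt N * sqrt (2 * L)) + 2 * L * (K\<^sup>2 / N * (2 * L)) + d + C / N)"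
    (is "_ \<le> ?B")
proof -
  have aM [measurable]: "a \<in> borel_measurable M" by (rule adapted_imp_M, rule a)
  define S where "S m \<omega> = a \<omega> * sqrt N * (\<theta> m \<omega> - \<theta> N \<omega>)" for m \<omega>
  \<comment> \<open>Half of the variance that would remain after time m if every later conditional
    variance equalled \<open>g N\<close>. At m = N it yields the Gaussian factor, and it vanishes as
    m grows.\<close>
  define R where "R m \<omega> = (a \<omega>)\<^sup>2 * g N \<omega> * (N / real m) / 2" for m \<omega>
  define \<Phi> where "\<Phi> m \<omega> = iexp (S m \<omega>) * complex_of_real (exp (- R m \<omega>))" for m \<omega>
  \<comment> \<open>The common factor of \<open>\<Phi> (Suc m)\<close> and \<open>\<Phi> m\<close>,
    hence the index \<open>Suc m\<close>. Outside \<open>space M\<close> the sign of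
    \<open>g N\<close> is unknown; \<open>max 0\<close> keeps the modulus at most 1 at every point,
    as \<open>char_step_bound\<close> demands.\<close>
  let ?H = "\<lambda>m \<omega>. iexp (S m \<omega>) * complex_of_real (exp (- max 0 (R (Suc m) \<omega>)))"
  let ?w = "\<lambda>m. real N / (real m * real (m + 1))"
  have [measurable]: "S m \<in> borel_measurable M" "R m \<in> borel_measurable M" for m
    unfolding S_def R_def by measurable
  have R0: "0 \<le> R m \<omega>" if "\<omega> \<in> space M" for m \<omega>
    unfolding R_def using var_nonneg[OF that] by simp
  have \<Phi>_bd: "cmod (\<Phi> m \<omega>) \<le> 1" if "\<omega> \<in> space M" for m \<omega>
    unfolding \<Phi>_def norm_mult using R0[OF that] by simp
  have \<Phi>_meas [measurable]: "\<Phi> m \<in> borel_measurable M" for m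
    unfolding \<Phi>_def by measurable
  have \<Phi>_int: "integrable M (\<Phi> m)" for m
    by (rule integrable_const_bound[where B = 1]) (use \<Phi>_bd in auto)
  have H_meas: "?H m \<in> borel_measurable (F m)" if "N \<le> m" for m
    using adapted_mono[OF a(1) that] adapted_mono[OF var_adapted[of N] that]
      adapted_mono[OF adapted[of N] that] adapted[of m]
    unfolding S_def R_def by measurable
  have B0: "0 \<le> ?B"
  proof -
    have "0 \<le> K" using a(2)[of undefined] by linarith
    moreover have "0 \<le> u"
      using order_trans[OF _ L(2)[of 0]] by (simp add: integral_nonneg_AE)
    moreover have "0 \<le> C" using order_trans[OF expectation_var_nonneg C[of 0]] .
    moreover have "0 \<le> d" using d[of N] by simp
    ultimately show ?thesis using L by simp
  qed
  have step: "cmod ((\<integral>\<omega>. \<Phi> (Suc m) \<omega> \<partial>M) - (\<integral>\<omega>. \<Phi> m \<omega> \<partial>M)) \<le> ?w m * ?B" if m: "N \<le> m" for m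
  proof -
    have "(\<integral>\<omega>. \<Phi> (Suc m) \<omega> \<partial>M) - (\<integral>\<omega>. \<Phi> m \<omega> \<partial>M) = (\<integral>\<omega>. \<Phi> (Suc m) \<omega> - \<Phi> m \<omega> \<partial>M)"
      by (rule Bochner_Integration.integral_diff[symmetric, OF \<Phi>_int \<Phi>_int])
    also have "\<dots> = (\<integral>\<omega>. ?H m \<omega> * (iexp (a \<omega> * sqrt N * (\<zeta> m \<omega> / real (m + 1)))
        - complex_of_real (exp (- ((a \<omega>)\<^sup>2 * g N \<omega> * ?w m / 2)))) \<partial>M)"
    proof (intro Bochner_Integration.integral_cong refl)
      fix \<omega> assume \<omega>: "\<omega> \<in> space M"
      have S: "S (Suc m) \<omega> = S m \<omega> + a \<omega> * sqrt N * (\<zeta> m \<omega> / real (m + 1))"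
        unfolding S_def step[OF \<omega>] by (simp add: algebra_simps)
      have "N / real m = N / real (Suc m) + ?w m"
        using N m by (simp add: divide_simps) (simp add: algebra_simps)
      then have R: "R m \<omega> = R (Suc m) \<omega> + (a \<omega>)\<^sup>2 * g N \<omega> * ?w m / 2"
        unfolding R_def by (simp only: ring_distribs) (simp only: add_divide_distrib)
      have "iexp (S (Suc m) \<omega>) = iexp (S m \<omega>) * iexp (a \<omega> * sqrt N * (\<zeta> m \<omega> / real (m + 1)))"
        unfolding S by (simp only: of_real_add ring_distribs exp_add)
      moreover have "exp (- R m \<omega>) = exp (- R (Suc m) \<omega>) * exp (- ((a \<omega>)\<^sup>2 * g N \<omega> * ?w m / 2))"
        unfolding R by (simp only: minus_add_distrib exp_add)
      ultimately show "\<Phi> (Suc m) \<omega> - \<Phi> m \<omega> = ?H m \<omega> * (iexp (a \<omega> * sqrt N * (\<zeta> m \<omega> / real (m + 1)))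
          - complex_of_real (exp (- ((a \<omega>)\<^sup>2 * g N \<omega> * ?w m / 2))))"
        unfolding \<Phi>_def max_absorb2[OF R0[OF \<omega>]] by (simp only: of_real_mult right_diff_distrib mult_ac)
    qed
    finally have eq: "(\<integral>\<omega>. \<Phi> (Suc m) \<omega> \<partial>M) - (\<integral>\<omega>. \<Phi> m \<omega> \<partial>M) = \<dots>" .
    show ?thesis unfolding eq
      by (rule char_step_bound[OF N m a H_meas[OF m] _ L C d[OF m]]) (simp add: norm_mult)
  qed
  have "cmod ((\<integral>\<omega>. \<Phi> (N + k) \<omega> \<partial>M) - (\<integral>\<omega>. \<Phi> N \<omega> \<partial>M)) \<le> ?B" for k
  proof -
    have tel: "(\<integral>\<omega>. \<Phi> (N + k) \<omega> \<partial>M) - (\<integral>\<omega>. \<Phi> N \<omega> \<partial>M)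
        = (\<Sum>j<k. (\<integral>\<omega>. \<Phi> (N + Suc j) \<omega> \<partial>M) - (\<integral>\<omega>. \<Phi> (N + j) \<omega> \<partial>M))"
      by (simp add: sum_lessThan_telescope[where f = "\<lambda>j. \<integral>\<omega>. \<Phi> (N + j) \<omega> \<partial>M"] del: add_Suc_right)
    have "cmod ((\<integral>\<omega>. \<Phi> (N + k) \<omega> \<partial>M) - (\<integral>\<omega>. \<Phi> N \<omega> \<partial>M)) \<le> (\<Sum>j<k. ?w (N + j) * ?B)"
      unfolding tel by (intro order_trans[OF norm_sum] sum_mono) (unfold add_Suc_right, rule step, simp)
    also have "\<dots> = (\<Sum>j<k. ?w (N + j)) * ?B" by (simp only: sum_distrib_right)
    also have "\<dots> \<le> 1 * ?B"
    proof (rule mult_right_mono[OF _ B0])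
      have "(\<Sum>j<k. ?w (N + j)) \<le> (\<Sum>j. ?w (N + j))"
        by (rule sum_le_suminf) (use harmonic_telescope_sums[OF N] in \<open>auto simp: sums_iff\<close>)
      then show "(\<Sum>j<k. ?w (N + j)) \<le> 1"
        using harmonic_telescope_sums[OF N] by (simp only: sums_iff)
    qed
    finally show ?thesis by simp
  qed
  moreover have "(\<lambda>k. \<integral>\<omega>. \<Phi> (N + k) \<omega> \<partial>M) \<longlonglongrightarrow> (\<integral>\<omega>. iexp (a \<omega> * sqrt N * (limit \<omega> - \<theta> N \<omega>)) \<partial>M)"
  proof (rule integral_dominated_convergence[where w = "\<lambda>_. 1"])
    show "AE \<omega> in M. (\<lambda>k. \<Phi> (N + k) \<omega>) \<longlonglongrightarrow> iexp (a \<omega> * sqrt N * (limit \<omega> - \<theta> N \<omega>))"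
      using tendsto_limit
    proof eventually_elim
      fix \<omega> assume "(\<lambda>k. \<theta> k \<omega>) \<longlonglongrightarrow> limit \<omega>"
      then have 1: "(\<lambda>k. \<theta> (N + k) \<omega>) \<longlonglongrightarrow> limit \<omega>"
        by (subst add.commute) (rule LIMSEQ_ignore_initial_segment)
      have "(\<lambda>k. N / real (N + k)) \<longlonglongrightarrow> 0" by real_asymp
      then have "(\<lambda>k. R (N + k) \<omega>) \<longlonglongrightarrow> (a \<omega>)\<^sup>2 * g N \<omega> * 0 / 2"
        unfolding R_def by (intro tendsto_intros) auto
      then have 2: "(\<lambda>k. R (N + k) \<omega>) \<longlonglongrightarrow> 0" by simp
      have "(\<lambda>k. \<Phi> (N + k) \<omega>) \<longlonglongrightarrow>
          iexp (a \<omega> * sqrt N * (limit \<omega> - \<theta> N \<omega>)) * complex_of_real (exp (- 0))"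
        unfolding \<Phi>_def S_def by (intro tendsto_intros 1 2)
      then show "(\<lambda>k. \<Phi> (N + k) \<omega>) \<longlonglongrightarrow> iexp (a \<omega> * sqrt N * (limit \<omega> - \<theta> N \<omega>))" by simp
    qed
    show "AE \<omega> in M. cmod (\<Phi> (N + k) \<omega>) \<le> 1" for k using \<Phi>_bd by auto
  qed auto
  then have "(\<lambda>k. cmod ((\<integral>\<omega>. \<Phi> (N + k) \<omega> \<partial>M) - (\<integral>\<omega>. \<Phi> N \<omega> \<partial>M))) \<longlonglongrightarrow>
      cmod ((\<integral>\<omega>. iexp (a \<omega> * sqrt N * (limit \<omega> - \<theta> N \<omega>)) \<partial>M) - (\<integral>\<omega>. \<Phi> N \<omega> \<partial>M))"
    by (intro tendsto_intros)
  ultimately have "cmod ((\<integral>\<omega>. iexp (a \<omega> * sqrt N * (limit \<omega> - \<theta> N \<omega>)) \<partial>M) - (\<integral>\<omega>. \<Phi> N \<omega> \<partial>M)) \<le> ?B"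
    by (intro LIMSEQ_le_const2) auto
  moreover have "\<Phi> N = (\<lambda>\<omega>. complex_of_real (exp (- ((a \<omega>)\<^sup>2 * g N \<omega> / 2))))"
    using N by (simp add: \<Phi>_def S_def R_def fun_eq_iff)
  ultimately show ?thesis by simp
qed

end

text \<open>Young's inequality separates b from x - y. In the application b is bounded in mean
  square only, while x - y is controlled only almost surely; the cap 2 makes dominated convergence
  available for the second term.\<close>

lemma cmod_iexp_diff_le:
  assumes "0 < \<eta>"
  shows "cmod (iexp (b * x) - iexp (b * y)) \<le> \<eta> * b\<^sup>2 + min 2 ((x - y)\<^sup>2 / (4 * \<eta>))"
proof -
  let ?h = "x - y"
  have "iexp (b * x) - iexp (b * y) = iexp (b * y) * (iexp (b * ?h) - 1)"
    by (simp add: right_diff_distrib exp_add[symmetric] flip: of_real_add)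
  then have "cmod (iexp (b * x) - iexp (b * y)) = cmod (iexp (b * ?h) - 1)"
    by (simp add: norm_mult)
  also have "\<dots> \<le> \<bar>b * ?h\<bar>" using iexp_approx1[of "b * ?h" 0] by simp
  also have "\<dots> \<le> \<eta> * b\<^sup>2 + ?h\<^sup>2 / (4 * \<eta>)"
  proof -
    have "0 \<le> (2 * \<eta> * \<bar>b\<bar> - \<bar>?h\<bar>)\<^sup>2 / (4 * \<eta>)" using assms by simp
    also have "\<dots> = \<eta> * b\<^sup>2 + ?h\<^sup>2 / (4 * \<eta>) - \<bar>b\<bar> * \<bar>?h\<bar>"
      using assms by (simp add: power2_diff power_mult_distrib field_simps) (simp add: power2_eq_square)
    finally show ?thesis by (simp add: abs_mult)
  qed
  finally have 1: "cmod (iexp (b * x) - iexp (b * y)) \<le> \<eta> * b\<^sup>2 + ?h\<^sup>2 / (4 * \<eta>)" .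
  have 2: "cmod (iexp (b * x) - iexp (b * y)) \<le> 2"
    using norm_triangle_ineq4[of "iexp (b * x)" "iexp (b * y)"] by simp
  have "0 \<le> \<eta> * b\<^sup>2" using assms by simp
  with 1 2 show ?thesis by (simp add: min_def)
qed

section \<open>Limits of the conditional variances and the studentized limit theorem\<close>

locale l2_martingale_clt = l2_martingale M F \<theta> \<zeta> g
  for M :: "'w measure" and F \<theta> \<zeta> g +
  fixes ginf :: "'w \<Rightarrow> real"
  assumes ginf_meas [measurable]: "ginf \<in> borel_measurable M"
    and var_tendsto: "AE \<omega> in M. (\<lambda>k. g k \<omega>) \<longlonglongrightarrow> ginf \<omega>"
    and ginf_pos: "AE \<omega> in M. 0 < ginf \<omega>"
begin

lemma ginf_integrable: "integrable M ginf"
proof -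
  obtain C where C: "\<And>k. (\<integral>\<omega>. g k \<omega> \<partial>M) \<le> C" using variance_bounded by blast
  show ?thesis
    by (rule fatou_expectation_bound(1)[OF var_integrable _ _ var_tendsto C])
      (use var_nonneg in auto)
qed

text \<open>Vitali's theorem by truncation: the part below K converges by domination, the excess of
  \<open>g k\<close> is at most e / 4 by \<open>excess_var_le\<close>, and so is that of the limit
  by Fatou's lemma.\<close>

lemma var_L1: "(\<lambda>k. \<integral>\<omega>. \<bar>g k \<omega> - ginf \<omega>\<bar> \<partial>M) \<longlonglongrightarrow> 0"
proof (rule tendstoI)
  fix e :: real assume e: "e > 0"
  then obtain K where K: "K \<ge> 0" "\<And>k. (\<integral>\<omega>. max 0 ((\<zeta> k \<omega>)\<^sup>2 - K) \<partial>M) \<le> e / 4"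
    using excess_small[of "e / 4"] by auto
  have Kg: "(\<integral>\<omega>. max 0 (g k \<omega> - K) \<partial>M) \<le> e / 4" for k
    using excess_var_le[of k K] K(2)[of k] by linarith
  have lim: "AE \<omega> in M. (\<lambda>k. max 0 (g k \<omega> - K)) \<longlonglongrightarrow> max 0 (ginf \<omega> - K)"
    using var_tendsto by eventually_elim (intro tendsto_intros)
  have Kinf: "(\<integral>\<omega>. max 0 (ginf \<omega> - K) \<partial>M) \<le> e / 4"
    by (rule fatou_expectation_bound(2)[OF _ _ _ lim Kg]) auto
  have "(\<lambda>k. \<integral>\<omega>. \<bar>min K (g k \<omega>) - min K (ginf \<omega>)\<bar> \<partial>M) \<longlonglongrightarrow> (\<integral>\<omega>. 0 \<partial>M)"
  proof (rule integral_dominated_convergence[where w = "\<lambda>_. K"])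
    show "AE \<omega> in M. (\<lambda>k. \<bar>min K (g k \<omega>) - min K (ginf \<omega>)\<bar>) \<longlonglongrightarrow> 0"
      using var_tendsto
    proof eventually_elim
      fix \<omega> assume "(\<lambda>k. g k \<omega>) \<longlonglongrightarrow> ginf \<omega>"
      then have "(\<lambda>k. \<bar>min K (g k \<omega>) - min K (ginf \<omega>)\<bar>) \<longlonglongrightarrow> \<bar>min K (ginf \<omega>) - min K (ginf \<omega>)\<bar>"
        by (intro tendsto_intros)
      then show "(\<lambda>k. \<bar>min K (g k \<omega>) - min K (ginf \<omega>)\<bar>) \<longlonglongrightarrow> 0" by simp
    qed
    show "AE \<omega> in M. norm \<bar>min K (g k \<omega>) - min K (ginf \<omega>)\<bar> \<le> K" for k
      using ginf_pos AE_space
    proof eventually_elim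
      fix \<omega> assume "0 < ginf \<omega>" "\<omega> \<in> space M"
      with var_nonneg[of \<omega> k] K(1) show "norm \<bar>min K (g k \<omega>) - min K (ginf \<omega>)\<bar> \<le> K"
        by (auto simp: min_def)
    qed
  qed auto
  then have "\<forall>\<^sub>F k in sequentially. (\<integral>\<omega>. \<bar>min K (g k \<omega>) - min K (ginf \<omega>)\<bar> \<partial>M) < e / 4"
    using e by (intro order_tendstoD(2)) auto
  then show "\<forall>\<^sub>F k in sequentially. dist (\<integral>\<omega>. \<bar>g k \<omega> - ginf \<omega>\<bar> \<partial>M) 0 < e"
  proof eventually_elim
    fix k assume k: "(\<integral>\<omega>. \<bar>min K (g k \<omega>) - min K (ginf \<omega>)\<bar> \<partial>M) < e / 4"
    have i: "integrable M (\<lambda>\<omega>. \<bar>min K (g k \<omega>) - min K (ginf \<omega>)\<bar>)"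
      "integrable M (\<lambda>\<omega>. max 0 (ginf \<omega> - K))"
      using var_integrable[of k] ginf_integrable by auto
    have "(\<integral>\<omega>. \<bar>g k \<omega> - ginf \<omega>\<bar> \<partial>M) \<le> (\<integral>\<omega>. \<bar>min K (g k \<omega>) - min K (ginf \<omega>)\<bar>
        + (max 0 (g k \<omega> - K) + max 0 (ginf \<omega> - K)) \<partial>M)"
    proof (rule integral_mono)
      show "integrable M (\<lambda>\<omega>. \<bar>min K (g k \<omega>) - min K (ginf \<omega>)\<bar>
          + (max 0 (g k \<omega> - K) + max 0 (ginf \<omega> - K)))"
        using i by (intro Bochner_Integration.integrable_add) auto
      show "\<bar>g k \<omega> - ginf \<omega>\<bar> \<le> \<bar>min K (g k \<omega>) - min K (ginf \<omega>)\<bar>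
          + (max 0 (g k \<omega> - K) + max 0 (ginf \<omega> - K))" for \<omega>
        by (auto simp: min_def max_def)
    qed (use var_integrable[of k] ginf_integrable in auto)
    also have "\<dots> = (\<integral>\<omega>. \<bar>min K (g k \<omega>) - min K (ginf \<omega>)\<bar> \<partial>M)
        + ((\<integral>\<omega>. max 0 (g k \<omega> - K) \<partial>M) + (\<integral>\<omega>. max 0 (ginf \<omega> - K) \<partial>M))"
      using i by simp
    also have "\<dots> < e" using k Kg[of k] Kinf e by linarith
    finally show "dist (\<integral>\<omega>. \<bar>g k \<omega> - ginf \<omega>\<bar> \<partial>M) 0 < e" by (simp add: dist_real_def)
  qed
qed

lemma expectation_var_tendsto: "(\<lambda>k. \<integral>\<omega>. g k \<omega> \<partial>M) \<longlonglongrightarrow> (\<integral>\<omega>. ginf \<omega> \<partial>M)"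
proof (rule LIM_zero_cancel, rule Lim_null_comparison[OF always_eventually var_L1], rule allI)
  fix k
  have "(\<integral>\<omega>. g k \<omega> \<partial>M) - (\<integral>\<omega>. ginf \<omega> \<partial>M) = (\<integral>\<omega>. g k \<omega> - ginf \<omega> \<partial>M)"
    using var_integrable[of k] ginf_integrable by simp
  then show "norm ((\<integral>\<omega>. g k \<omega> \<partial>M) - (\<integral>\<omega>. ginf \<omega> \<partial>M)) \<le> (\<integral>\<omega>. \<bar>g k \<omega> - ginf \<omega>\<bar> \<partial>M)"
    by (simp add: integral_abs_bound)
qed

lemma expectation_ginf_pos: "0 < (\<integral>\<omega>. ginf \<omega> \<partial>M)"
proof -
  have "0 \<le> (\<integral>\<omega>. ginf \<omega> \<partial>M)"
    using ginf_pos by (intro integral_nonneg_AE, eventually_elim) simp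
  moreover have "(\<integral>\<omega>. ginf \<omega> \<partial>M) \<noteq> 0"
  proof
    assume "(\<integral>\<omega>. ginf \<omega> \<partial>M) = 0"
    moreover have "AE \<omega> in M. 0 \<le> ginf \<omega>" using ginf_pos by eventually_elim simp
    ultimately have "AE \<omega> in M. ginf \<omega> = 0"
      using integral_nonneg_eq_0_iff_AE[OF ginf_integrable] by simp
    with ginf_pos have "AE \<omega> in M. False" by eventually_elim simp
    then show False by simp
  qed
  ultimately show ?thesis by linarith
qed

lemma scaled_limit_L2_tendsto:
  "(\<lambda>N. real N * (\<integral>\<omega>. (limit \<omega> - \<theta> N \<omega>)\<^sup>2 \<partial>M)) \<longlonglongrightarrow> (\<integral>\<omega>. ginf \<omega> \<partial>M)"
  using tail_inverse_squares_limit[OF expectation_var_tendsto] by (simp only: limit_L2(2))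

text \<open>One threshold \<open>N0\<close> serves all multipliers bounded by K, because the
  multiplier used later changes with N. The truncation level L depends only on e and K; the terms
  containing it vanish as N grows.\<close>

lemma char_frozen_limit:
  assumes "0 < e"
  shows "\<exists>N0. \<forall>N\<ge>N0. \<forall>a \<in> borel_measurable (F N). (\<forall>\<omega>. \<bar>a \<omega>\<bar> \<le> K) \<longrightarrow>
    cmod ((\<integral>\<omega>. iexp (a \<omega> * sqrt N * (limit \<omega> - \<theta> N \<omega>)) \<partial>M)
        - (\<integral>\<omega>. complex_of_real (exp (- ((a \<omega>)\<^sup>2 * g N \<omega> / 2))) \<partial>M)) \<le> e"
proof -
  \<comment> \<open>Five copies of \<open>u\<close> occur in the error, four from the Taylor
    remainders and one from the variance change; K^2 times their sum must stay below e / 2. The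
    summand 1 covers K = 0.\<close>
  define u where "u = e / (10 * (K\<^sup>2 + 1))"
  have K1: "0 < K\<^sup>2 + 1" by (simp add: add_nonneg_pos)
  have u: "u > 0" using assms K1 by (simp add: u_def)
  have Ku: "K\<^sup>2 * (5 * u) \<le> e / 2"
  proof -
    have "K\<^sup>2 * (5 * u) \<le> (K\<^sup>2 + 1) * (5 * u)" using u by (intro mult_right_mono) auto
    also have "\<dots> = e / 2"
    proof -
      have "J * (5 * (e / (10 * J))) = e / 2" if "0 < J" for J using that by simp
      from this[OF K1] show ?thesis by (simp only: u_def)
    qed
    finally show ?thesis .
  qed
  obtain L where L: "0 \<le> L" "\<And>k. (\<integral>\<omega>. max 0 ((\<zeta> k \<omega>)\<^sup>2 - L) \<partial>M) \<le> u"
    using excess_small[OF u] by auto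
  obtain C where C: "\<And>k. (\<integral>\<omega>. g k \<omega> \<partial>M) \<le> C" using variance_bounded by blast
  let ?f = "\<lambda>N::nat. K\<^sup>2 * (2 * L * (K / sqrt N * sqrt (2 * L)) + 2 * L * (K\<^sup>2 / N * (2 * L)) + C / N)"
  have "?f \<longlonglongrightarrow> K\<^sup>2 * (2 * L * (0 * sqrt (2 * L)) + 2 * L * (0 * (2 * L)) + 0)"
    by (intro tendsto_intros; real_asymp)
  then have f: "\<forall>\<^sub>F N in sequentially. ?f N < e / 2"
    using assms by (intro order_tendstoD(2)) auto
  have "\<forall>\<^sub>F N in sequentially. (\<integral>\<omega>. \<bar>g N \<omega> - ginf \<omega>\<bar> \<partial>M) < u / 2"
    using var_L1 u by (intro order_tendstoD(2)) auto
  with f have "\<forall>\<^sub>F N in sequentially. ?f N < e / 2 \<and> (\<integral>\<omega>. \<bar>g N \<omega> - ginf \<omega>\<bar> \<partial>M) < u / 2"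
    by eventually_elim simp
  then obtain N0 where N0: "\<And>N. N \<ge> N0 \<Longrightarrow> ?f N < e / 2"
      "\<And>N. N \<ge> N0 \<Longrightarrow> (\<integral>\<omega>. \<bar>g N \<omega> - ginf \<omega>\<bar> \<partial>M) < u / 2"
    unfolding eventually_sequentially by auto
  have d: "(\<integral>\<omega>. \<bar>g m \<omega> - g N \<omega>\<bar> \<partial>M) \<le> u" if "N0 \<le> N" "N \<le> m" for m N
  proof -
    have i: "integrable M (\<lambda>\<omega>. \<bar>g k \<omega> - ginf \<omega>\<bar>)" for k
      using var_integrable[of k] ginf_integrable by auto
    have "(\<integral>\<omega>. \<bar>g m \<omega> - g N \<omega>\<bar> \<partial>M) \<le> (\<integral>\<omega>. \<bar>g m \<omega> - ginf \<omega>\<bar> + \<bar>g N \<omega> - ginf \<omega>\<bar> \<partial>M)"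
      using i var_integrable by (intro integral_mono) auto
    also have "\<dots> = (\<integral>\<omega>. \<bar>g m \<omega> - ginf \<omega>\<bar> \<partial>M) + (\<integral>\<omega>. \<bar>g N \<omega> - ginf \<omega>\<bar> \<partial>M)"
      using i by simp
    also have "\<dots> \<le> u" using N0(2)[of m] N0(2)[of N] that by linarith
    finally show ?thesis .
  qed
  show ?thesis
  proof (intro exI[of _ "max 1 N0"] allI impI ballI)
    fix N a assume N: "max 1 N0 \<le> N" and a: "a \<in> borel_measurable (F N)" and K: "\<forall>\<omega>. \<bar>a \<omega>\<bar> \<le> K"
    have "cmod ((\<integral>\<omega>. iexp (a \<omega> * sqrt N * (limit \<omega> - \<theta> N \<omega>)) \<partial>M)
        - (\<integral>\<omega>. complex_of_real (exp (- ((a \<omega>)\<^sup>2 * g N \<omega> / 2))) \<partial>M))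
      \<le> K\<^sup>2 * (4 * u + 2 * L * (K / sqrt N * sqrt (2 * L)) + 2 * L * (K\<^sup>2 / N * (2 * L)) + u + C / N)"
      by (rule char_frozen_bound[OF _ a _ L C d]) (use N K in auto)
    also have "\<dots> = K\<^sup>2 * (5 * u) + ?f N" by (simp add: algebra_simps)
    also have "\<dots> \<le> e / 2 + e / 2" using Ku N0(1)[of N] N by (intro add_mono) auto
    finally show "cmod ((\<integral>\<omega>. iexp (a \<omega> * sqrt N * (limit \<omega> - \<theta> N \<omega>)) \<partial>M)
        - (\<integral>\<omega>. complex_of_real (exp (- ((a \<omega>)\<^sup>2 * g N \<omega> / 2))) \<partial>M)) \<le> e" by simp
  qed
qed

text \<open>The exact multiplier \<open>W N\<close> of sqrt N times the remaining error is in
  general neither bounded nor known at time N, whereas its substitute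
  \<open>A \<delta> (g N)\<close> is both. Three errors arise: exchanging the multipliers, freezing
  the variance, and the distance of the resulting Gaussian factor from exp(- t^2 / 2).\<close>

lemma studentized_char_tendsto:
  assumes V [measurable]: "\<And>N. V N \<in> borel_measurable M"
    and lim: "AE \<omega> in M. (\<lambda>N. real N * V N \<omega>) \<longlonglongrightarrow> ginf \<omega>"
  shows "(\<lambda>N. \<integral>\<omega>. iexp (t * (inverse (sqrt (V N \<omega>)) * (limit \<omega> - \<theta> N \<omega>))) \<partial>M)
    \<longlonglongrightarrow> complex_of_real (exp (- t\<^sup>2 / 2))"
proof (rule tendstoI)
  fix e :: real assume e: "e > 0"
  define C where "C = (\<integral>\<omega>. ginf \<omega> \<partial>M) + 1"
  have C: "C > 0" using expectation_ginf_pos by (simp add: C_def)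
  \<comment> \<open>Eventually \<open>C\<close> bounds the second moment of sqrt N (limit - \<theta>
    N), so the term \<eta> b^2 of \<open>cmod_iexp_diff_le\<close> costs at most e / 8.\<close>
  define \<eta> where "\<eta> = e / (8 * C)"
  have \<eta>: "\<eta> > 0" "\<eta> * C = e / 8" using e C by (auto simp: \<eta>_def)
  define T where "T = exp (- t\<^sup>2 / 2)"
  have T: "0 \<le> T" "T \<le> 1" by (auto simp: T_def)
  \<comment> \<open>Collects the first and the third error, with x the exact multiplier, y the
    floored one and z the variance. It is continuous, and bounded for z >= 0, so its expectation
    passes to the limit.\<close>
  define G where "G x y z = min 2 ((x - y)\<^sup>2 / (4 * \<eta>)) + \<bar>exp (- (y\<^sup>2 * z / 2)) - T\<bar>" for x y z
  have G_meas [measurable]: "(\<lambda>\<omega>. G (x \<omega>) (y \<omega>) (z \<omega>)) \<in> borel_measurable M"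
    if [measurable]: "x \<in> borel_measurable M" "y \<in> borel_measurable M" "z \<in> borel_measurable M" for x y z
    unfolding G_def by measurable
  have G_bd: "norm (G x y z) \<le> 3" if "0 \<le> z" for x y z
  proof -
    have "exp (- (y\<^sup>2 * z / 2)) \<le> 1" using that by simp
    then have "\<bar>exp (- (y\<^sup>2 * z / 2)) - T\<bar> \<le> 1"
      using T exp_ge_zero[of "- (y\<^sup>2 * z / 2)"] by linarith
    moreover have "0 \<le> min 2 ((x - y)\<^sup>2 / (4 * \<eta>))" using \<eta> by simp
    moreover have "min 2 ((x - y)\<^sup>2 / (4 * \<eta>)) \<le> 2" by simp
    ultimately show ?thesis unfolding G_def real_norm_def by linarith
  qed
  define A where "A \<delta> x = t / max \<delta> (sqrt x)" for \<delta> x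
  have A_meas [measurable]: "(\<lambda>\<omega>. A \<delta> (z \<omega>)) \<in> borel_measurable N"
    if [measurable]: "z \<in> borel_measurable N" for \<delta> z and N :: "'w measure"
    unfolding A_def by measurable
  \<comment> \<open>\<delta> is fixed before N. Where the limiting variance is positive, the floor
    is inactive once \<delta> is below its square root, and then \<open>G\<close> is exactly
    0.\<close>
  have "(\<lambda>j. \<integral>\<omega>. G (t / sqrt (ginf \<omega>)) (A (1 / real (Suc j)) (ginf \<omega>)) (ginf \<omega>) \<partial>M) \<longlonglongrightarrow> (\<integral>\<omega>. 0 \<partial>M)"
  proof (rule integral_dominated_convergence[where w = "\<lambda>_. 3"])
    show "AE \<omega> in M. (\<lambda>j. G (t / sqrt (ginf \<omega>)) (A (1 / real (Suc j)) (ginf \<omega>)) (ginf \<omega>)) \<longlonglongrightarrow> 0"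
      using ginf_pos
    proof eventually_elim
      fix \<omega> assume pos: "0 < ginf \<omega>"
      have "(\<lambda>j. 1 / real (Suc j)) \<longlonglongrightarrow> 0" by real_asymp
      then have "\<forall>\<^sub>F j in sequentially. 1 / real (Suc j) < sqrt (ginf \<omega>)"
        using pos by (intro order_tendstoD(2)) auto
      then have "\<forall>\<^sub>F j in sequentially. G (t / sqrt (ginf \<omega>)) (A (1 / real (Suc j)) (ginf \<omega>)) (ginf \<omega>) = 0"
      proof eventually_elim
        fix j assume "1 / real (Suc j) < sqrt (ginf \<omega>)"
        then have "A (1 / real (Suc j)) (ginf \<omega>) = t / sqrt (ginf \<omega>)"
          unfolding A_def by (simp only: max_absorb2 less_imp_le)
        then show "G (t / sqrt (ginf \<omega>)) (A (1 / real (Suc j)) (ginf \<omega>)) (ginf \<omega>) = 0"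
          using pos by (simp add: G_def T_def power_divide)
      qed
      then show "(\<lambda>j. G (t / sqrt (ginf \<omega>)) (A (1 / real (Suc j)) (ginf \<omega>)) (ginf \<omega>)) \<longlonglongrightarrow> 0"
        by (rule tendsto_eventually)
    qed
    show "AE \<omega> in M. norm (G (t / sqrt (ginf \<omega>)) (A (1 / real (Suc j)) (ginf \<omega>)) (ginf \<omega>)) \<le> 3" for j
      using ginf_pos by eventually_elim (rule G_bd, simp)
  qed auto
  then have "\<forall>\<^sub>F j in sequentially. (\<integral>\<omega>. G (t / sqrt (ginf \<omega>)) (A (1 / real (Suc j)) (ginf \<omega>)) (ginf \<omega>) \<partial>M) < e / 4"
    using e by (intro order_tendstoD(2)) auto
  then obtain j where j: "(\<integral>\<omega>. G (t / sqrt (ginf \<omega>)) (A (1 / real (Suc j)) (ginf \<omega>)) (ginf \<omega>) \<partial>M) < e / 4"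
    unfolding eventually_sequentially by auto
  define \<delta> where "\<delta> = 1 / real (Suc j)"
  have \<delta>: "\<delta> > 0" by (simp add: \<delta>_def)
  define W where "W N \<omega> = t * inverse (sqrt N * sqrt (V N \<omega>))" for N \<omega>
  have [measurable]: "W N \<in> borel_measurable M" for N unfolding W_def by measurable
  have "(\<lambda>N. \<integral>\<omega>. G (W N \<omega>) (A \<delta> (g N \<omega>)) (g N \<omega>) \<partial>M) \<longlonglongrightarrow>
      (\<integral>\<omega>. G (t / sqrt (ginf \<omega>)) (A \<delta> (ginf \<omega>)) (ginf \<omega>) \<partial>M)"
  proof (rule integral_dominated_convergence[where w = "\<lambda>_. 3"])
    show "AE \<omega> in M. (\<lambda>N. G (W N \<omega>) (A \<delta> (g N \<omega>)) (g N \<omega>)) \<longlonglongrightarrow>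
        G (t / sqrt (ginf \<omega>)) (A \<delta> (ginf \<omega>)) (ginf \<omega>)"
      using var_tendsto ginf_pos lim
    proof eventually_elim
      fix \<omega> assume g: "(\<lambda>k. g k \<omega>) \<longlonglongrightarrow> ginf \<omega>" and pos: "0 < ginf \<omega>"
        and V: "(\<lambda>N. real N * V N \<omega>) \<longlonglongrightarrow> ginf \<omega>"
      have "(\<lambda>N. t * inverse (sqrt (real N * V N \<omega>))) \<longlonglongrightarrow> t * inverse (sqrt (ginf \<omega>))"
        using pos by (intro tendsto_intros V) auto
      then have W: "(\<lambda>N. W N \<omega>) \<longlonglongrightarrow> t / sqrt (ginf \<omega>)"
        by (simp add: W_def real_sqrt_mult divide_inverse)
      have "(\<lambda>N. A \<delta> (g N \<omega>)) \<longlonglongrightarrow> A \<delta> (ginf \<omega>)"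
        unfolding A_def using \<delta> by (intro tendsto_intros g) auto
      with W g show "(\<lambda>N. G (W N \<omega>) (A \<delta> (g N \<omega>)) (g N \<omega>)) \<longlonglongrightarrow>
          G (t / sqrt (ginf \<omega>)) (A \<delta> (ginf \<omega>)) (ginf \<omega>)"
        unfolding G_def using \<eta> by (intro tendsto_intros) auto
    qed
    show "AE \<omega> in M. norm (G (W N \<omega>) (A \<delta> (g N \<omega>)) (g N \<omega>)) \<le> 3" for N
      by (rule AE_I2, rule G_bd, rule var_nonneg)
  qed auto
  then have ev_G: "\<forall>\<^sub>F N in sequentially. (\<integral>\<omega>. G (W N \<omega>) (A \<delta> (g N \<omega>)) (g N \<omega>) \<partial>M) < e / 4"
    using j by (intro order_tendstoD(2)) (auto simp: \<delta>_def)
  have ev_C: "\<forall>\<^sub>F N in sequentially. real N * (\<integral>\<omega>. (limit \<omega> - \<theta> N \<omega>)\<^sup>2 \<partial>M) < C"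
    by (rule order_tendstoD(2)[OF scaled_limit_L2_tendsto]) (simp add: C_def)
  obtain N0 where N0: "\<And>N a. N \<ge> N0 \<Longrightarrow> a \<in> borel_measurable (F N) \<Longrightarrow> (\<And>\<omega>. \<bar>a \<omega>\<bar> \<le> \<bar>t\<bar> / \<delta>) \<Longrightarrow>
    cmod ((\<integral>\<omega>. iexp (a \<omega> * sqrt N * (limit \<omega> - \<theta> N \<omega>)) \<partial>M)
        - (\<integral>\<omega>. complex_of_real (exp (- ((a \<omega>)\<^sup>2 * g N \<omega> / 2))) \<partial>M)) \<le> e / 8"
    using char_frozen_limit[of "e / 8" "\<bar>t\<bar> / \<delta>"] e by auto
  show "\<forall>\<^sub>F N in sequentially. dist (\<integral>\<omega>. iexp (t * (inverse (sqrt (V N \<omega>)) * (limit \<omega> - \<theta> N \<omega>))) \<partial>M)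
      (complex_of_real (exp (- t\<^sup>2 / 2))) < e"
    using ev_G ev_C eventually_ge_at_top[of "max 1 N0"]
  proof eventually_elim
    fix N assume GN: "(\<integral>\<omega>. G (W N \<omega>) (A \<delta> (g N \<omega>)) (g N \<omega>) \<partial>M) < e / 4"
      and CN: "real N * (\<integral>\<omega>. (limit \<omega> - \<theta> N \<omega>)\<^sup>2 \<partial>M) < C" and N: "max 1 N0 \<le> N"
    define B where "B \<omega> = sqrt N * (limit \<omega> - \<theta> N \<omega>)" for \<omega>
    define a where "a \<omega> = A \<delta> (g N \<omega>)" for \<omega>
    have a_meas: "a \<in> borel_measurable (F N)" unfolding a_def using var_adapted by measurable
    have [measurable]: "B \<in> borel_measurable M" "a \<in> borel_measurable M"
      unfolding B_def a_def by measurable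
    have a_bd: "\<bar>a \<omega>\<bar> \<le> \<bar>t\<bar> / \<delta>" for \<omega>
      unfolding a_def A_def using \<delta> by (simp add: divide_left_mono)
    have BB: "integrable M (\<lambda>\<omega>. (B \<omega>)\<^sup>2)" "(\<integral>\<omega>. (B \<omega>)\<^sup>2 \<partial>M) < C"
      using CN limit_L2(1)[of N] by (auto simp: B_def power_mult_distrib)
    have tU: "t * (inverse (sqrt (V N \<omega>)) * (limit \<omega> - \<theta> N \<omega>)) = B \<omega> * W N \<omega>" for \<omega>
      using N by (simp add: B_def W_def)
    have aB: "a \<omega> * sqrt N * (limit \<omega> - \<theta> N \<omega>) = B \<omega> * a \<omega>" for \<omega>
      by (simp add: B_def)
    let ?g = "\<lambda>\<omega>. exp (- ((a \<omega>)\<^sup>2 * g N \<omega> / 2))"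
    have int1: "integrable M (\<lambda>\<omega>. iexp (B \<omega> * W N \<omega>))" "integrable M (\<lambda>\<omega>. iexp (B \<omega> * a \<omega>))"
      by (rule integrable_const_bound[where B = 1]; simp)+
    have int2: "integrable M ?g"
      by (rule integrable_const_bound[where B = 1]) (use var_nonneg in auto)
    have int3: "integrable M (\<lambda>\<omega>. min 2 ((W N \<omega> - a \<omega>)\<^sup>2 / (4 * \<eta>)))"
      by (rule integrable_const_bound[where B = 2]) (use \<eta> in auto)
    have int4: "integrable M (\<lambda>\<omega>. \<bar>?g \<omega> - T\<bar>)" using int2 by simp
    have 1: "cmod ((\<integral>\<omega>. iexp (B \<omega> * W N \<omega>) \<partial>M) - (\<integral>\<omega>. iexp (B \<omega> * a \<omega>) \<partial>M))
        \<le> \<eta> * (\<integral>\<omega>. (B \<omega>)\<^sup>2 \<partial>M) + (\<integral>\<omega>. min 2 ((W N \<omega> - a \<omega>)\<^sup>2 / (4 * \<eta>)) \<partial>M)"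
    proof -
      have "cmod ((\<integral>\<omega>. iexp (B \<omega> * W N \<omega>) \<partial>M) - (\<integral>\<omega>. iexp (B \<omega> * a \<omega>) \<partial>M))
          = cmod (\<integral>\<omega>. iexp (B \<omega> * W N \<omega>) - iexp (B \<omega> * a \<omega>) \<partial>M)"
        using int1 by (simp only: Bochner_Integration.integral_diff)
      also have "\<dots> \<le> (\<integral>\<omega>. \<eta> * (B \<omega>)\<^sup>2 + min 2 ((W N \<omega> - a \<omega>)\<^sup>2 / (4 * \<eta>)) \<partial>M)"
        by (intro order_trans[OF integral_norm_bound integral_mono] cmod_iexp_diff_le \<eta>
            integrable_norm Bochner_Integration.integrable_diff Bochner_Integration.integrable_add
            int1 int3 integrable_mult_right BB)
      also have "\<dots> = \<eta> * (\<integral>\<omega>. (B \<omega>)\<^sup>2 \<partial>M) + (\<integral>\<omega>. min 2 ((W N \<omega> - a \<omega>)\<^sup>2 / (4 * \<eta>)) \<partial>M)"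
        using BB int3 by simp
      finally show ?thesis .
    qed
    have 2: "cmod ((\<integral>\<omega>. iexp (B \<omega> * a \<omega>) \<partial>M) - (\<integral>\<omega>. complex_of_real (?g \<omega>) \<partial>M)) \<le> e / 8"
      using N0[OF _ a_meas a_bd] N unfolding aB by simp
    have 3: "cmod ((\<integral>\<omega>. complex_of_real (?g \<omega>) \<partial>M) - complex_of_real T) \<le> (\<integral>\<omega>. \<bar>?g \<omega> - T\<bar> \<partial>M)"
    proof -
      have "(\<integral>\<omega>. complex_of_real (?g \<omega>) \<partial>M) - complex_of_real T = complex_of_real (\<integral>\<omega>. ?g \<omega> - T \<partial>M)"
        using int2 by (simp add: prob_space)
      then show ?thesis by (simp only: norm_of_real integral_abs_bound)
    qed
    have "(\<integral>\<omega>. G (W N \<omega>) (a \<omega>) (g N \<omega>) \<partial>M) =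
        (\<integral>\<omega>. min 2 ((W N \<omega> - a \<omega>)\<^sup>2 / (4 * \<eta>)) \<partial>M) + (\<integral>\<omega>. \<bar>?g \<omega> - T\<bar> \<partial>M)"
      unfolding G_def using int3 int4 by simp
    then have 4: "(\<integral>\<omega>. min 2 ((W N \<omega> - a \<omega>)\<^sup>2 / (4 * \<eta>)) \<partial>M) + (\<integral>\<omega>. \<bar>?g \<omega> - T\<bar> \<partial>M) < e / 4"
      using GN by (simp add: a_def)
    have 5: "\<eta> * (\<integral>\<omega>. (B \<omega>)\<^sup>2 \<partial>M) \<le> e / 8"
      using mult_left_mono[OF less_imp_le[OF BB(2)], of \<eta>] \<eta> by simp
    have "dist (\<integral>\<omega>. iexp (B \<omega> * W N \<omega>) \<partial>M) (complex_of_real T)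
        \<le> cmod ((\<integral>\<omega>. iexp (B \<omega> * W N \<omega>) \<partial>M) - (\<integral>\<omega>. iexp (B \<omega> * a \<omega>) \<partial>M))
        + (cmod ((\<integral>\<omega>. iexp (B \<omega> * a \<omega>) \<partial>M) - (\<integral>\<omega>. complex_of_real (?g \<omega>) \<partial>M))
        + cmod ((\<integral>\<omega>. complex_of_real (?g \<omega>) \<partial>M) - complex_of_real T))"
      unfolding dist_norm[symmetric]
      by (rule order_trans[OF dist_triangle add_left_mono[OF dist_triangle]])
    also have "\<dots> < e" using 1 2 3 4 5 e by linarith
    finally show "dist (\<integral>\<omega>. iexp (t * (inverse (sqrt (V N \<omega>)) * (limit \<omega> - \<theta> N \<omega>))) \<partial>M)
        (complex_of_real (exp (- t\<^sup>2 / 2))) < e"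
      unfolding tU T_def .
  qed
qed

lemma studentized_clt:
  assumes V [measurable]: "\<And>N. V N \<in> borel_measurable M"
    and lim: "AE \<omega> in M. (\<lambda>N. real N * V N \<omega>) \<longlonglongrightarrow> ginf \<omega>"
  shows "weak_conv_m (\<lambda>N. distr M borel (\<lambda>\<omega>. inverse (sqrt (V N \<omega>)) * (limit \<omega> - \<theta> N \<omega>)))
    std_normal_distribution"
proof (rule levy_continuity)
  show "real_distribution (distr M borel (\<lambda>\<omega>. inverse (sqrt (V N \<omega>)) * (limit \<omega> - \<theta> N \<omega>)))" for N
    by (rule real_distribution_distr) measurable
  show "real_distribution std_normal_distribution"
    by (rule real_dist_normal_dist)
  have "char (distr M borel (\<lambda>\<omega>. inverse (sqrt (V N \<omega>)) * (limit \<omega> - \<theta> N \<omega>))) t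
      = (\<integral>\<omega>. iexp (t * (inverse (sqrt (V N \<omega>)) * (limit \<omega> - \<theta> N \<omega>))) \<partial>M)" for N t
    unfolding char_def by (rule integral_distr) measurable
  then show "(\<lambda>N. char (distr M borel (\<lambda>\<omega>. inverse (sqrt (V N \<omega>)) * (limit \<omega> - \<theta> N \<omega>))) t)
      \<longlonglongrightarrow> char std_normal_distribution t" for t
    using studentized_char_tendsto[OF V lim, of t] by (simp add: char_std_normal_distribution)
qed

end

section \<open>Disintegration along a conditional law\<close>

text \<open>In \<open>cond_law\<close> the exceptional null set may depend on A. The integrands
  considered below are measurable for \<open>F\<close> in the first variable, so that \<omega> acts
  as a known parameter when y is drawn from \<kappa> \<omega>.\<close>

locale conditional_law = prob_space M for M :: "'w measure" +
  fixes F :: "'w measure" and \<mu> :: "'y measure" and Y :: "'w \<Rightarrow> 'y" and \<kappa> :: "'w \<Rightarrow> 'y measure"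
  assumes subalg: "subalgebra M F"
    and Y_meas [measurable]: "Y \<in> M \<rightarrow>\<^sub>M \<mu>"
    and kernel_prob: "\<And>\<omega>. \<omega> \<in> space M \<Longrightarrow> prob_space (\<kappa> \<omega>)"
    and kernel_sets: "\<And>\<omega>. \<omega> \<in> space M \<Longrightarrow> sets (\<kappa> \<omega>) = sets \<mu>"
    and cond_law: "\<And>A. A \<in> sets \<mu> \<Longrightarrow>
      AE \<omega> in M. real_cond_exp M F (\<lambda>\<omega>'. indicator A (Y \<omega>')) \<omega> = measure (\<kappa> \<omega>) A"
begin

lemma graph_measurable [measurable]: "(\<lambda>\<omega>. (\<omega>, Y \<omega>)) \<in> M \<rightarrow>\<^sub>M F \<Otimes>\<^sub>M \<mu>"
proof -
  have "id \<in> M \<rightarrow>\<^sub>M F" using subalg by (auto simp: measurable_def subalgebra_def)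
  then show ?thesis by (intro measurable_Pair) (auto simp: id_def)
qed

lemma space_F: "space F = space M" using subalg by (simp add: subalgebra_def)

lemma space_kernel: "\<omega> \<in> space M \<Longrightarrow> space (\<kappa> \<omega>) = space \<mu>"
  using kernel_sets sets_eq_imp_space_eq by blast

lemma section_sets:
  "C \<in> sets (F \<Otimes>\<^sub>M \<mu>) \<Longrightarrow> \<omega> \<in> space M \<Longrightarrow> Pair \<omega> -` C \<in> sets (\<kappa> \<omega>)"
  using sets_Pair1[of C F \<mu> \<omega>] kernel_sets[of \<omega>] by simp

text \<open>The kernel is not assumed measurable in \<open>\<omega>\<close>; it agrees only almost everywhere with a
  measurable function, hence the witness \<open>q\<close>.\<close>

lemma disintegration_indicator:
  assumes "C \<in> sets (F \<Otimes>\<^sub>M \<mu>)"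
  shows "\<exists>q \<in> borel_measurable M. (AE \<omega> in M. q \<omega> = emeasure (\<kappa> \<omega>) (Pair \<omega> -` C)) \<and>
    (\<integral>\<^sup>+\<omega>. indicator C (\<omega>, Y \<omega>) \<partial>M) = (\<integral>\<^sup>+\<omega>. q \<omega> \<partial>M)"
  using Int_stable_pair_measure_generator pair_measure_closed assms
  unfolding sets_pair_measure
proof (induct rule: sigma_sets_induct_disjoint)
  \<comment> \<open>On a rectangle the witness is the conditional probability of \<open>Y\<close> in
    A, cut down to B; the integral identity is its defining property on the event B.\<close>
  case (basic C)
  then obtain B A where C: "C = B \<times> A" and B: "B \<in> sets F" and A [measurable]: "A \<in> sets \<mu>" by auto
  have BM [measurable]: "B \<in> sets M" using B subalg by (auto simp: subalgebra_def)
  interpret sigma_finite_subalgebra M F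
    by (rule finite_measure_subalgebra_is_sigma_finite)
      (simp add: finite_measure_subalgebra_def finite_measure_subalgebra_axioms_def subalg finite_measure_axioms)
  let ?r = "real_cond_exp M F (\<lambda>\<omega>. indicator A (Y \<omega>))"
  have iA: "integrable M (\<lambda>\<omega>. indicator A (Y \<omega>) :: real)"
    by (rule integrable_const_bound[where B = 1]) auto
  have r0: "AE \<omega> in M. 0 \<le> ?r \<omega>" using cond_law[OF A] by eventually_elim simp
  have r_int: "integrable M ?r" by (rule real_cond_exp_int(1)[OF iA])
  have ri: "integrable M (\<lambda>\<omega>. indicator B \<omega> * ?r \<omega>)"
    using integrable_mult_indicator[OF BM r_int] by simp
  show ?case
  proof (intro bexI[of _ "\<lambda>\<omega>. ennreal (indicator B \<omega> * ?r \<omega>)"] conjI)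
    show "AE \<omega> in M. ennreal (indicator B \<omega> * ?r \<omega>) = emeasure (\<kappa> \<omega>) (Pair \<omega> -` C)"
      using cond_law[OF A] AE_space
    proof eventually_elim
      fix \<omega> assume *: "?r \<omega> = measure (\<kappa> \<omega>) A" "\<omega> \<in> space M"
      interpret k: prob_space "\<kappa> \<omega>" by (rule kernel_prob) fact
      have "Pair \<omega> -` C = (if \<omega> \<in> B then A else {})" by (auto simp: C)
      then show "ennreal (indicator B \<omega> * ?r \<omega>) = emeasure (\<kappa> \<omega>) (Pair \<omega> -` C)"
        using * by (simp add: k.emeasure_eq_measure)
    qed
    have "(\<integral>\<^sup>+\<omega>. indicator C (\<omega>, Y \<omega>) \<partial>M) = (\<integral>\<^sup>+\<omega>. ennreal (indicator B \<omega> * indicator A (Y \<omega>)) \<partial>M)"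
      by (intro nn_integral_cong) (auto simp: C indicator_def)
    also have "\<dots> = ennreal (\<integral>\<omega>. indicator B \<omega> * indicator A (Y \<omega>) \<partial>M)"
      by (intro nn_integral_eq_integral integrable_const_bound[where B = 1]) (auto simp: indicator_def)
    also have "(\<integral>\<omega>. indicator B \<omega> * indicator A (Y \<omega>) \<partial>M) = (\<integral>\<omega>. indicator B \<omega> * ?r \<omega> \<partial>M)"
      using real_cond_exp_intA[OF iA B] by (simp add: set_lebesgue_integral_def)
    also have "ennreal \<dots> = (\<integral>\<^sup>+\<omega>. ennreal (indicator B \<omega> * ?r \<omega>) \<partial>M)"
      using r0 by (intro nn_integral_eq_integral[symmetric] ri, eventually_elim) simp
    finally show "(\<integral>\<^sup>+\<omega>. indicator C (\<omega>, Y \<omega>) \<partial>M) = (\<integral>\<^sup>+\<omega>. ennreal (indicator B \<omega> * ?r \<omega>) \<partial>M)" .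
  qed measurable
next
  case empty
  show ?case by (intro bexI[of _ "\<lambda>_. 0"]) auto
next
  case (compl C)
  note C [measurable] = compl(1)[folded sets_pair_measure]
  from compl(2) obtain q where q [measurable]: "q \<in> borel_measurable M"
    and q_eq: "AE \<omega> in M. q \<omega> = emeasure (\<kappa> \<omega>) (Pair \<omega> -` C)"
    and q_int: "(\<integral>\<^sup>+\<omega>. indicator C (\<omega>, Y \<omega>) \<partial>M) = (\<integral>\<^sup>+\<omega>. q \<omega> \<partial>M)" by blast
  \<comment> \<open>Subtraction of extended nonnegative reals commutes with the integral when the
    smaller function has a finite integral; \<open>q1\<close> and \<open>fin\<close> secure
    this.\<close>
  have q1: "AE \<omega> in M. q \<omega> \<le> 1"
    using q_eq AE_space
  proof eventually_elim
    fix \<omega> assume *: "q \<omega> = emeasure (\<kappa> \<omega>) (Pair \<omega> -` C)" "\<omega> \<in> space M"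
    interpret k: prob_space "\<kappa> \<omega>" by (rule kernel_prob) fact
    show "q \<omega> \<le> 1" using * k.measure_le_1 by simp
  qed
  have "(\<integral>\<^sup>+\<omega>. q \<omega> \<partial>M) \<le> (\<integral>\<^sup>+\<omega>. 1 \<partial>M)" using q1 by (intro nn_integral_mono_AE) auto
  also have "\<dots> = 1" by (simp add: emeasure_space_1)
  finally have fin: "(\<integral>\<^sup>+\<omega>. q \<omega> \<partial>M) \<noteq> \<infinity>" by (auto simp: top_unique)
  show ?case
  proof (intro bexI[of _ "\<lambda>\<omega>. 1 - q \<omega>"] conjI)
    show "AE \<omega> in M. 1 - q \<omega> = emeasure (\<kappa> \<omega>) (Pair \<omega> -` (space F \<times> space \<mu> - C))"
      using q_eq AE_space
    proof eventually_elim
      fix \<omega> assume *: "q \<omega> = emeasure (\<kappa> \<omega>) (Pair \<omega> -` C)" "\<omega> \<in> space M"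
      interpret k: prob_space "\<kappa> \<omega>" by (rule kernel_prob) fact
      have "Pair \<omega> -` (space F \<times> space \<mu> - C) = space (\<kappa> \<omega>) - Pair \<omega> -` C"
        using * by (auto simp: space_F space_kernel)
      then show "1 - q \<omega> = emeasure (\<kappa> \<omega>) (Pair \<omega> -` (space F \<times> space \<mu> - C))"
        using emeasure_compl[OF section_sets[OF C *(2)]] *
        by (simp add: k.emeasure_space_1)
    qed
    have "(\<integral>\<^sup>+\<omega>. indicator (space F \<times> space \<mu> - C) (\<omega>, Y \<omega>) \<partial>M) = (\<integral>\<^sup>+\<omega>. 1 - indicator C (\<omega>, Y \<omega>) \<partial>M)"
      using measurable_space[OF Y_meas]
      by (intro nn_integral_cong) (auto simp: indicator_def space_F)
    also have "\<dots> = (\<integral>\<^sup>+\<omega>. 1 \<partial>M) - (\<integral>\<^sup>+\<omega>. indicator C (\<omega>, Y \<omega>) \<partial>M)"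
      by (rule nn_integral_diff) (use fin q_int in \<open>auto simp: indicator_def\<close>)
    also have "\<dots> = (\<integral>\<^sup>+\<omega>. 1 \<partial>M) - (\<integral>\<^sup>+\<omega>. q \<omega> \<partial>M)" by (simp only: q_int)
    also have "\<dots> = (\<integral>\<^sup>+\<omega>. 1 - q \<omega> \<partial>M)"
      by (rule nn_integral_diff[symmetric]) (use fin q1 in auto)
    finally show "(\<integral>\<^sup>+\<omega>. indicator (space F \<times> space \<mu> - C) (\<omega>, Y \<omega>) \<partial>M) = (\<integral>\<^sup>+\<omega>. 1 - q \<omega> \<partial>M)" .
  qed measurable
next
  case (union C)
  have C [measurable]: "C i \<in> sets (F \<Otimes>\<^sub>M \<mu>)" for i using union(2) by (auto simp: sets_pair_measure)
  \<comment> \<open>A witness is chosen for each set at once; the countably many exceptional null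
    sets still form a null set.\<close>
  have "\<exists>q. \<forall>i. q i \<in> borel_measurable M \<and> (AE \<omega> in M. q i \<omega> = emeasure (\<kappa> \<omega>) (Pair \<omega> -` C i)) \<and>
      (\<integral>\<^sup>+\<omega>. indicator (C i) (\<omega>, Y \<omega>) \<partial>M) = (\<integral>\<^sup>+\<omega>. q i \<omega> \<partial>M)"
    by (rule choice, rule allI, rule union(3)[unfolded Bex_def])
  then obtain q where q [measurable]: "\<And>i. q i \<in> borel_measurable M"
    and q_eq: "\<And>i. AE \<omega> in M. q i \<omega> = emeasure (\<kappa> \<omega>) (Pair \<omega> -` C i)"
    and q_int: "\<And>i. (\<integral>\<^sup>+\<omega>. indicator (C i) (\<omega>, Y \<omega>) \<partial>M) = (\<integral>\<^sup>+\<omega>. q i \<omega> \<partial>M)" by blast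
  show ?case
  proof (intro bexI[of _ "\<lambda>\<omega>. \<Sum>i. q i \<omega>"] conjI)
    have "AE \<omega> in M. \<forall>i. q i \<omega> = emeasure (\<kappa> \<omega>) (Pair \<omega> -` C i)"
      using q_eq by (simp add: AE_all_countable)
    then show "AE \<omega> in M. (\<Sum>i. q i \<omega>) = emeasure (\<kappa> \<omega>) (Pair \<omega> -` (\<Union>i. C i))"
      using AE_space
    proof eventually_elim
      fix \<omega> assume *: "\<forall>i. q i \<omega> = emeasure (\<kappa> \<omega>) (Pair \<omega> -` C i)" "\<omega> \<in> space M"
      have "(\<Sum>i. emeasure (\<kappa> \<omega>) (Pair \<omega> -` C i)) = emeasure (\<kappa> \<omega>) (\<Union>i. Pair \<omega> -` C i)"
        using union(1) section_sets[OF C *(2)]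
        by (intro suminf_emeasure) (auto simp: disjoint_family_on_vimageI)
      then show "(\<Sum>i. q i \<omega>) = emeasure (\<kappa> \<omega>) (Pair \<omega> -` (\<Union>i. C i))"
        using * by (simp add: vimage_UN)
    qed
    have "(\<integral>\<^sup>+\<omega>. indicator (\<Union>i. C i) (\<omega>, Y \<omega>) \<partial>M) = (\<integral>\<^sup>+\<omega>. (\<Sum>i. indicator (C i) (\<omega>, Y \<omega>)) \<partial>M)"
      by (simp add: suminf_indicator[OF union(1)])
    also have "\<dots> = (\<Sum>i. \<integral>\<^sup>+\<omega>. indicator (C i) (\<omega>, Y \<omega>) \<partial>M)"
      by (rule nn_integral_suminf) measurable
    also have "\<dots> = (\<integral>\<^sup>+\<omega>. (\<Sum>i. q i \<omega>) \<partial>M)"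
      unfolding q_int by (rule nn_integral_suminf[symmetric]) measurable
    finally show "(\<integral>\<^sup>+\<omega>. indicator (\<Union>i. C i) (\<omega>, Y \<omega>) \<partial>M) = (\<integral>\<^sup>+\<omega>. (\<Sum>i. q i \<omega>) \<partial>M)" .
  qed measurable
qed

section \<open>From events to integrands\<close>

lemma section_meas:
  assumes "f \<in> borel_measurable (F \<Otimes>\<^sub>M \<mu>)" "\<omega> \<in> space M"
  shows "(\<lambda>y. f (\<omega>, y)) \<in> borel_measurable (\<kappa> \<omega>)"
  unfolding measurable_cong_sets[OF kernel_sets[OF assms(2)] refl]
  by (rule measurable_Pair2[OF assms(1)]) (simp add: space_F assms)

text \<open>Approximation by simple functions from below. The witness \<open>q\<close> is carried
  through every stage because the kernel integral itself may fail to be measurable in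
  \<omega>.\<close>

lemma disintegration:
  fixes f :: "'w \<times> 'y \<Rightarrow> ennreal"
  assumes "f \<in> borel_measurable (F \<Otimes>\<^sub>M \<mu>)"
  shows "\<exists>q \<in> borel_measurable M. (AE \<omega> in M. q \<omega> = (\<integral>\<^sup>+y. f (\<omega>, y) \<partial>\<kappa> \<omega>)) \<and>
    (\<integral>\<^sup>+\<omega>. f (\<omega>, Y \<omega>) \<partial>M) = (\<integral>\<^sup>+\<omega>. q \<omega> \<partial>M)"
  using assms
proof (induct rule: borel_measurable_induct)
  case (cong f g)
  have "(\<integral>\<^sup>+y. f (\<omega>, y) \<partial>\<kappa> \<omega>) = (\<integral>\<^sup>+y. g (\<omega>, y) \<partial>\<kappa> \<omega>)" if "\<omega> \<in> space M" for \<omega>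
    using that cong(3) by (intro nn_integral_cong) (auto simp: space_pair_measure space_F space_kernel)
  then have "AE \<omega> in M. (\<integral>\<^sup>+y. f (\<omega>, y) \<partial>\<kappa> \<omega>) = (\<integral>\<^sup>+y. g (\<omega>, y) \<partial>\<kappa> \<omega>)" by auto
  moreover have "(\<integral>\<^sup>+\<omega>. f (\<omega>, Y \<omega>) \<partial>M) = (\<integral>\<^sup>+\<omega>. g (\<omega>, Y \<omega>) \<partial>M)"
    using cong(3) measurable_space[OF Y_meas]
    by (intro nn_integral_cong) (auto simp: space_pair_measure space_F)
  moreover obtain q where "q \<in> borel_measurable M" "AE \<omega> in M. q \<omega> = (\<integral>\<^sup>+y. g (\<omega>, y) \<partial>\<kappa> \<omega>)"
    "(\<integral>\<^sup>+\<omega>. g (\<omega>, Y \<omega>) \<partial>M) = (\<integral>\<^sup>+\<omega>. q \<omega> \<partial>M)"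
    using cong(4) by blast
  ultimately show ?case by (intro bexI[of _ q]) auto
next
  case (set C)
  from disintegration_indicator[OF set] obtain q where "q \<in> borel_measurable M"
    and q: "AE \<omega> in M. q \<omega> = emeasure (\<kappa> \<omega>) (Pair \<omega> -` C)"
    and "(\<integral>\<^sup>+\<omega>. indicator C (\<omega>, Y \<omega>) \<partial>M) = (\<integral>\<^sup>+\<omega>. q \<omega> \<partial>M)" by blast
  moreover have "AE \<omega> in M. q \<omega> = (\<integral>\<^sup>+y. indicator C (\<omega>, y) \<partial>\<kappa> \<omega>)"
    using q AE_space
  proof eventually_elim
    fix \<omega> assume *: "q \<omega> = emeasure (\<kappa> \<omega>) (Pair \<omega> -` C)" "\<omega> \<in> space M"
    have "(\<integral>\<^sup>+y. indicator C (\<omega>, y) \<partial>\<kappa> \<omega>) = (\<integral>\<^sup>+y. indicator (Pair \<omega> -` C) y \<partial>\<kappa> \<omega>)"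
      by (intro nn_integral_cong) (simp add: indicator_def)
    then show "q \<omega> = (\<integral>\<^sup>+y. indicator C (\<omega>, y) \<partial>\<kappa> \<omega>)"
      using * section_sets[OF set *(2)] by simp
  qed
  ultimately show ?case by (intro bexI[of _ q]) auto
next
  case (mult u c)
  note [measurable] = mult(2)
  from mult(4) obtain q where [measurable]: "q \<in> borel_measurable M"
    and q: "AE \<omega> in M. q \<omega> = (\<integral>\<^sup>+y. u (\<omega>, y) \<partial>\<kappa> \<omega>)" "(\<integral>\<^sup>+\<omega>. u (\<omega>, Y \<omega>) \<partial>M) = (\<integral>\<^sup>+\<omega>. q \<omega> \<partial>M)"
    by blast
  show ?case
  proof (intro bexI[of _ "\<lambda>\<omega>. c * q \<omega>"] conjI)
    show "AE \<omega> in M. c * q \<omega> = (\<integral>\<^sup>+y. c * u (\<omega>, y) \<partial>\<kappa> \<omega>)"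
      using q(1) AE_space
      by eventually_elim (simp add: nn_integral_cmult section_meas[OF mult(2)])
    show "(\<integral>\<^sup>+\<omega>. c * u (\<omega>, Y \<omega>) \<partial>M) = (\<integral>\<^sup>+\<omega>. c * q \<omega> \<partial>M)"
      by (simp add: nn_integral_cmult q(2))
  qed measurable
next
  case (add u v)
  note [measurable] = add(1) add(4)
  from add(3) obtain q where [measurable]: "q \<in> borel_measurable M"
    and q: "AE \<omega> in M. q \<omega> = (\<integral>\<^sup>+y. u (\<omega>, y) \<partial>\<kappa> \<omega>)" "(\<integral>\<^sup>+\<omega>. u (\<omega>, Y \<omega>) \<partial>M) = (\<integral>\<^sup>+\<omega>. q \<omega> \<partial>M)"
    by blast
  from add(7) obtain r where [measurable]: "r \<in> borel_measurable M"
    and r: "AE \<omega> in M. r \<omega> = (\<integral>\<^sup>+y. v (\<omega>, y) \<partial>\<kappa> \<omega>)" "(\<integral>\<^sup>+\<omega>. v (\<omega>, Y \<omega>) \<partial>M) = (\<integral>\<^sup>+\<omega>. r \<omega> \<partial>M)"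
    by blast
  show ?case
  proof (intro bexI[of _ "\<lambda>\<omega>. r \<omega> + q \<omega>"] conjI)
    show "AE \<omega> in M. r \<omega> + q \<omega> = (\<integral>\<^sup>+y. v (\<omega>, y) + u (\<omega>, y) \<partial>\<kappa> \<omega>)"
      using q(1) r(1) AE_space
      by eventually_elim (simp add: nn_integral_add section_meas[OF add(1)] section_meas[OF add(4)])
    show "(\<integral>\<^sup>+\<omega>. v (\<omega>, Y \<omega>) + u (\<omega>, Y \<omega>) \<partial>M) = (\<integral>\<^sup>+\<omega>. r \<omega> + q \<omega> \<partial>M)"
      by (simp add: nn_integral_add q(2) r(2))
  qed measurable
next
  case (seq U)
  note [measurable] = seq(1)
  have "\<exists>q. \<forall>i. q i \<in> borel_measurable M \<and> (AE \<omega> in M. q i \<omega> = (\<integral>\<^sup>+y. U i (\<omega>, y) \<partial>\<kappa> \<omega>)) \<and>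
      (\<integral>\<^sup>+\<omega>. U i (\<omega>, Y \<omega>) \<partial>M) = (\<integral>\<^sup>+\<omega>. q i \<omega> \<partial>M)"
    by (rule choice, rule allI, rule seq(3)[unfolded Bex_def])
  then obtain q where [measurable]: "\<And>i. q i \<in> borel_measurable M"
    and q: "\<And>i. AE \<omega> in M. q i \<omega> = (\<integral>\<^sup>+y. U i (\<omega>, y) \<partial>\<kappa> \<omega>)"
      "\<And>i. (\<integral>\<^sup>+\<omega>. U i (\<omega>, Y \<omega>) \<partial>M) = (\<integral>\<^sup>+\<omega>. q i \<omega> \<partial>M)"
    by blast
  have inc: "U i z \<le> U (Suc i) z" for i z using \<open>incseq U\<close> unfolding incseq_Suc_iff le_fun_def by blast
  have q_all: "AE \<omega> in M. \<forall>i. q i \<omega> = (\<integral>\<^sup>+y. U i (\<omega>, y) \<partial>\<kappa> \<omega>)"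
    using q(1) by (simp add: AE_all_countable)
  show ?case
  proof (intro bexI[of _ "\<lambda>\<omega>. SUP i. q i \<omega>"] conjI)
    show "AE \<omega> in M. (SUP i. q i \<omega>) = (\<integral>\<^sup>+y. (SUP i. U i) (\<omega>, y) \<partial>\<kappa> \<omega>)"
      using q_all AE_space
    proof eventually_elim
      fix \<omega> assume *: "\<forall>i. q i \<omega> = (\<integral>\<^sup>+y. U i (\<omega>, y) \<partial>\<kappa> \<omega>)" "\<omega> \<in> space M"
      have "(\<integral>\<^sup>+y. (SUP i. U i (\<omega>, y)) \<partial>\<kappa> \<omega>) = (SUP i. \<integral>\<^sup>+y. U i (\<omega>, y) \<partial>\<kappa> \<omega>)"
        by (intro nn_integral_monotone_convergence_SUP incseq_SucI le_funI inc section_meas seq(1) *(2))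
      then show "(SUP i. q i \<omega>) = (\<integral>\<^sup>+y. (SUP i. U i) (\<omega>, y) \<partial>\<kappa> \<omega>)"
        using * by (simp add: image_comp)
    qed
    have "(\<integral>\<^sup>+\<omega>. (SUP i. U i) (\<omega>, Y \<omega>) \<partial>M) = (\<integral>\<^sup>+\<omega>. (SUP i. U i (\<omega>, Y \<omega>)) \<partial>M)"
      by (simp add: image_comp)
    also have "\<dots> = (SUP i. \<integral>\<^sup>+\<omega>. U i (\<omega>, Y \<omega>) \<partial>M)"
      by (intro nn_integral_monotone_convergence_SUP incseq_SucI le_funI inc) measurable
    also have "\<dots> = (SUP i. \<integral>\<^sup>+\<omega>. q i \<omega> \<partial>M)" by (simp only: q(2))
    \<comment> \<open>The witnesses increase only almost everywhere, namely where they equal the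
      kernel integrals.\<close>
    also have "\<dots> = (\<integral>\<^sup>+\<omega>. (SUP i. q i \<omega>) \<partial>M)"
    proof (rule nn_integral_monotone_convergence_SUP_AE[symmetric])
      show "AE \<omega> in M. q i \<omega> \<le> q (Suc i) \<omega>" for i
        using q_all by eventually_elim (simp add: nn_integral_mono inc)
    qed measurable
    finally show "(\<integral>\<^sup>+\<omega>. (SUP i. U i) (\<omega>, Y \<omega>) \<partial>M) = (\<integral>\<^sup>+\<omega>. (SUP i. q i \<omega>) \<partial>M)" .
  qed measurable
qed

text \<open>Comparing two joint integrands with equal kernel integrals keeps the possibly
  nonmeasurable kernel integral out of the conclusion.\<close>

lemma nn_integral_eq_of_kernel:
  fixes f f' :: "'w \<times> 'y \<Rightarrow> ennreal"
  assumes "f \<in> borel_measurable (F \<Otimes>\<^sub>M \<mu>)" "f' \<in> borel_measurable (F \<Otimes>\<^sub>M \<mu>)"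
    and eq: "\<And>\<omega>. \<omega> \<in> space M \<Longrightarrow> (\<integral>\<^sup>+y. f (\<omega>, y) \<partial>\<kappa> \<omega>) = (\<integral>\<^sup>+y. f' (\<omega>, y) \<partial>\<kappa> \<omega>)"
  shows "(\<integral>\<^sup>+\<omega>. f (\<omega>, Y \<omega>) \<partial>M) = (\<integral>\<^sup>+\<omega>. f' (\<omega>, Y \<omega>) \<partial>M)"
proof -
  obtain q q' where q: "AE \<omega> in M. q \<omega> = (\<integral>\<^sup>+y. f (\<omega>, y) \<partial>\<kappa> \<omega>)"
      "(\<integral>\<^sup>+\<omega>. f (\<omega>, Y \<omega>) \<partial>M) = (\<integral>\<^sup>+\<omega>. q \<omega> \<partial>M)"
    and q': "AE \<omega> in M. q' \<omega> = (\<integral>\<^sup>+y. f' (\<omega>, y) \<partial>\<kappa> \<omega>)"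
      "(\<integral>\<^sup>+\<omega>. f' (\<omega>, Y \<omega>) \<partial>M) = (\<integral>\<^sup>+\<omega>. q' \<omega> \<partial>M)"
    using disintegration[OF assms(1)] disintegration[OF assms(2)] by blast
  have "AE \<omega> in M. q \<omega> = q' \<omega>" using q(1) q'(1) AE_space by eventually_elim (simp add: eq)
  then show ?thesis unfolding q(2) q'(2) by (rule nn_integral_cong_AE)
qed

text \<open>The positive and negative parts of f - f' have finite and, by \<open>eq\<close>, equal
  kernel integrals, so the nonnegative case applies to them; \<open>ennreal\<close> produces the
  parts by cutting off at 0.\<close>

lemma integral_eq_of_kernel:
  fixes f f' :: "'w \<times> 'y \<Rightarrow> real"
  assumes [measurable]: "f \<in> borel_measurable (F \<Otimes>\<^sub>M \<mu>)" "f' \<in> borel_measurable (F \<Otimes>\<^sub>M \<mu>)"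
    and int: "\<And>\<omega>. \<omega> \<in> space M \<Longrightarrow> integrable (\<kappa> \<omega>) (\<lambda>y. f (\<omega>, y))"
      "\<And>\<omega>. \<omega> \<in> space M \<Longrightarrow> integrable (\<kappa> \<omega>) (\<lambda>y. f' (\<omega>, y))"
    and eq: "\<And>\<omega>. \<omega> \<in> space M \<Longrightarrow> (\<integral>y. f (\<omega>, y) \<partial>\<kappa> \<omega>) = (\<integral>y. f' (\<omega>, y) \<partial>\<kappa> \<omega>)"
    and f: "integrable M (\<lambda>\<omega>. f (\<omega>, Y \<omega>))" and f': "integrable M (\<lambda>\<omega>. f' (\<omega>, Y \<omega>))"
  shows "(\<integral>\<omega>. f (\<omega>, Y \<omega>) \<partial>M) = (\<integral>\<omega>. f' (\<omega>, Y \<omega>) \<partial>M)"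
proof -
  let ?d = "\<lambda>z. f z - f' z"
  have "(\<integral>\<^sup>+\<omega>. ennreal (?d (\<omega>, Y \<omega>)) \<partial>M) = (\<integral>\<^sup>+\<omega>. ennreal (- ?d (\<omega>, Y \<omega>)) \<partial>M)"
  proof (rule nn_integral_eq_of_kernel[of "\<lambda>z. ennreal (?d z)" "\<lambda>z. ennreal (- ?d z)"])
    fix \<omega> assume \<omega>: "\<omega> \<in> space M"
    let ?p = "\<integral>\<^sup>+y. ennreal (?d (\<omega>, y)) \<partial>\<kappa> \<omega>" and ?n = "\<integral>\<^sup>+y. ennreal (- ?d (\<omega>, y)) \<partial>\<kappa> \<omega>"
    have i: "integrable (\<kappa> \<omega>) (\<lambda>y. ?d (\<omega>, y))" using int[OF \<omega>] by simp
    have "enn2real ?p - enn2real ?n = 0"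
      unfolding real_lebesgue_integral_def[OF i, symmetric] using int[OF \<omega>] eq[OF \<omega>] by simp
    moreover have "?p \<noteq> \<infinity>" "?n \<noteq> \<infinity>"
      by (rule i[unfolded real_integrable_def, THEN conjunct2, THEN conjunct1])
        (rule i[unfolded real_integrable_def, THEN conjunct2, THEN conjunct2])
    ultimately show "?p = ?n" by (cases ?p; cases ?n) auto
  qed measurable
  then have "(\<integral>\<omega>. ?d (\<omega>, Y \<omega>) \<partial>M) = 0"
    using f f' by (subst real_lebesgue_integral_def) auto
  then show ?thesis using f f' by simp
qed

end

section \<open>Predictive resampling\<close>

text \<open>All subsets of a null set are measurable in the completion. This serves the reciprocal
  information at the limit, which is unspecified where the limit leaves \<Theta>.\<close>

lemma borel_measurable_completion_cong_AE:
  assumes g: "g \<in> borel_measurable M" and eq: "AE x in M. f x = g x"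
  shows "f \<in> borel_measurable (completion M)"
proof (rule measurableI)
  fix B :: "'b set" assume [measurable]: "B \<in> sets borel"
  have [measurable]: "g \<in> borel_measurable (completion M)" using g by (rule measurable_completion)
  have [measurable]: "Measurable.pred (completion M) (\<lambda>x. f x \<noteq> g x)"
    "Measurable.pred (completion M) (\<lambda>x. f x \<noteq> g x \<and> f x \<in> B)"
    by (rule sets_completion_AE, use eq in eventually_elim, simp)+
  have "Measurable.pred (completion M) (\<lambda>x. (\<not> f x \<noteq> g x \<and> g x \<in> B) \<or> (f x \<noteq> g x \<and> f x \<in> B))"
    by measurable
  also have "(\<lambda>x. (\<not> f x \<noteq> g x \<and> g x \<in> B) \<or> (f x \<noteq> g x \<and> f x \<in> B)) = (\<lambda>x. f x \<in> B)" by auto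
  finally show "f -` B \<inter> space (completion M) \<in> sets (completion M)"
    by (simp add: pred_def vimage_def Int_def conj_commute)
qed simp

text \<open>For K >= 0 the excess is at most f on the event f > K and 0 elsewhere, so it inherits
  the tail bound.\<close>

lemma uniformly_integrable_excess:
  assumes ui: "uniformly_integrable M I f" and nonneg: "\<And>i \<omega>. 0 \<le> f i \<omega>" and "0 < e"
  shows "\<exists>K\<ge>0. \<forall>i\<in>I. (\<integral>\<^sup>+\<omega>. ennreal (max 0 (f i \<omega> - K)) \<partial>M) \<le> ennreal e"
proof -
  let ?S = "\<lambda>K::real. SUP i\<in>I. \<integral>\<^sup>+\<omega>. ennreal \<bar>f i \<omega>\<bar> * indicator {\<omega>. \<bar>f i \<omega>\<bar> > K} \<omega> \<partial>M"
  have "(?S \<longlongrightarrow> 0) at_top" using ui by (simp add: uniformly_integrable_def)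
  then have "\<forall>\<^sub>F K in at_top. ?S K < ennreal e"
    using \<open>0 < e\<close> by (intro order_tendstoD(2)) auto
  then have "\<forall>\<^sub>F K in at_top. ?S K < ennreal e \<and> 0 \<le> K"
    using eventually_ge_at_top[of 0] by eventually_elim simp
  then obtain K where K: "?S K < ennreal e" "0 \<le> K"
    by (auto dest: eventually_happens)
  have "(\<integral>\<^sup>+\<omega>. ennreal (max 0 (f i \<omega> - K)) \<partial>M) \<le> ennreal e" if "i \<in> I" for i
  proof -
    have "(\<integral>\<^sup>+\<omega>. ennreal (max 0 (f i \<omega> - K)) \<partial>M)
        \<le> (\<integral>\<^sup>+\<omega>. ennreal \<bar>f i \<omega>\<bar> * indicator {\<omega>. \<bar>f i \<omega>\<bar> > K} \<omega> \<partial>M)"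
      using nonneg K(2) by (intro nn_integral_mono) (auto simp: indicator_def max_def intro!: ennreal_leI)
    also have "\<dots> \<le> ?S K" using that by (rule SUP_upper)
    finally show ?thesis using K(1) by simp
  qed
  with K(2) show ?thesis by blast
qed

section \<open>The statistical model and its filtration\<close>

locale predictive_model =
  fixes M :: "'w measure" and \<mu> :: "'y measure"
    and p :: "real \<Rightarrow> 'y \<Rightarrow> real" and \<Theta> :: "real set"
    and n :: nat and t0 :: real
    and Y :: "nat \<Rightarrow> 'w \<Rightarrow> 'y" and \<theta> :: "nat \<Rightarrow> 'w \<Rightarrow> real"
  assumes prob_M: "prob_space M"
    and density_measurable: "\<And>t. t \<in> \<Theta> \<Longrightarrow> p t \<in> borel_measurable \<mu>"
    and density_nonneg: "\<And>t y. t \<in> \<Theta> \<Longrightarrow> y \<in> space \<mu> \<Longrightarrow> p t y \<ge> 0"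
    and density_prob: "\<And>t. t \<in> \<Theta> \<Longrightarrow> prob_space (model_dist \<mu> p t)"
    and score_measurable:
      "(\<lambda>(t, y). score p \<Theta> t y) \<in> borel_measurable (restrict_space borel \<Theta> \<Otimes>\<^sub>M \<mu>)"
    and score_exists: "\<And>t. t \<in> \<Theta> \<Longrightarrow> AE y in model_dist \<mu> p t. \<exists>D. has_score p \<Theta> t y D"
    and score_integrable: "\<And>t. t \<in> \<Theta> \<Longrightarrow> integrable (model_dist \<mu> p t) (score p \<Theta> t)"
    and score_mean_zero: "\<And>t. t \<in> \<Theta> \<Longrightarrow> (\<integral>y. score p \<Theta> t y \<partial>model_dist \<mu> p t) = 0"
    and score_square_integrable:
      "\<And>t. t \<in> \<Theta> \<Longrightarrow> integrable (model_dist \<mu> p t) (\<lambda>y. (score p \<Theta> t y)\<^sup>2)"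
    and fisher_continuous: "\<And>t. t \<in> \<Theta> \<Longrightarrow> continuous (at t within \<Theta>) (fisher \<mu> p \<Theta>)"
    and fisher_pos: "\<And>t. t \<in> \<Theta> \<Longrightarrow> fisher \<mu> p \<Theta> t > 0"
    and resampling: "predictive_resampling M \<mu> p \<Theta> n t0 Y \<theta>"
    and unif_int: "uniformly_integrable M {n<..} (\<lambda>N \<omega>. (Zinc \<mu> p \<Theta> Y \<theta> N \<omega>)\<^sup>2)"
    and limit_in: "AE \<omega> in M. theta_inf \<theta> \<omega> \<in> \<Theta>"
begin

sublocale prob_space M by (rule prob_M)

abbreviation "info \<equiv> fisher \<mu> p \<Theta>"
abbreviation "\<F> \<equiv> past M \<mu> Y n"
abbreviation "law \<equiv> model_dist \<mu> p"

lemma start: "\<omega> \<in> space M \<Longrightarrow> \<theta> n \<omega> = t0"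
  and theta_in: "n \<le> N \<Longrightarrow> \<omega> \<in> space M \<Longrightarrow> \<theta> N \<omega> \<in> \<Theta>"
  and Y_meas: "n < N \<Longrightarrow> Y N \<in> M \<rightarrow>\<^sub>M \<mu>"
  and Y_law: "n < N \<Longrightarrow> A \<in> sets \<mu> \<Longrightarrow> AE \<omega> in M.
      real_cond_exp M (\<F> (N - 1)) (\<lambda>\<omega>'. indicator A (Y N \<omega>')) \<omega> = measure (law (\<theta> (N - 1) \<omega>)) A"
  and theta_step: "n < N \<Longrightarrow> \<omega> \<in> space M \<Longrightarrow>
      \<theta> N \<omega> = \<theta> (N - 1) \<omega> + (1 / real N) * Zinc \<mu> p \<Theta> Y \<theta> N \<omega>"
  using resampling by (auto simp: predictive_resampling_def)

lemma t0_in: "t0 \<in> \<Theta>"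
  using not_empty start theta_in[of n] by auto

lemma past_generators: "(\<Union>i\<in>{n<..N}. {Y i -` A \<inter> space M | A. A \<in> sets \<mu>}) \<subseteq> Pow (space M)"
  by auto

lemma space_past [simp]: "space (\<F> N) = space M"
  unfolding past_def by (rule space_measure_of[OF past_generators])

lemma sets_past: "sets (\<F> N) = sigma_sets (space M) (\<Union>i\<in>{n<..N}. {Y i -` A \<inter> space M | A. A \<in> sets \<mu>})"
  unfolding past_def by (rule sets_measure_of[OF past_generators])

lemma past_subalgebra: "subalgebra M (\<F> N)"
proof -
  have "sigma_sets (space M) (\<Union>i\<in>{n<..N}. {Y i -` A \<inter> space M | A. A \<in> sets \<mu>}) \<subseteq> sets M"
    by (rule sets.sigma_sets_subset) (auto intro: measurable_sets[OF Y_meas])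
  then show ?thesis by (simp add: subalgebra_def sets_past)
qed

lemma past_mono: "N \<le> N' \<Longrightarrow> subalgebra (\<F> N') (\<F> N)"
  unfolding subalgebra_def sets_past space_past by (intro conjI refl sigma_sets_mono' UN_mono) auto

lemma Y_past: "n < i \<Longrightarrow> i \<le> N \<Longrightarrow> Y i \<in> \<F> N \<rightarrow>\<^sub>M \<mu>"
  using measurable_space[OF Y_meas]
  by (intro measurableI, simp, unfold sets_past space_past, intro sigma_sets.Basic UN_I[of i]) auto

text \<open>\<Theta> is an arbitrary set of reals, so continuity within \<Theta> gives measurability
  for the trace of the Borel sets on \<Theta>; the estimates are accordingly treated as maps into
  this restricted space.\<close>

lemma info_meas [measurable]: "info \<in> borel_measurable (restrict_space borel \<Theta>)"
  using fisher_continuous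
  by (intro borel_measurable_continuous_on_restrict) (simp add: continuous_on_eq_continuous_within)

lemma score_compose:
  assumes "f \<in> N \<rightarrow>\<^sub>M restrict_space borel \<Theta>" "h \<in> N \<rightarrow>\<^sub>M \<mu>"
  shows "(\<lambda>x. score p \<Theta> (f x) (h x)) \<in> borel_measurable N"
  using measurable_compose[OF measurable_Pair[OF assms] score_measurable] by simp

text \<open>Adaptedness is derived from the recursion: the new value is a jointly measurable
  function of the previous one and the new observation.\<close>

lemma theta_past: "n \<le> N \<Longrightarrow> \<theta> N \<in> \<F> N \<rightarrow>\<^sub>M restrict_space borel \<Theta>"
proof (induction N rule: dec_induct)
  case base
  have "(\<lambda>_. t0) \<in> \<F> n \<rightarrow>\<^sub>M restrict_space borel \<Theta>"
    using t0_in by (intro measurable_const) (simp add: space_restrict_space)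
  then show ?case
    by (subst measurable_cong[where g = "\<lambda>_. t0"]) (auto simp: start)
next
  case (step N)
  have th: "\<theta> N \<in> \<F> (Suc N) \<rightarrow>\<^sub>M restrict_space borel \<Theta>"
    by (rule measurable_from_subalg[OF past_mono step.IH]) simp
  have th': "\<theta> N \<in> borel_measurable (\<F> (Suc N))"
    using th by (simp add: measurable_restrict_space2_iff)
  have s: "(\<lambda>\<omega>. score p \<Theta> (\<theta> N \<omega>) (Y (Suc N) \<omega>)) \<in> borel_measurable (\<F> (Suc N))"
    by (rule score_compose[OF th Y_past]) (use step in auto)
  have i: "(\<lambda>\<omega>. info (\<theta> N \<omega>)) \<in> borel_measurable (\<F> (Suc N))"
    using measurable_compose[OF th info_meas] .
  have "(\<lambda>\<omega>. \<theta> N \<omega> + (1 / real (Suc N)) * (inverse (info (\<theta> N \<omega>)) * score p \<Theta> (\<theta> N \<omega>) (Y (Suc N) \<omega>)))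
      \<in> borel_measurable (\<F> (Suc N))"
    using th' s i by measurable
  moreover have "\<theta> (Suc N) \<omega> = \<theta> N \<omega> + (1 / real (Suc N)) * (inverse (info (\<theta> N \<omega>)) * score p \<Theta> (\<theta> N \<omega>) (Y (Suc N) \<omega>))"
    if "\<omega> \<in> space M" for \<omega>
    using theta_step[of "Suc N"] that step(1) by (simp add: Zinc_def)
  ultimately have "\<theta> (Suc N) \<in> borel_measurable (\<F> (Suc N))"
    by (subst measurable_cong) auto
  then show ?case using theta_in[of "Suc N"] step(1) by (intro measurable_restrict_space2) auto
qed

lemma theta_borel_past: "n \<le> N \<Longrightarrow> \<theta> N \<in> borel_measurable (\<F> N)"
  using theta_past by (simp add: measurable_restrict_space2_iff)

lemma info_past: "n \<le> N \<Longrightarrow> (\<lambda>\<omega>. info (\<theta> N \<omega>)) \<in> borel_measurable (\<F> N)"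
  using measurable_compose[OF theta_past info_meas] .

lemma info_pos: "n \<le> N \<Longrightarrow> \<omega> \<in> space M \<Longrightarrow> 0 < info (\<theta> N \<omega>)"
  using fisher_pos theta_in by blast

text \<open>The innovation that leads from \<open>\<theta> k\<close> to \<open>\<theta> (k + 1)\<close> carries the index \<open>k\<close>, and all sequences
  are extended by constants below \<open>n\<close> so that the martingale starts at index 0.\<close>

definition "innov k \<omega> = (if k < n then 0 else Zinc \<mu> p \<Theta> Y \<theta> (Suc k) \<omega>)"
definition "cvar k \<omega> = (if k < n then 0 else inverse (info (\<theta> k \<omega>)))"
definition "est k = (if k < n then (\<lambda>_. t0) else \<theta> k)"

section \<open>Conditional moments of the innovations\<close>

lemma conditional_law_Y:
  assumes k: "n \<le> k"
  shows "conditional_law M (\<F> k) \<mu> (Y (Suc k)) (\<lambda>\<omega>. law (\<theta> k \<omega>))"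
proof (intro conditional_law.intro conditional_law_axioms.intro prob_M)
  show "subalgebra M (\<F> k)" by (rule past_subalgebra)
  show "Y (Suc k) \<in> M \<rightarrow>\<^sub>M \<mu>" using k by (intro Y_meas) simp
  show "prob_space (law (\<theta> k \<omega>))" if "\<omega> \<in> space M" for \<omega>
    by (rule density_prob[OF theta_in[OF k that]])
  show "sets (law (\<theta> k \<omega>)) = sets \<mu>" for \<omega> by (simp add: model_dist_def)
  show "AE \<omega> in M. real_cond_exp M (\<F> k) (\<lambda>\<omega>'. indicator A (Y (Suc k) \<omega>')) \<omega> = measure (law (\<theta> k \<omega>)) A"
    if "A \<in> sets \<mu>" for A
    using Y_law[of "Suc k" A] that k by simp
qed

lemma innov_integrand_meas:
  assumes "n \<le> k"
  shows "(\<lambda>(\<omega>, y). inverse (info (\<theta> k \<omega>)) * score p \<Theta> (\<theta> k \<omega>) y) \<in> borel_measurable (\<F> k \<Otimes>\<^sub>M \<mu>)"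
proof -
  have [measurable]: "(\<lambda>z. score p \<Theta> (\<theta> k (fst z)) (snd z)) \<in> borel_measurable (\<F> k \<Otimes>\<^sub>M \<mu>)"
    by (rule score_compose[OF measurable_compose[OF measurable_fst theta_past[OF assms]]]) simp
  have [measurable]: "(\<lambda>z. info (\<theta> k (fst z))) \<in> borel_measurable (\<F> k \<Otimes>\<^sub>M \<mu>)"
    by (rule measurable_compose[OF measurable_fst info_past[OF assms]])
  show ?thesis by (simp add: case_prod_beta')
qed

lemma innov_eq: "n \<le> k \<Longrightarrow> innov k \<omega> = inverse (info (\<theta> k \<omega>)) * score p \<Theta> (\<theta> k \<omega>) (Y (Suc k) \<omega>)"
  by (simp add: innov_def Zinc_def)

text \<open>The second moment of the score is the information, which cancels one of the two
  reciprocal factors.\<close>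

lemma innov_sq_kernel:
  assumes "n \<le> k" "\<omega> \<in> space M"
  shows "integrable (law (\<theta> k \<omega>)) (\<lambda>y. (inverse (info (\<theta> k \<omega>)) * score p \<Theta> (\<theta> k \<omega>) y)\<^sup>2)"
    and "(\<integral>y. (inverse (info (\<theta> k \<omega>)) * score p \<Theta> (\<theta> k \<omega>) y)\<^sup>2 \<partial>law (\<theta> k \<omega>)) = cvar k \<omega>"
proof -
  note t = theta_in[OF assms]
  show "integrable (law (\<theta> k \<omega>)) (\<lambda>y. (inverse (info (\<theta> k \<omega>)) * score p \<Theta> (\<theta> k \<omega>) y)\<^sup>2)"
    using score_square_integrable[OF t] by (simp add: power_mult_distrib)
  have "(\<integral>y. (inverse (info (\<theta> k \<omega>)) * score p \<Theta> (\<theta> k \<omega>) y)\<^sup>2 \<partial>law (\<theta> k \<omega>))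
      = (inverse (info (\<theta> k \<omega>)))\<^sup>2 * info (\<theta> k \<omega>)"
    unfolding power_mult_distrib fisher_def by simp
  also have "\<dots> = cvar k \<omega>"
    using info_pos[OF assms] assms(1) by (simp add: cvar_def power2_eq_square)
  finally show "(\<integral>y. (inverse (info (\<theta> k \<omega>)) * score p \<Theta> (\<theta> k \<omega>) y)\<^sup>2 \<partial>law (\<theta> k \<omega>)) = cvar k \<omega>" .
qed

lemma cvar_past: "cvar k \<in> borel_measurable (\<F> k)"
  using info_past[of k] unfolding cvar_def by (cases "k < n") auto

lemma cvar_nonneg: "\<omega> \<in> space M \<Longrightarrow> 0 \<le> cvar k \<omega>"
  using info_pos[of k \<omega>] by (auto simp: cvar_def)

lemma innov_past: "innov k \<in> borel_measurable (\<F> (Suc k))"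
proof (cases "k < n")
  case False
  then have k: "n \<le> k" by simp
  have th: "\<theta> k \<in> \<F> (Suc k) \<rightarrow>\<^sub>M restrict_space borel \<Theta>"
    by (rule measurable_from_subalg[OF past_mono theta_past[OF k]]) simp
  have "(\<lambda>\<omega>. score p \<Theta> (\<theta> k \<omega>) (Y (Suc k) \<omega>)) \<in> borel_measurable (\<F> (Suc k))"
    by (rule score_compose[OF th Y_past]) (use k in auto)
  then show ?thesis
    using measurable_compose[OF th info_meas] unfolding innov_eq[OF k, abs_def] by measurable
qed (simp add: innov_def[abs_def])

lemma innov_meas [measurable]: "innov k \<in> borel_measurable M"
  by (rule measurable_from_subalg[OF past_subalgebra innov_past])

lemma cvar_meas [measurable]: "cvar k \<in> borel_measurable M"
  by (rule measurable_from_subalg[OF past_subalgebra cvar_past])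

lemma innov_excess:
  assumes "0 < e"
  shows "\<exists>K\<ge>0. \<forall>k. (\<integral>\<^sup>+\<omega>. ennreal (max 0 ((innov k \<omega>)\<^sup>2 - K)) \<partial>M) \<le> ennreal e"
proof -
  obtain K where K: "0 \<le> K"
      "\<And>N. n < N \<Longrightarrow> (\<integral>\<^sup>+\<omega>. ennreal (max 0 ((Zinc \<mu> p \<Theta> Y \<theta> N \<omega>)\<^sup>2 - K)) \<partial>M) \<le> ennreal e"
    using uniformly_integrable_excess[OF unif_int _ assms] by auto
  have "(\<integral>\<^sup>+\<omega>. ennreal (max 0 ((innov k \<omega>)\<^sup>2 - K)) \<partial>M) \<le> ennreal e" for k
  proof (cases "k < n")
    case True
    then show ?thesis using K(1) by (simp add: innov_def max_def)
  next
    case False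
    then show ?thesis using K(2)[of "Suc k"] by (simp add: innov_def)
  qed
  with K(1) show ?thesis by blast
qed

lemma innov_sq_integrable: "integrable M (\<lambda>\<omega>. (innov k \<omega>)\<^sup>2)"
proof -
  obtain K where K: "0 \<le> K" "(\<integral>\<^sup>+\<omega>. ennreal (max 0 ((innov k \<omega>)\<^sup>2 - K)) \<partial>M) \<le> ennreal 1"
    using innov_excess[of 1] by auto
  have "integrable M (\<lambda>\<omega>. max 0 ((innov k \<omega>)\<^sup>2 - K))"
    using K(2) by (intro integrableI_nonneg) (auto simp: order_le_less_trans)
  then have "integrable M (\<lambda>\<omega>. K + max 0 ((innov k \<omega>)\<^sup>2 - K))" by simp
  then show ?thesis
    by (rule Bochner_Integration.integrable_bound) (use K(1) in \<open>auto simp: max_def\<close>)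
qed

text \<open>The nonnegative version comes first: infinite values are allowed, so it yields
  integrability of \<open>cvar k\<close> and, later, equivalence of integrability for the two
  products with an arbitrary \<open>H\<close>.\<close>

lemma nn_variance:
  assumes k: "n \<le> k" and h: "h \<in> borel_measurable (\<F> k)"
  shows "(\<integral>\<^sup>+\<omega>. h \<omega> * ennreal ((innov k \<omega>)\<^sup>2) \<partial>M) = (\<integral>\<^sup>+\<omega>. h \<omega> * ennreal (cvar k \<omega>) \<partial>M)"
proof -
  interpret conditional_law M "\<F> k" \<mu> "Y (Suc k)" "\<lambda>\<omega>. law (\<theta> k \<omega>)" by (rule conditional_law_Y[OF k])
  note [measurable] = h innov_integrand_meas[OF k] cvar_past[of k]
  let ?z = "\<lambda>z. (\<lambda>(\<omega>, y). inverse (info (\<theta> k \<omega>)) * score p \<Theta> (\<theta> k \<omega>) y) z"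
  have "(\<integral>\<^sup>+\<omega>. h (fst (\<omega>, Y (Suc k) \<omega>)) * ennreal ((?z (\<omega>, Y (Suc k) \<omega>))\<^sup>2) \<partial>M)
      = (\<integral>\<^sup>+\<omega>. h (fst (\<omega>, Y (Suc k) \<omega>)) * ennreal (cvar k (fst (\<omega>, Y (Suc k) \<omega>))) \<partial>M)"
  proof (rule nn_integral_eq_of_kernel[of "\<lambda>z. h (fst z) * ennreal ((?z z)\<^sup>2)" "\<lambda>z. h (fst z) * ennreal (cvar k (fst z))"])
    fix \<omega> assume \<omega>: "\<omega> \<in> space M"
    interpret k: prob_space "law (\<theta> k \<omega>)" by (rule kernel_prob[OF \<omega>])
    note i = innov_sq_kernel[OF k \<omega>]
    show "(\<integral>\<^sup>+y. h (fst (\<omega>, y)) * ennreal ((?z (\<omega>, y))\<^sup>2) \<partial>law (\<theta> k \<omega>))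
        = (\<integral>\<^sup>+y. h (fst (\<omega>, y)) * ennreal (cvar k (fst (\<omega>, y))) \<partial>law (\<theta> k \<omega>))"
      using nn_integral_eq_integral[OF i(1)] i
      by (simp add: nn_integral_cmult borel_measurable_integrable k.emeasure_space_1)
  qed measurable
  then show ?thesis by (simp add: innov_eq[OF k])
qed

lemma cvar_integrable: "integrable M (cvar k)"
proof (cases "k < n")
  case False
  then have "(\<integral>\<^sup>+\<omega>. ennreal (cvar k \<omega>) \<partial>M) = (\<integral>\<^sup>+\<omega>. ennreal ((innov k \<omega>)\<^sup>2) \<partial>M)"
    using nn_variance[of k "\<lambda>_. 1"] by simp
  also have "\<dots> < \<infinity>"
    using nn_integral_eq_integral[OF innov_sq_integrable[of k]] by simp
  finally show ?thesis
    using cvar_nonneg by (intro integrableI_nonneg) auto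
qed (simp add: cvar_def[abs_def])

lemma innov_variance:
  assumes H: "H \<in> borel_measurable (\<F> k)"
  shows "(\<integral>\<omega>. H \<omega> * (innov k \<omega>)\<^sup>2 \<partial>M) = (\<integral>\<omega>. H \<omega> * cvar k \<omega> \<partial>M)"
proof (cases "k < n")
  case False
  then have k: "n \<le> k" by simp
  interpret conditional_law M "\<F> k" \<mu> "Y (Suc k)" "\<lambda>\<omega>. law (\<theta> k \<omega>)" by (rule conditional_law_Y[OF k])
  note [measurable] = H innov_integrand_meas[OF k] cvar_past[of k]
  have HM [measurable]: "H \<in> borel_measurable M" by (rule measurable_from_subalg[OF past_subalgebra H])
  let ?z = "\<lambda>z. (\<lambda>(\<omega>, y). inverse (info (\<theta> k \<omega>)) * score p \<Theta> (\<theta> k \<omega>) y) z"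
  have "(\<integral>\<^sup>+\<omega>. ennreal (norm (H \<omega> * (innov k \<omega>)\<^sup>2)) \<partial>M) = (\<integral>\<^sup>+\<omega>. ennreal \<bar>H \<omega>\<bar> * ennreal ((innov k \<omega>)\<^sup>2) \<partial>M)"
    by (simp add: abs_mult ennreal_mult)
  also have "\<dots> = (\<integral>\<^sup>+\<omega>. ennreal \<bar>H \<omega>\<bar> * ennreal (cvar k \<omega>) \<partial>M)"
    by (rule nn_variance[OF k]) measurable
  also have "\<dots> = (\<integral>\<^sup>+\<omega>. ennreal (norm (H \<omega> * cvar k \<omega>)) \<partial>M)"
    using cvar_nonneg by (intro nn_integral_cong) (simp add: abs_mult ennreal_mult)
  \<comment> \<open>If both products fail to be integrable, both integrals are 0 by convention, so
    the identity extends to unbounded \<open>H\<close>.\<close>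
  finally have iff: "integrable M (\<lambda>\<omega>. H \<omega> * (innov k \<omega>)\<^sup>2) \<longleftrightarrow> integrable M (\<lambda>\<omega>. H \<omega> * cvar k \<omega>)"
    by (simp add: integrable_iff_bounded)
  show ?thesis
  proof (cases "integrable M (\<lambda>\<omega>. H \<omega> * (innov k \<omega>)\<^sup>2)")
    case True
    have "(\<integral>\<omega>. H (fst (\<omega>, Y (Suc k) \<omega>)) * (?z (\<omega>, Y (Suc k) \<omega>))\<^sup>2 \<partial>M)
        = (\<integral>\<omega>. H (fst (\<omega>, Y (Suc k) \<omega>)) * cvar k (fst (\<omega>, Y (Suc k) \<omega>)) \<partial>M)"
    proof (rule integral_eq_of_kernel[of "\<lambda>z. H (fst z) * (?z z)\<^sup>2" "\<lambda>z. H (fst z) * cvar k (fst z)"])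
      fix \<omega> assume \<omega>: "\<omega> \<in> space M"
      interpret k: prob_space "law (\<theta> k \<omega>)" by (rule kernel_prob[OF \<omega>])
      note i = innov_sq_kernel[OF k \<omega>]
      show "integrable (law (\<theta> k \<omega>)) (\<lambda>y. H (fst (\<omega>, y)) * (?z (\<omega>, y))\<^sup>2)" using i(1) by simp
      show "integrable (law (\<theta> k \<omega>)) (\<lambda>y. H (fst (\<omega>, y)) * cvar k (fst (\<omega>, y)))" by simp
      show "(\<integral>y. H (fst (\<omega>, y)) * (?z (\<omega>, y))\<^sup>2 \<partial>law (\<theta> k \<omega>))
          = (\<integral>y. H (fst (\<omega>, y)) * cvar k (fst (\<omega>, y)) \<partial>law (\<theta> k \<omega>))"
        using i(2) by (simp add: k.prob_space)
    qed (use True iff in \<open>simp_all add: innov_eq[OF k]\<close>)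
    then show ?thesis by (simp add: innov_eq[OF k])
  next
    case False
    then show ?thesis using iff by (simp add: not_integrable_integral_eq)
  qed
qed (simp add: cvar_def innov_def)

lemma innov_centred:
  assumes H: "H \<in> borel_measurable (\<F> k)"
  shows "(\<integral>\<omega>. H \<omega> * innov k \<omega> \<partial>M) = 0"
proof (cases "k < n \<or> \<not> integrable M (\<lambda>\<omega>. H \<omega> * innov k \<omega>)")
  \<comment> \<open>Below n the innovation is 0, and a product that is not integrable has integral 0
    by convention.\<close>
  case True
  then show ?thesis by (auto simp: innov_def not_integrable_integral_eq)
next
  case False
  then have k: "n \<le> k" and int: "integrable M (\<lambda>\<omega>. H \<omega> * innov k \<omega>)" by auto
  interpret conditional_law M "\<F> k" \<mu> "Y (Suc k)" "\<lambda>\<omega>. law (\<theta> k \<omega>)" by (rule conditional_law_Y[OF k])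
  note [measurable] = H innov_integrand_meas[OF k]
  let ?z = "\<lambda>z. (\<lambda>(\<omega>, y). inverse (info (\<theta> k \<omega>)) * score p \<Theta> (\<theta> k \<omega>) y) z"
  have "(\<integral>\<omega>. H (fst (\<omega>, Y (Suc k) \<omega>)) * ?z (\<omega>, Y (Suc k) \<omega>) \<partial>M) = (\<integral>\<omega>. 0 \<partial>M)"
  proof (rule integral_eq_of_kernel[of "\<lambda>z. H (fst z) * ?z z" "\<lambda>_. 0"])
    fix \<omega> assume \<omega>: "\<omega> \<in> space M"
    note t = theta_in[OF k \<omega>]
    show "integrable (law (\<theta> k \<omega>)) (\<lambda>y. H (fst (\<omega>, y)) * ?z (\<omega>, y))"
      using score_integrable[OF t] by simp
    show "(\<integral>y. H (fst (\<omega>, y)) * ?z (\<omega>, y) \<partial>law (\<theta> k \<omega>)) = (\<integral>y. 0 \<partial>law (\<theta> k \<omega>))"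
      using score_mean_zero[OF t] by simp
  qed (use int in \<open>simp_all add: innov_eq[OF k]\<close>)
  then show ?thesis by (simp add: innov_eq[OF k])
qed

lemma est_step:
  assumes \<omega>: "\<omega> \<in> space M"
  shows "est (Suc k) \<omega> = est k \<omega> + innov k \<omega> / real (Suc k)"
proof -
  \<comment> \<open>At Suc k = n the padding ends: \<open>est\<close> passes from the constant to
    \<theta> n, which equals t0, so the step is 0 like the padded innovation.\<close>
  consider "Suc k < n" | "Suc k = n" | "n \<le> k" by linarith
  then show ?thesis
  proof cases
    case 3
    then show ?thesis using theta_step[of "Suc k", OF _ \<omega>] by (simp add: est_def innov_def)
  qed (use start[OF \<omega>] in \<open>auto simp: est_def innov_def\<close>)
qed

sublocale mart: l2_martingale M \<F> est innov cvar
proof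
  show "est k \<in> borel_measurable (\<F> k)" for k
    using theta_borel_past[of k] by (simp add: est_def)
  show "\<exists>K\<ge>0. \<forall>k. (\<integral>\<omega>. max 0 ((innov k \<omega>)\<^sup>2 - K) \<partial>M) \<le> e" if e: "0 < e" for e :: real
  proof -
    obtain K where K: "0 \<le> K" "\<And>k. (\<integral>\<^sup>+\<omega>. ennreal (max 0 ((innov k \<omega>)\<^sup>2 - K)) \<partial>M) \<le> ennreal e"
      using innov_excess[OF e] by auto
    have "(\<integral>\<omega>. max 0 ((innov k \<omega>)\<^sup>2 - K) \<partial>M) \<le> e" for k
    proof -
      have "integrable M (\<lambda>\<omega>. max 0 ((innov k \<omega>)\<^sup>2 - K))" using innov_sq_integrable by auto
      then have "(\<integral>\<^sup>+\<omega>. ennreal (max 0 ((innov k \<omega>)\<^sup>2 - K)) \<partial>M)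
          = ennreal (\<integral>\<omega>. max 0 ((innov k \<omega>)\<^sup>2 - K) \<partial>M)"
        by (rule nn_integral_eq_integral) simp
      then show ?thesis using K(2)[of k] e by (simp only: ennreal_le_iff less_imp_le)
    qed
    with K(1) show ?thesis by blast
  qed
qed (use past_subalgebra past_mono cvar_past est_step cvar_nonneg innov_sq_integrable
    cvar_integrable innov_centred innov_variance in auto)

text \<open>Equality holds at every point, even without convergence: \<open>lim\<close> depends only
  on which numbers are limits, and the two sequences agree from n on.\<close>

lemma limit_eq: "mart.limit = theta_inf \<theta>"
proof
  fix \<omega>
  have "\<forall>\<^sub>F k in sequentially. est k \<omega> = \<theta> k \<omega>"
    using eventually_ge_at_top[of n] by eventually_elim (simp add: est_def)
  then have "((\<lambda>k. est k \<omega>) \<longlonglongrightarrow> L) \<longleftrightarrow> ((\<lambda>k. \<theta> k \<omega>) \<longlonglongrightarrow> L)" for L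
    by (rule tendsto_cong)
  then show "mart.limit \<omega> = theta_inf \<theta> \<omega>"
    by (simp add: mart.limit_def theta_inf_def lim_def)
qed

lemma est_eq: "n \<le> N \<Longrightarrow> est N = \<theta> N" by (simp add: est_def)

lemma theta_tendsto: "AE \<omega> in M. (\<lambda>N. \<theta> N \<omega>) \<longlonglongrightarrow> theta_inf \<theta> \<omega>"
  using mart.tendsto_limit
proof eventually_elim
  fix \<omega> assume *: "(\<lambda>k. est k \<omega>) \<longlonglongrightarrow> mart.limit \<omega>"
  have "\<forall>\<^sub>F k in sequentially. est k \<omega> = \<theta> k \<omega>"
    using eventually_ge_at_top[of n] by eventually_elim (simp add: est_def)
  from tendsto_cong[THEN iffD1, OF this *]
  show "(\<lambda>N. \<theta> N \<omega>) \<longlonglongrightarrow> theta_inf \<theta> \<omega>" by (simp only: limit_eq)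
qed

text \<open>A measurable version of the reciprocal information at the limit; the two agree wherever
  \<theta> converges to a point of \<Theta>.\<close>

definition "cvar_lim \<omega> = lim (\<lambda>k. cvar k \<omega>)"

lemma cvar_lim_meas [measurable]: "cvar_lim \<in> borel_measurable M"
  unfolding cvar_lim_def[abs_def] by measurable

text \<open>Continuity of the information is relative to \<Theta>; \<open>theta_in\<close> and
  \<open>limit_in\<close> place the sequence and its limit there.\<close>

lemma cvar_tendsto_inverse_info:
  "AE \<omega> in M. (\<lambda>k. cvar k \<omega>) \<longlonglongrightarrow> inverse (info (theta_inf \<theta> \<omega>)) \<and> 0 < info (theta_inf \<theta> \<omega>)"
  using theta_tendsto limit_in AE_space
proof eventually_elim
  fix \<omega> assume lim: "(\<lambda>N. \<theta> N \<omega>) \<longlonglongrightarrow> theta_inf \<theta> \<omega>" and t: "theta_inf \<theta> \<omega> \<in> \<Theta>" and \<omega>: "\<omega> \<in> space M"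
  have "\<forall>\<^sub>F k in sequentially. \<theta> k \<omega> \<in> \<Theta>"
    using eventually_ge_at_top[of n] by eventually_elim (rule theta_in[OF _ \<omega>])
  from continuous_within_tendsto_compose[OF fisher_continuous[OF t] this lim]
  have "(\<lambda>k. inverse (info (\<theta> k \<omega>))) \<longlonglongrightarrow> inverse (info (theta_inf \<theta> \<omega>))"
    using fisher_pos[OF t] by (intro tendsto_inverse) auto
  moreover have "\<forall>\<^sub>F k in sequentially. inverse (info (\<theta> k \<omega>)) = cvar k \<omega>"
    using eventually_ge_at_top[of n] by eventually_elim (simp add: cvar_def)
  ultimately have "(\<lambda>k. cvar k \<omega>) \<longlonglongrightarrow> inverse (info (theta_inf \<theta> \<omega>))"
    by (simp only: tendsto_cong)
  then show "(\<lambda>k. cvar k \<omega>) \<longlonglongrightarrow> inverse (info (theta_inf \<theta> \<omega>)) \<and> 0 < info (theta_inf \<theta> \<omega>)"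
    using fisher_pos[OF t] by simp
qed

lemma cvar_lim_eq: "AE \<omega> in M. cvar_lim \<omega> = inverse (info (theta_inf \<theta> \<omega>))"
  using cvar_tendsto_inverse_info
  by eventually_elim (simp add: cvar_lim_def limI)

sublocale clt: l2_martingale_clt M \<F> est innov cvar cvar_lim
proof
  show "AE \<omega> in M. (\<lambda>k. cvar k \<omega>) \<longlonglongrightarrow> cvar_lim \<omega>"
    using cvar_tendsto_inverse_info cvar_lim_eq by eventually_elim simp
  show "AE \<omega> in M. 0 < cvar_lim \<omega>"
    using cvar_tendsto_inverse_info cvar_lim_eq by eventually_elim simp
qed simp

lemma mean_inv_fisher_eq: "mean_inv_fisher M \<mu> p \<Theta> \<theta> = (\<integral>\<omega>. cvar_lim \<omega> \<partial>M)"
proof -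
  have eq: "AE \<omega> in M. inverse (info (theta_inf \<theta> \<omega>)) = cvar_lim \<omega>"
    using cvar_lim_eq by eventually_elim simp
  have "mean_inv_fisher M \<mu> p \<Theta> \<theta> = (\<integral>\<omega>. cvar_lim \<omega> \<partial>completion M)"
    unfolding mean_inv_fisher_def
    by (intro integral_cong_AE borel_measurable_completion_cong_AE[OF cvar_lim_meas eq]
        measurable_completion[OF cvar_lim_meas] AE_completion eq)
  also have "\<dots> = (\<integral>\<omega>. cvar_lim \<omega> \<partial>M)" by (rule integral_completion) simp
  finally show ?thesis .
qed

section \<open>Tail variances and the two limit statements\<close>

lemma incr_eq: "n \<le> k \<Longrightarrow> \<omega> \<in> space M \<Longrightarrow> incr \<theta> (Suc k) \<omega> = innov k \<omega> / real (Suc k)"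
  using est_step[of \<omega> k] by (simp add: incr_def est_def)

text \<open>Testing \<open>innov_variance\<close> with scaled indicators of past events gives the
  characterisation of conditional expectation.\<close>

lemma cond_var_eq:
  assumes k: "n \<le> k"
  shows "AE \<omega> in M. cond_var M \<mu> Y n \<theta> (Suc k) \<omega> = cvar k \<omega> / (real (Suc k))\<^sup>2"
proof -
  interpret sigma_finite_subalgebra M "\<F> k"
    by (rule finite_measure_subalgebra_is_sigma_finite)
      (simp add: finite_measure_subalgebra_def finite_measure_subalgebra_axioms_def past_subalgebra finite_measure_axioms)
  let ?c = "(real (Suc k))\<^sup>2"
  have "AE \<omega> in M. real_cond_exp M (\<F> k) (\<lambda>\<omega>. (incr \<theta> (Suc k) \<omega>)\<^sup>2) \<omega> = cvar k \<omega> / ?c"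
  proof (rule real_cond_exp_charact)
    have "integrable M (\<lambda>\<omega>. (innov k \<omega>)\<^sup>2 / ?c)" using innov_sq_integrable by simp
    then show "integrable M (\<lambda>\<omega>. (incr \<theta> (Suc k) \<omega>)\<^sup>2)"
      by (rule Bochner_Integration.integrable_cong[THEN iffD1, rotated 2])
        (simp_all add: incr_eq[OF k] power_divide)
    show "integrable M (\<lambda>\<omega>. cvar k \<omega> / ?c)" using cvar_integrable by simp
    show "(\<lambda>\<omega>. cvar k \<omega> / ?c) \<in> borel_measurable (\<F> k)" using cvar_past[of k] by measurable
    fix A assume A: "A \<in> sets (\<F> k)"
    have H: "(\<lambda>\<omega>. indicator A \<omega> / ?c) \<in> borel_measurable (\<F> k)" using A by measurable
    have "(\<integral>\<omega>\<in>A. (incr \<theta> (Suc k) \<omega>)\<^sup>2 \<partial>M) = (\<integral>\<omega>. indicator A \<omega> / ?c * (innov k \<omega>)\<^sup>2 \<partial>M)"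
      unfolding set_lebesgue_integral_def
      by (intro Bochner_Integration.integral_cong refl) (simp add: incr_eq[OF k] power_divide)
    also have "\<dots> = (\<integral>\<omega>. indicator A \<omega> / ?c * cvar k \<omega> \<partial>M)" by (rule innov_variance[OF H])
    also have "\<dots> = (\<integral>\<omega>\<in>A. cvar k \<omega> / ?c \<partial>M)"
      unfolding set_lebesgue_integral_def by simp
    finally show "(\<integral>\<omega>\<in>A. (incr \<theta> (Suc k) \<omega>)\<^sup>2 \<partial>M) = (\<integral>\<omega>\<in>A. cvar k \<omega> / ?c \<partial>M)" .
  qed
  then show ?thesis by (simp add: cond_var_def)
qed

lemma cond_var_eq_all:
  "AE \<omega> in M. \<forall>k\<ge>n. cond_var M \<mu> Y n \<theta> (Suc k) \<omega> = cvar k \<omega> / (real (Suc k))\<^sup>2"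
proof -
  have "AE \<omega> in M. \<forall>k. n \<le> k \<longrightarrow> cond_var M \<mu> Y n \<theta> (Suc k) \<omega> = cvar k \<omega> / (real (Suc k))\<^sup>2"
    unfolding AE_all_countable using cond_var_eq by (auto intro: AE_I2)
  then show ?thesis by simp
qed

lemma summable_cond_var:
  assumes "n \<le> N"
  shows "AE \<omega> in M. summable (\<lambda>j. cond_var M \<mu> Y n \<theta> (N + 1 + j) \<omega>)"
  using cond_var_eq_all clt.var_tendsto
proof eventually_elim
  fix \<omega> assume eq: "\<forall>k\<ge>n. cond_var M \<mu> Y n \<theta> (Suc k) \<omega> = cvar k \<omega> / (real (Suc k))\<^sup>2"
    and lim: "(\<lambda>k. cvar k \<omega>) \<longlonglongrightarrow> cvar_lim \<omega>"
  have "summable (\<lambda>j. cvar (N + j) \<omega> / (real (N + j + 1))\<^sup>2)"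
    using lim by (intro summable_tail_inverse_squares convergent_imp_Bseq convergentI)
  then show "summable (\<lambda>j. cond_var M \<mu> Y n \<theta> (N + 1 + j) \<omega>)"
    using eq assms by simp
qed

lemma scaled_V_sq_tendsto: "AE \<omega> in M. (\<lambda>N. real N * V_sq M \<mu> Y n \<theta> N \<omega>) \<longlonglongrightarrow> cvar_lim \<omega>"
  using cond_var_eq_all clt.var_tendsto
proof eventually_elim
  fix \<omega> assume eq: "\<forall>k\<ge>n. cond_var M \<mu> Y n \<theta> (Suc k) \<omega> = cvar k \<omega> / (real (Suc k))\<^sup>2"
    and lim: "(\<lambda>k. cvar k \<omega>) \<longlonglongrightarrow> cvar_lim \<omega>"
  have "\<forall>\<^sub>F N in sequentially. real N * (\<Sum>j. cvar (N + j) \<omega> / (real (N + j + 1))\<^sup>2) = real N * V_sq M \<mu> Y n \<theta> N \<omega>"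
    using eventually_ge_at_top[of n] by eventually_elim (use eq in \<open>simp add: V_sq_def\<close>)
  from tendsto_cong[THEN iffD1, OF this tail_inverse_squares_limit[OF lim]]
  show "(\<lambda>N. real N * V_sq M \<mu> Y n \<theta> N \<omega>) \<longlonglongrightarrow> cvar_lim \<omega>" .
qed

lemma expectation_incr_sq:
  "n \<le> N \<Longrightarrow> (\<integral>\<omega>. (incr \<theta> (N + 1 + j) \<omega>)\<^sup>2 \<partial>M) = (\<integral>\<omega>. cvar (N + j) \<omega> \<partial>M) / (real (N + j + 1))\<^sup>2"
  using mart.increment_L2[of "N + j" 1] by (simp add: est_def incr_def)

lemma s_sq_eq:
  assumes "n \<le> N"
  shows "summable (\<lambda>j. \<integral>\<omega>. (incr \<theta> (N + 1 + j) \<omega>)\<^sup>2 \<partial>M)"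
    and "s_sq M \<theta> N = (\<integral>\<omega>. (theta_inf \<theta> \<omega> - \<theta> N \<omega>)\<^sup>2 \<partial>M)"
  unfolding s_sq_def expectation_incr_sq[OF assms]
  by (rule mart.summable_variances, unfold mart.limit_L2(2) limit_eq est_eq[OF assms], rule refl)

lemma scaled_s_sq_tendsto: "(\<lambda>N. real N * s_sq M \<theta> N) \<longlonglongrightarrow> mean_inv_fisher M \<mu> p \<Theta> \<theta>"
proof -
  have "\<forall>\<^sub>F N in sequentially. real N * (\<integral>\<omega>. (mart.limit \<omega> - est N \<omega>)\<^sup>2 \<partial>M) = real N * s_sq M \<theta> N"
    using eventually_ge_at_top[of n] by eventually_elim (simp only: s_sq_eq limit_eq est_eq)
  from tendsto_cong[THEN iffD1, OF this clt.scaled_limit_L2_tendsto]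
  show ?thesis by (simp only: mean_inv_fisher_eq)
qed

lemma V_sq_ratio_tendsto:
  "AE \<omega> in M. (\<lambda>N. V_sq M \<mu> Y n \<theta> N \<omega> / s_sq M \<theta> N) \<longlonglongrightarrow>
    inverse (info (theta_inf \<theta> \<omega>)) / mean_inv_fisher M \<mu> p \<Theta> \<theta>"
  using scaled_V_sq_tendsto cvar_lim_eq
proof eventually_elim
  fix \<omega> assume V: "(\<lambda>N. real N * V_sq M \<mu> Y n \<theta> N \<omega>) \<longlonglongrightarrow> cvar_lim \<omega>"
    and eq: "cvar_lim \<omega> = inverse (info (theta_inf \<theta> \<omega>))"
  have "mean_inv_fisher M \<mu> p \<Theta> \<theta> \<noteq> 0"
    using clt.expectation_ginf_pos by (simp add: mean_inv_fisher_eq)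
  from tendsto_divide[OF V scaled_s_sq_tendsto this]
  have lim: "(\<lambda>N. (real N * V_sq M \<mu> Y n \<theta> N \<omega>) / (real N * s_sq M \<theta> N)) \<longlonglongrightarrow>
      inverse (info (theta_inf \<theta> \<omega>)) / mean_inv_fisher M \<mu> p \<Theta> \<theta>"
    by (simp only: eq)
  have "\<forall>\<^sub>F N in sequentially. (real N * V_sq M \<mu> Y n \<theta> N \<omega>) / (real N * s_sq M \<theta> N)
      = V_sq M \<mu> Y n \<theta> N \<omega> / s_sq M \<theta> N"
    using eventually_gt_at_top[of 0] by eventually_elim simp
  from tendsto_cong[THEN iffD1, OF this lim]
  show "(\<lambda>N. V_sq M \<mu> Y n \<theta> N \<omega> / s_sq M \<theta> N) \<longlonglongrightarrow>
    inverse (info (theta_inf \<theta> \<omega>)) / mean_inv_fisher M \<mu> p \<Theta> \<theta>" .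
qed

lemma V_sq_meas: "V_sq M \<mu> Y n \<theta> N \<in> borel_measurable M"
  unfolding V_sq_def[abs_def] cond_var_def by measurable

lemma studentized_limit:
  "weak_conv_m
    (\<lambda>N. distr M borel (\<lambda>\<omega>. inverse (sqrt (V_sq M \<mu> Y n \<theta> N \<omega>)) * (theta_inf \<theta> \<omega> - \<theta> N \<omega>)))
    std_normal_distribution"
proof -
  let ?D = "\<lambda>\<theta>' N. distr M borel (\<lambda>\<omega>. inverse (sqrt (V_sq M \<mu> Y n \<theta> N \<omega>)) * (theta_inf \<theta> \<omega> - \<theta>' N \<omega>))"
  have "weak_conv_m (?D est) std_normal_distribution"
    using clt.studentized_clt[OF V_sq_meas scaled_V_sq_tendsto] by (simp only: limit_eq)
  \<comment> \<open>\<open>est\<close> and \<theta> may differ below n, but convergence of the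
    distribution functions depends only on N >= n.\<close>
  moreover have "(\<lambda>N. cdf (?D est N) x) \<longlonglongrightarrow> L \<longleftrightarrow> (\<lambda>N. cdf (?D \<theta> N) x) \<longlonglongrightarrow> L" for x L
    by (rule tendsto_cong, rule eventually_mono[OF eventually_ge_at_top[of n]]) (simp only: est_eq)
  ultimately show ?thesis by (simp only: weak_conv_m_def weak_conv_def)
qed

end

theorem theorem1:
  fixes M :: "'w measure" and \<mu> :: "'y measure"
    and p :: "real \<Rightarrow> 'y \<Rightarrow> real" and \<Theta> :: "real set"
    and n :: nat and t0 :: real
    and Y :: "nat \<Rightarrow> 'w \<Rightarrow> 'y" and \<theta> :: "nat \<Rightarrow> 'w \<Rightarrow> real"
  assumes "prob_space M"
    and density_measurable: "\<And>t. t \<in> \<Theta> \<Longrightarrow> p t \<in> borel_measurable \<mu>"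
    and density_nonneg: "\<And>t y. t \<in> \<Theta> \<Longrightarrow> y \<in> space \<mu> \<Longrightarrow> p t y \<ge> 0"
    and density_prob: "\<And>t. t \<in> \<Theta> \<Longrightarrow> prob_space (model_dist \<mu> p t)"
    and score_measurable:
      "(\<lambda>(t, y). score p \<Theta> t y) \<in> borel_measurable (restrict_space borel \<Theta> \<Otimes>\<^sub>M \<mu>)"
    and score_exists: "\<And>t. t \<in> \<Theta> \<Longrightarrow> AE y in model_dist \<mu> p t. \<exists>D. has_score p \<Theta> t y D"
    and score_integrable: "\<And>t. t \<in> \<Theta> \<Longrightarrow> integrable (model_dist \<mu> p t) (score p \<Theta> t)"
    and score_mean_zero: "\<And>t. t \<in> \<Theta> \<Longrightarrow> (\<integral>y. score p \<Theta> t y \<partial>model_dist \<mu> p t) = 0"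
    and score_square_integrable:
      "\<And>t. t \<in> \<Theta> \<Longrightarrow> integrable (model_dist \<mu> p t) (\<lambda>y. (score p \<Theta> t y)\<^sup>2)"
    and fisher_continuous: "\<And>t. t \<in> \<Theta> \<Longrightarrow> continuous (at t within \<Theta>) (fisher \<mu> p \<Theta>)"
    and fisher_pos: "\<And>t. t \<in> \<Theta> \<Longrightarrow> fisher \<mu> p \<Theta> t > 0"
    and resampling: "predictive_resampling M \<mu> p \<Theta> n t0 Y \<theta>"
    and unif_int: "uniformly_integrable M {n<..} (\<lambda>N \<omega>. (Zinc \<mu> p \<Theta> Y \<theta> N \<omega>)\<^sup>2)"
    and limit_in: "AE \<omega> in M. theta_inf \<theta> \<omega> \<in> \<Theta>"
  shows "(AE \<omega> in M. (\<lambda>N. \<theta> N \<omega>) \<longlonglongrightarrow> theta_inf \<theta> \<omega>) \<and>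
    (\<forall>N\<ge>n. (AE \<omega> in M. summable (\<lambda>j. cond_var M \<mu> Y n \<theta> (N + 1 + j) \<omega>))) \<and>
    (\<forall>N\<ge>n. summable (\<lambda>j. \<integral>\<omega>. (incr \<theta> (N + 1 + j) \<omega>)\<^sup>2 \<partial>M) \<and>
            s_sq M \<theta> N = (\<integral>\<omega>. (theta_inf \<theta> \<omega> - \<theta> N \<omega>)\<^sup>2 \<partial>M)) \<and>
    (AE \<omega> in M. (\<lambda>N. V_sq M \<mu> Y n \<theta> N \<omega> / s_sq M \<theta> N) \<longlonglongrightarrow>
       inverse (fisher \<mu> p \<Theta> (theta_inf \<theta> \<omega>)) /
         mean_inv_fisher M \<mu> p \<Theta> \<theta>) \<and>
    weak_conv_m
      (\<lambda>N. distr M borel (\<lambda>\<omega>. inverse (sqrt (V_sq M \<mu> Y n \<theta> N \<omega>)) * (theta_inf \<theta> \<omega> - \<theta> N \<omega>)))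
      std_normal_distribution"
proof -
  interpret predictive_model M \<mu> p \<Theta> n t0 Y \<theta>
    by (rule predictive_model.intro) fact+
  show ?thesis
    by (intro conjI allI impI theta_tendsto summable_cond_var s_sq_eq V_sq_ratio_tendsto studentized_limit)
qed

end
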